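(* Let $\mathfrak{M}=(V,\langle\cdot,\cdot\rangle,A)$ be a curvature model. There exist a real analytic pseudo-Riemannian manifold $\mathcal{M}=(M,g)$ and a point $P$ of $M$ such that $\mathcal{M}$ has constant scalar curvature and such that $\mathfrak{M}$ is isomorphic to the curvature model $\mathfrak{M}(\mathcal{M},P):=(T_PM,g_P,R_P)$.
   Context: Let $V$ be a finite dimensional real vector space of dimension $m$. A tensor $A\in\otimes^4(V^* )$ is an algebraic curvature tensor on $V$ if for all $x,y,z,w\in V$: $A(x,y,z,w)=-A(y,x,z,w)=A(z,w,x,y)$ and $A(x,y,z,w)+A(y,z,x,w)+A(z,x,y,w)=0$. A curvature model is a triple $(V,\langle\cdot,\cdot\rangle,A)$ where $A$ is an algebraic curvature tensor on $V$ and $\langle\cdot,\cdot\rangle$ is a non-degenerate symmetric bilinear form of some signature $(p,q)$ on $V$. Two curvature models $(V_1,\langle\cdot,\cdot\rangle_1,A_1)$ and $(V_2,\langle\cdot,\cdot\rangle_2,A_2)$ are isomorphic if there is a linear isomorphism $\phi:V_1\to V_2$ with $\phi^*\langle\cdot,\cdot\rangle_2=\langle\cdot,\cdot\rangle_1$ and $\phi^*A_2=A_1$. For a basis $\{e_i\}$ of $V$ put $\varepsilon_{ij}=\langle e_i,e_j\rangle$, $A_{ijkl}=A(e_i,e_j,e_k,e_l)$, and let $\varepsilon^{ij}$ be the inverse matrix; the scalar curvature of the model is $\tau=\varepsilon^{il}\varepsilon^{jk}A_{ijkl}$ (summing over repeated indices). For a pseudo-Riemannian manifold $\mathcal{M}=(M,g)$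 with Levi-Civita connection $\nabla$, the curvature tensor is $R(x,y,z,w)=g((\nabla_x\nabla_y-\nabla_y\nabla_x-\nabla_{[x,y]})z,w)$, and the scalar curvature of $\mathcal{M}$ at a point $Q$ is that of the curvature model $(T_QM,g_Q,R_Q)$. *)

theory Defs
  imports "HOL-Analysis.Analysis" "HOL-Library.Function_Algebras"
begin

section \<open>Linear algebra on subspaces\<close>

text \<open>
  Vector spaces are subspaces of a real vector space type. The tangent spaces below are
  subspaces of function types, hence the pointwise vector space structure on functions.
\<close>

instantiation "fun" :: (type, real_vector) real_vector
begin

definition scaleR_fun_def: "r *\<^sub>R f = (\<lambda>x. r *\<^sub>R f x)"

instance
  by standard (auto simp: scaleR_fun_def fun_eq_iff scaleR_add_right scaleR_add_left)

end

definition finite_dim :: "'v::real_vector set \<Rightarrow> bool" where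
  "finite_dim V \<longleftrightarrow> (\<exists>B. finite B \<and> span B = V)"

definition linear_on :: "'v::real_vector set \<Rightarrow> ('v \<Rightarrow> 'w::real_vector) \<Rightarrow> bool" where
  "linear_on V f \<longleftrightarrow>
     (\<forall>x\<in>V. \<forall>y\<in>V. f (x + y) = f x + f y) \<and> (\<forall>r. \<forall>x\<in>V. f (r *\<^sub>R x) = r *\<^sub>R f x)"

definition nondegenerate_symmetric_form ::
    "'v::real_vector set \<Rightarrow> ('v \<Rightarrow> 'v \<Rightarrow> real) \<Rightarrow> bool" where
  "nondegenerate_symmetric_form V b \<longleftrightarrow>
     (\<forall>y\<in>V. linear_on V (\<lambda>x. b x y)) \<and> (\<forall>x\<in>V. linear_on V (b x)) \<and>
     (\<forall>x\<in>V. \<forall>y\<in>V. b x y = b y x) \<and>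
     (\<forall>x\<in>V. (\<forall>y\<in>V. b x y = 0) \<longrightarrow> x = 0)"

text \<open>
  For a nondegenerate symmetric form, the index (the number of negative squares) together
  with the dimension determines the signature.
\<close>

definition form_index :: "'v::real_vector set \<Rightarrow> ('v \<Rightarrow> 'v \<Rightarrow> real) \<Rightarrow> nat" where
  "form_index V b =
     Max {dim W |W. subspace W \<and> W \<subseteq> V \<and> (\<forall>w\<in>W. w \<noteq> 0 \<longrightarrow> b w w < 0)}"

text \<open>
  The inverse of the square matrix with entries \<open>G i j\<close>, \<open>i, j \<in> I\<close>, for finite \<open>I\<close>;
  entries outside \<open>I\<close> are \<open>0\<close>, which makes the inverse of an invertible matrix unique.
\<close>

definition inverse_matrix_on :: "'i set \<Rightarrow> ('i \<Rightarrow> 'i \<Rightarrow> real) \<Rightarrow> 'i \<Rightarrow> 'i \<Rightarrow> real" where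
  "inverse_matrix_on I G = (THE H.
     (\<forall>i j. i \<notin> I \<or> j \<notin> I \<longrightarrow> H i j = 0) \<and>
     (\<forall>i\<in>I. \<forall>j\<in>I. (\<Sum>k\<in>I. G i k * H k j) = (if i = j then 1 else 0)))"


section \<open>Curvature models\<close>

type_synonym 'v model =
  "'v set \<times> ('v \<Rightarrow> 'v \<Rightarrow> real) \<times> ('v \<Rightarrow> 'v \<Rightarrow> 'v \<Rightarrow> 'v \<Rightarrow> real)"

definition algebraic_curvature_tensor ::
    "'v::real_vector set \<Rightarrow> ('v \<Rightarrow> 'v \<Rightarrow> 'v \<Rightarrow> 'v \<Rightarrow> real) \<Rightarrow> bool" where
  "algebraic_curvature_tensor V A \<longleftrightarrow>
     (\<forall>x\<in>V. \<forall>y\<in>V. \<forall>z\<in>V.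
        linear_on V (\<lambda>v. A v x y z) \<and> linear_on V (\<lambda>v. A x v y z) \<and>
        linear_on V (\<lambda>v. A x y v z) \<and> linear_on V (\<lambda>v. A x y z v)) \<and>
     (\<forall>x\<in>V. \<forall>y\<in>V. \<forall>z\<in>V. \<forall>w\<in>V.
        A x y z w = - A y x z w \<and> A x y z w = A z w x y \<and>
        A x y z w + A y z x w + A z x y w = 0)"

definition curvature_model :: "'v::real_vector model \<Rightarrow> bool" where
  "curvature_model = (\<lambda>(V, b, A). subspace V \<and> finite_dim V \<and>
     nondegenerate_symmetric_form V b \<and> algebraic_curvature_tensor V A)"

definition model_isomorphic :: "'v::real_vector model \<Rightarrow> 'w::real_vector model \<Rightarrow> bool" where
  "model_isomorphic = (\<lambda>(V1, b1, A1) (V2, b2, A2).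
     \<exists>\<phi>. linear_on V1 \<phi> \<and> bij_betw \<phi> V1 V2 \<and>
       (\<forall>x\<in>V1. \<forall>y\<in>V1. b2 (\<phi> x) (\<phi> y) = b1 x y) \<and>
       (\<forall>x\<in>V1. \<forall>y\<in>V1. \<forall>z\<in>V1. \<forall>w\<in>V1. A2 (\<phi> x) (\<phi> y) (\<phi> z) (\<phi> w) = A1 x y z w))"

text \<open>
  A basis indexes itself, so the indices below run over basis vectors. The value does not
  depend on which basis is chosen.
\<close>

definition scalar_curvature :: "'v::real_vector model \<Rightarrow> real" where
  "scalar_curvature = (\<lambda>(V, b, A).
     let B = (SOME B. independent B \<and> span B = V);
         H = inverse_matrix_on B b
     in \<Sum>i\<in>B. \<Sum>j\<in>B. \<Sum>k\<in>B. \<Sum>l\<in>B. H i l * H j k * A i j k l)"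


section \<open>Real analytic manifolds\<close>

text \<open>
  The model space is \<^term>\<open>Euclidean_space n\<close>: all \<open>x :: nat \<Rightarrow> real\<close> with
  \<open>x i = 0\<close> for \<open>i \<ge> n\<close>.
\<close>

definition partial_deriv :: "nat \<Rightarrow> ((nat \<Rightarrow> real) \<Rightarrow> real) \<Rightarrow> (nat \<Rightarrow> real) \<Rightarrow> real" where
  "partial_deriv i f x = deriv (\<lambda>t. f (x(i := t))) (x i)"

text \<open>
  Near each point \<open>a\<close> of the open set \<open>U\<close>, \<open>f\<close> is the sum of a power series
  \<open>\<Sum>\<^sub>\<alpha> c\<^sub>\<alpha> (x - a)\<^sup>\<alpha>\<close> over the multi-indices \<open>\<alpha>\<close> in \<open>n\<close> variables.
\<close>

definition real_analytic_on ::
    "nat \<Rightarrow> (nat \<Rightarrow> real) set \<Rightarrow> ((nat \<Rightarrow> real) \<Rightarrow> real) \<Rightarrow> bool" where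
  "real_analytic_on n U f \<longleftrightarrow>
     (\<forall>a\<in>U. \<exists>r>0. \<exists>c :: (nat \<Rightarrow> nat) \<Rightarrow> real. \<forall>x\<in>U. (\<forall>i<n. \<bar>x i - a i\<bar> < r) \<longrightarrow>
        ((\<lambda>\<alpha>. c \<alpha> * (\<Prod>i<n. (x i - a i) ^ \<alpha> i)) has_sum f x) {\<alpha>. \<forall>i\<ge>n. \<alpha> i = 0})"

text \<open>A chart is a domain together with a coordinate map, irrelevant outside the domain.\<close>

type_synonym 'p chart = "'p set \<times> ('p \<Rightarrow> nat \<Rightarrow> real)"

definition is_chart :: "'p topology \<Rightarrow> nat \<Rightarrow> 'p chart \<Rightarrow> bool" where
  "is_chart X n = (\<lambda>(U, \<phi>). openin X U \<and> openin (Euclidean_space n) (\<phi> ` U) \<and>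
     homeomorphic_map (subtopology X U) (subtopology (Euclidean_space n) (\<phi> ` U)) \<phi>)"

definition inv_chart :: "'p chart \<Rightarrow> (nat \<Rightarrow> real) \<Rightarrow> 'p" where
  "inv_chart c = inv_into (fst c) (snd c)"

definition analytic_manifold :: "'p topology \<Rightarrow> nat \<Rightarrow> 'p chart set \<Rightarrow> bool" where
  "analytic_manifold X n \<A> \<longleftrightarrow>
     Hausdorff_space X \<and> second_countable X \<and>
     (\<forall>c\<in>\<A>. is_chart X n c) \<and> (\<Union>c\<in>\<A>. fst c) = topspace X \<and>
     (\<forall>c\<in>\<A>. \<forall>d\<in>\<A>. \<forall>k<n.
        real_analytic_on n (snd c ` (fst c \<inter> fst d)) (\<lambda>x. snd d (inv_chart c x) k))"

definition charts_at :: "'p chart set \<Rightarrow> 'p \<Rightarrow> 'p chart set" where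
  "charts_at \<A> p = {c\<in>\<A>. p \<in> fst c}"

text \<open>\<open>chart_partial c i f p\<close> is \<open>\<partial>f/\<partial>x\<^sup>i\<close> at \<open>p\<close> in the coordinates \<open>x\<close> of the chart \<open>c\<close>.\<close>

definition chart_partial :: "'p chart \<Rightarrow> nat \<Rightarrow> ('p \<Rightarrow> real) \<Rightarrow> 'p \<Rightarrow> real" where
  "chart_partial c i f p = partial_deriv i (\<lambda>x. f (inv_chart c x)) (snd c p)"

text \<open>
  A tangent vector at \<open>p\<close> assigns to each chart around \<open>p\<close> a vector of \<open>\<real>\<^sup>n\<close> (its components in
  that chart), such that components in different charts are related by the Jacobian matrix of
  the coordinate change. The value at charts not around \<open>p\<close> is \<open>0\<close> by convention.
\<close>

type_synonym 'p tvec = "'p chart \<Rightarrow> nat \<Rightarrow> real"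

definition tangent_space :: "nat \<Rightarrow> 'p chart set \<Rightarrow> 'p \<Rightarrow> 'p tvec set" where
  "tangent_space n \<A> p = {v.
     (\<forall>c k. c \<notin> charts_at \<A> p \<or> n \<le> k \<longrightarrow> v c k = 0) \<and>
     (\<forall>c\<in>charts_at \<A> p. \<forall>d\<in>charts_at \<A> p. \<forall>k<n.
        v d k = (\<Sum>i<n. chart_partial c i (\<lambda>q. snd d q k) p * v c i))}"

text \<open>The coordinate vector field \<open>\<partial>/\<partial>x\<^sup>i\<close> of the chart \<open>c\<close>.\<close>

definition coord_field :: "nat \<Rightarrow> 'p chart set \<Rightarrow> 'p chart \<Rightarrow> nat \<Rightarrow> 'p \<Rightarrow> 'p tvec" where
  "coord_field n \<A> c i p = (\<lambda>d k.
     if d \<in> charts_at \<A> p \<and> k < n then chart_partial c i (\<lambda>q. snd d q k) p else 0)"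


section \<open>Pseudo-Riemannian metrics and curvature\<close>

definition metric_coeff ::
    "nat \<Rightarrow> 'p chart set \<Rightarrow> ('p \<Rightarrow> 'p tvec \<Rightarrow> 'p tvec \<Rightarrow> real) \<Rightarrow> 'p chart \<Rightarrow> nat \<Rightarrow> nat \<Rightarrow> 'p \<Rightarrow> real" where
  "metric_coeff n \<A> g c i j p = g p (coord_field n \<A> c i p) (coord_field n \<A> c j p)"

definition analytic_pseudo_riemannian_manifold ::
    "'p topology \<Rightarrow> nat \<Rightarrow> 'p chart set \<Rightarrow> ('p \<Rightarrow> 'p tvec \<Rightarrow> 'p tvec \<Rightarrow> real) \<Rightarrow> bool" where
  "analytic_pseudo_riemannian_manifold X n \<A> g \<longleftrightarrow>
     analytic_manifold X n \<A> \<and>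
     (\<forall>p\<in>topspace X. nondegenerate_symmetric_form (tangent_space n \<A> p) (g p)) \<and>
     (\<exists>\<nu>. \<forall>p\<in>topspace X. form_index (tangent_space n \<A> p) (g p) = \<nu>) \<and>
     (\<forall>c\<in>\<A>. \<forall>i<n. \<forall>j<n.
        real_analytic_on n (snd c ` fst c) (\<lambda>x. metric_coeff n \<A> g c i j (inv_chart c x)))"

text \<open>The Levi-Civita connection is given in each chart by the Christoffel symbols \<open>\<Gamma>\<^sup>k\<^sub>i\<^sub>j\<close>.\<close>

definition christoffel ::
    "nat \<Rightarrow> 'p chart set \<Rightarrow> ('p \<Rightarrow> 'p tvec \<Rightarrow> 'p tvec \<Rightarrow> real) \<Rightarrow> 'p chart \<Rightarrow> nat \<Rightarrow> nat \<Rightarrow> nat \<Rightarrow> 'p \<Rightarrow> real"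
  where
  "christoffel n \<A> g c k i j p =
     (\<Sum>l<n. inverse_matrix_on {..<n} (\<lambda>a b. metric_coeff n \<A> g c a b p) k l *
        (chart_partial c i (metric_coeff n \<A> g c j l) p +
         chart_partial c j (metric_coeff n \<A> g c i l) p -
         chart_partial c l (metric_coeff n \<A> g c i j) p)) / 2"

text \<open>
  The two defining properties of the Levi-Civita connection (torsion-freeness and
  compatibility with the metric), in coordinates, for a symmetric invertible \<open>g\<^sub>i\<^sub>j\<close>.
\<close>

lemma christoffel_torsion_free:
  assumes "\<And>l. chart_partial c l (metric_coeff n \<A> g c i j) p = chart_partial c l (metric_coeff n \<A> g c j i) p"
  shows "christoffel n \<A> g c k i j p = christoffel n \<A> g c k j i p"
  unfolding christoffel_def using assms by (simp add: algebra_simps)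

lemma christoffel_metric:
  fixes n \<A> g c p
  defines "G \<equiv> \<lambda>i j. metric_coeff n \<A> g c i j p"
    and "\<Gamma> \<equiv> \<lambda>k i j. christoffel n \<A> g c k i j p"
    and "dG \<equiv> \<lambda>k i j. chart_partial c k (metric_coeff n \<A> g c i j) p"
  assumes sym: "\<And>i j. G i j = G j i" "\<And>k i j. dG k i j = dG k j i"
    and inv: "\<And>i j. i < n \<Longrightarrow> j < n \<Longrightarrow>
      (\<Sum>k<n. G i k * inverse_matrix_on {..<n} G k j) = (if i = j then 1 else 0)"
    and "i < n" "j < n"
  shows "dG k i j = (\<Sum>l<n. \<Gamma> l k i * G l j) + (\<Sum>l<n. \<Gamma> l k j * G i l)"
proof -
  have lower: "(\<Sum>l<n. G a l * \<Gamma> l k e) = (dG k e a + dG e k a - dG a k e) / 2"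
    if "a < n" for a e
  proof -
    let ?t = "\<lambda>m. (dG k e m + dG e k m - dG m k e) / 2"
    have "(\<Sum>l<n. G a l * \<Gamma> l k e) = (\<Sum>l<n. \<Sum>m<n. G a l * inverse_matrix_on {..<n} G l m * ?t m)"
      by (simp add: \<Gamma>_def christoffel_def dG_def G_def sum_distrib_left sum_divide_distrib algebra_simps)
    also have "\<dots> = (\<Sum>m<n. (\<Sum>l<n. G a l * inverse_matrix_on {..<n} G l m) * ?t m)"
      by (subst sum.swap) (simp only: sum_distrib_right)
    also have "\<dots> = (\<Sum>m<n. if m = a then ?t m else 0)"
      using that by (intro sum.cong) (auto simp: inv)
    finally show ?thesis using that by simp
  qed
  have "(\<Sum>l<n. \<Gamma> l k i * G l j) = (dG k i j + dG i k j - dG j k i) / 2"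
    using lower[OF \<open>j < n\<close>, of i] sym(1) by (simp add: mult.commute)
  moreover have "(\<Sum>l<n. \<Gamma> l k j * G i l) = (dG k j i + dG j k i - dG i k j) / 2"
    using lower[OF \<open>i < n\<close>, of j] by (simp add: mult.commute)
  ultimately show ?thesis using sym(2)[of k i j] by (simp add: field_simps)
qed

definition levi_civita ::
    "nat \<Rightarrow> 'p chart set \<Rightarrow> ('p \<Rightarrow> 'p tvec \<Rightarrow> 'p tvec \<Rightarrow> real) \<Rightarrow>
     ('p \<Rightarrow> 'p tvec) \<Rightarrow> ('p \<Rightarrow> 'p tvec) \<Rightarrow> 'p \<Rightarrow> 'p tvec" where
  "levi_civita n \<A> g X Y p = (\<lambda>c k.
     if c \<in> charts_at \<A> p \<and> k < n
     then \<Sum>i<n. X p c i *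
            (chart_partial c i (\<lambda>q. Y q c k) p + (\<Sum>j<n. christoffel n \<A> g c k i j p * Y p c j))
     else 0)"

definition lie_bracket ::
    "nat \<Rightarrow> 'p chart set \<Rightarrow> ('p \<Rightarrow> 'p tvec) \<Rightarrow> ('p \<Rightarrow> 'p tvec) \<Rightarrow> 'p \<Rightarrow> 'p tvec" where
  "lie_bracket n \<A> X Y p = (\<lambda>c k.
     if c \<in> charts_at \<A> p \<and> k < n
     then \<Sum>i<n. X p c i * chart_partial c i (\<lambda>q. Y q c k) p -
                  Y p c i * chart_partial c i (\<lambda>q. X q c k) p
     else 0)"

text \<open>The local vector field with constant components in the chart \<open>c\<close> extending \<open>v\<close>.\<close>

definition extend_field :: "nat \<Rightarrow> 'p chart set \<Rightarrow> 'p chart \<Rightarrow> 'p tvec \<Rightarrow> 'p \<Rightarrow> 'p tvec" where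
  "extend_field n \<A> c v q = (\<Sum>i<n. v c i *\<^sub>R coord_field n \<A> c i q)"

text \<open>
  The curvature tensor evaluates the second-order commutator on vector fields extending the
  given tangent vectors. Since it is tensorial, neither the extension nor the chart matters.
\<close>

definition curvature_tensor ::
    "nat \<Rightarrow> 'p chart set \<Rightarrow> ('p \<Rightarrow> 'p tvec \<Rightarrow> 'p tvec \<Rightarrow> real) \<Rightarrow>
     'p \<Rightarrow> 'p tvec \<Rightarrow> 'p tvec \<Rightarrow> 'p tvec \<Rightarrow> 'p tvec \<Rightarrow> real" where
  "curvature_tensor n \<A> g p x y z w =
     (let c = (SOME c. c \<in> charts_at \<A> p);
          X = extend_field n \<A> c x; Y = extend_field n \<A> c y; Z = extend_field n \<A> c z;
          D = levi_civita n \<A> g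
      in g p (D X (D Y Z) p - D Y (D X Z) p - D (lie_bracket n \<A> X Y) Z p) w)"

definition tangent_model ::
    "nat \<Rightarrow> 'p chart set \<Rightarrow> ('p \<Rightarrow> 'p tvec \<Rightarrow> 'p tvec \<Rightarrow> real) \<Rightarrow> 'p \<Rightarrow> 'p tvec model" where
  "tangent_model n \<A> g p = (tangent_space n \<A> p, g p, curvature_tensor n \<A> g p)"

definition constant_scalar_curvature ::
    "'p topology \<Rightarrow> nat \<Rightarrow> 'p chart set \<Rightarrow> ('p \<Rightarrow> 'p tvec \<Rightarrow> 'p tvec \<Rightarrow> real) \<Rightarrow> bool" where
  "constant_scalar_curvature X n \<A> g \<longleftrightarrow>
     (\<exists>\<kappa>. \<forall>q\<in>topspace X. scalar_curvature (tangent_model n \<A> g q) = \<kappa>)"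

end

theory Submission
  imports Defs "HOL-Combinatorics.Multiset_Permutations"
begin

text \<open>
  On a cube around the origin, with a single chart, consider the metric
  \<open>g = \<mu>\<^sup>2 (\<epsilon> + \<mu>\<^sup>2 Q + \<mu> \<phi> s)\<close>. Here \<open>\<epsilon>\<close> is the diagonal form of the model in an orthonormal basis, \<open>Q\<close> is
  the quadratic term of a metric in normal coordinates with the prescribed curvature tensor, \<open>\<phi>\<close> is
  an unknown function and \<open>s\<close> is a constant diagonal matrix. The matrix \<open>s\<close> is chosen such that
  among the second derivatives of \<open>\<phi>\<close> only \<open>\<partial>\<^sub>0\<^sup>2 \<phi>\<close> enters the scalar curvature linearised at the flat
  metric. With \<open>w = \<partial>\<^sub>0\<^sup>2 \<phi>\<close> and \<open>\<phi> = \<partial>\<^sub>0\<^sup>-\<^sup>2 w\<close>, the equation "the scalar curvature is constant", together with the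
  one for the inverse metric, becomes a fixed point equation which is a contraction for small \<open>\<mu>\<close>.
  This replaces the Cauchy-Kovalevskaya theorem: in the Banach algebra of power series
  \<open>\<Sum> c\<^sub>\<alpha> x\<^sup>\<alpha>\<close> with norm \<open>\<Sum> \<bar>c\<^sub>\<alpha>\<bar> \<alpha>! / \<bar>\<alpha>\<bar>!\<close> the operators \<open>\<partial>\<^sub>i \<partial>\<^sub>0\<^sup>-\<^sup>1\<close> are bounded, although the \<open>\<partial>\<^sub>i\<close> are not.
  As \<open>w\<close> then vanishes at the origin, so do the second derivatives of \<open>\<phi>\<close>, and the curvature there is
  the prescribed one.
\<close>

section \<open>The space of absolutely summable families\<close>

text \<open>The metric \<open>\<epsilon> + Q(y)\<close> has the right curvature at 0, and
  \<open>y = \<mu> x\<close> turns it into \<open>\<mu>^2 (\<epsilon> + \<mu>^2 Q(x))\<close>: the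
  cube stays fixed while the neighbourhood it describes shrinks. The deformation gets only one inner
  factor \<open>\<mu>\<close>, so that the second derivatives of the inner bracket, divided by
  \<open>\<mu>\<close>, still tend to 0 with \<open>\<mu>\<close> and \<open>w\<close>; this yields
  a contraction rather than a mere Lipschitz bound. The nonlinear part of the equation contains all
  second derivatives of \<open>\<phi>\<close>; a loss of derivatives would forbid iterating in one
  Banach space, hence the adapted norm. Making the inverse metric an unknown keeps every equation
  polynomial, so that estimates for sums and products suffice. No initial value of \<open>w\<close>
  is imposed: the prescribed constant is the scalar curvature of the model, which \<open>Q\<close>
  already produces at the origin, so the equation itself forces \<open>w = 0\<close> there.
  Dimension 1, where the coefficient \<open>1 - n\<close> of \<open>w\<close> vanishes, is harmless
  because all curvature vanishes.\<close>

typedef 'a l1 = "{f :: 'a \<Rightarrow> real. f summable_on UNIV}"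
  morphisms coeff Abs_l1
  by (rule exI[of _ "\<lambda>_. 0"]) simp

lemma coeff_summable [simp]: "coeff f summable_on A"
  using coeff[of f] by (auto intro: summable_on_subset)

lemma abs_coeff_summable [simp]: "(\<lambda>a. \<bar>coeff f a\<bar>) summable_on A"
  using summable_on_iff_abs_summable_on_real[of "coeff f" A] by simp

lemma coeff_Abs: "f summable_on UNIV \<Longrightarrow> coeff (Abs_l1 f) = f"
  by (simp add: Abs_l1_inverse)

lemma l1_eqI: "(\<And>a. coeff f a = coeff g a) \<Longrightarrow> f = g"
  by (simp add: coeff_inject[symmetric] ext)

instantiation l1 :: (type) real_normed_vector
begin

definition zero_l1 :: "'a l1" where "0 = Abs_l1 (\<lambda>_. 0)"
definition plus_l1 :: "'a l1 \<Rightarrow> 'a l1 \<Rightarrow> 'a l1" where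
  "f + g = Abs_l1 (\<lambda>a. coeff f a + coeff g a)"
definition minus_l1 :: "'a l1 \<Rightarrow> 'a l1 \<Rightarrow> 'a l1" where
  "f - g = Abs_l1 (\<lambda>a. coeff f a - coeff g a)"
definition uminus_l1 :: "'a l1 \<Rightarrow> 'a l1" where
  "- f = Abs_l1 (\<lambda>a. - coeff f a)"
definition scaleR_l1 :: "real \<Rightarrow> 'a l1 \<Rightarrow> 'a l1" where
  "scaleR r f = Abs_l1 (\<lambda>a. r * coeff f a)"
definition norm_l1 :: "'a l1 \<Rightarrow> real" where
  "norm f = (\<Sum>\<^sub>\<infinity>a. \<bar>coeff f a\<bar>)"
definition sgn_l1 :: "'a l1 \<Rightarrow> 'a l1" where "sgn_l1 f = inverse (norm f) *\<^sub>R f"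
definition dist_l1 :: "'a l1 \<Rightarrow> 'a l1 \<Rightarrow> real" where "dist_l1 f g = norm (f - g)"
definition uniformity_l1 :: "('a l1 \<times> 'a l1) filter" where
  "uniformity_l1 = (INF e\<in>{0<..}. principal {(x, y). dist x y < e})"
definition open_l1 :: "'a l1 set \<Rightarrow> bool" where
  "open_l1 U = (\<forall>x\<in>U. eventually (\<lambda>(x', y). x' = x \<longrightarrow> y \<in> U) uniformity)"

lemma coeff_ops:
  "coeff (0 :: 'a l1) = (\<lambda>_. 0)"
  "coeff (f + g) = (\<lambda>a. coeff f a + coeff g a)"
  "coeff (f - g) = (\<lambda>a. coeff f a - coeff g a)"
  "coeff (- f) = (\<lambda>a. - coeff f a)"
  "coeff (r *\<^sub>R f) = (\<lambda>a. r * coeff f a)"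
proof -
  have "(\<lambda>a. coeff f a + - 1 * coeff g a) summable_on UNIV"
    by (intro summable_on_add summable_on_cmult_right) auto
  then show "coeff (f - g) = (\<lambda>a. coeff f a - coeff g a)"
    by (simp add: minus_l1_def coeff_Abs)
qed (simp_all add: zero_l1_def plus_l1_def uminus_l1_def scaleR_l1_def coeff_Abs
    summable_on_add summable_on_cmult_right summable_on_uminus)

instance
proof
  fix f g h :: "'a l1" and r s :: real
  show "f + g + h = f + (g + h)" "f + g = g + f" "0 + f = f" "- f + f = 0" "f - g = f + - g"
    "r *\<^sub>R (f + g) = r *\<^sub>R f + r *\<^sub>R g" "(r + s) *\<^sub>R f = r *\<^sub>R f + s *\<^sub>R f"
    "r *\<^sub>R s *\<^sub>R f = (r * s) *\<^sub>R f" "1 *\<^sub>R f = f"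
    by (rule l1_eqI; simp add: coeff_ops algebra_simps)+
  show "dist f g = norm (f - g)" by (simp add: dist_l1_def)
  show "sgn f = inverse (norm f) *\<^sub>R f" by (simp add: sgn_l1_def)
  show "uniformity = (INF e\<in>{0<..}. principal {(x, y :: 'a l1). dist x y < e})"
    by (rule uniformity_l1_def)
  show "open U \<longleftrightarrow> (\<forall>x\<in>U. eventually (\<lambda>(x', y). x' = x \<longrightarrow> y \<in> U) uniformity)"
    for U :: "'a l1 set" by (rule open_l1_def)
  show "norm f = 0 \<longleftrightarrow> f = 0"
  proof
    assume "norm f = 0"
    then have "\<bar>coeff f a\<bar> = 0" for a
      by (intro nonneg_infsum_le_0D[of "\<lambda>a. \<bar>coeff f a\<bar>" UNIV]) (auto simp: norm_l1_def)
    then show "f = 0" by (intro l1_eqI) (simp add: coeff_ops)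
  qed (simp add: norm_l1_def coeff_ops)
  have "norm (f + g) \<le> (\<Sum>\<^sub>\<infinity>a. \<bar>coeff f a\<bar> + \<bar>coeff g a\<bar>)"
    unfolding norm_l1_def
    using abs_coeff_summable[of "f + g" UNIV]
    by (intro infsum_mono summable_on_add) (auto simp: coeff_ops(2))
  then show "norm (f + g) \<le> norm f + norm g"
    by (simp add: norm_l1_def infsum_add)
  show "norm (r *\<^sub>R f) = \<bar>r\<bar> * norm f"
    by (simp add: norm_l1_def coeff_ops abs_mult infsum_cmult_right')
qed

end

lemma sum_coeff_le_norm: "finite S \<Longrightarrow> (\<Sum>a\<in>S. \<bar>coeff f a\<bar>) \<le> norm f"
  unfolding norm_l1_def by (intro finite_sum_le_infsum) auto

lemma abs_coeff_le_norm: "\<bar>coeff f a\<bar> \<le> norm f"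
  using sum_coeff_le_norm[of "{a}" f] by simp

lemma norm_l1_leI:
  assumes "\<And>S. finite S \<Longrightarrow> (\<Sum>a\<in>S. \<bar>coeff f a\<bar>) \<le> B"
  shows "norm f \<le> B"
  unfolding norm_l1_def by (rule infsum_le_finite_sums) (auto intro: assms)

text \<open>A bound on all finite partial sums yields both summability and the norm estimate;
  multiplication, integration and \<open>slope\<close> are all introduced through it.\<close>

lemma coeff_Abs_bounded:
  assumes "\<And>S. finite S \<Longrightarrow> (\<Sum>a\<in>S. \<bar>f a\<bar>) \<le> B"
  shows "coeff (Abs_l1 f) = f" "norm (Abs_l1 f) \<le> B"
proof -
  have "(\<lambda>a. \<bar>f a\<bar>) summable_on UNIV"
    by (rule nonneg_bdd_above_summable_on) (auto intro!: bdd_aboveI2 assms)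
  then show c: "coeff (Abs_l1 f) = f"
    using summable_on_iff_abs_summable_on_real[of f UNIV] by (simp add: coeff_Abs)
  show "norm (Abs_l1 f) \<le> B"
    by (rule norm_l1_leI) (simp add: c assms)
qed

instance l1 :: (type) banach
proof
  fix X :: "nat \<Rightarrow> 'a l1"
  assume X: "Cauchy X"
  have "Cauchy (\<lambda>n. coeff (X n) a)" for a
  proof (rule CauchyI)
    fix e :: real assume "e > 0"
    then obtain N where N: "\<And>m n. m \<ge> N \<Longrightarrow> n \<ge> N \<Longrightarrow> norm (X m - X n) < e"
      using CauchyD[OF X] by blast
    have "norm (coeff (X m) a - coeff (X n) a) < e" if "m \<ge> N" "n \<ge> N" for m n
      using N[OF that] abs_coeff_le_norm[of "X m - X n" a] by (simp add: coeff_ops)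
    then show "\<exists>N. \<forall>m\<ge>N. \<forall>n\<ge>N. norm (coeff (X m) a - coeff (X n) a) < e" by blast
  qed
  then have "convergent (\<lambda>n. coeff (X n) a)" for a by (simp add: Cauchy_convergent)
  then obtain c where c: "(\<lambda>n. coeff (X n) a) \<longlonglongrightarrow> c a" for a
    unfolding convergent_def by metis
  \<comment> \<open>Only finitely many coefficients are compared at a time: there the limit passes
    through the sum, and the bound does not depend on \<open>S\<close>.\<close>
  have bound: "(\<Sum>a\<in>S. \<bar>c a - coeff (X m) a\<bar>) \<le> e"
    if N: "\<And>m n. m \<ge> N \<Longrightarrow> n \<ge> N \<Longrightarrow> norm (X m - X n) < e" and "m \<ge> N" "finite S" for e N m S
  proof (rule tendsto_upperbound)
    show "(\<lambda>n. \<Sum>a\<in>S. \<bar>coeff (X n) a - coeff (X m) a\<bar>) \<longlonglongrightarrow> (\<Sum>a\<in>S. \<bar>c a - coeff (X m) a\<bar>)"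
      by (intro tendsto_intros c)
    have "(\<Sum>a\<in>S. \<bar>coeff (X n) a - coeff (X m) a\<bar>) \<le> e" if "n \<ge> N" for n
      using sum_coeff_le_norm[OF \<open>finite S\<close>, of "X n - X m"] N[OF that \<open>m \<ge> N\<close>]
      by (simp add: coeff_ops)
    then show "eventually (\<lambda>n. (\<Sum>a\<in>S. \<bar>coeff (X n) a - coeff (X m) a\<bar>) \<le> e) sequentially"
      by (auto simp: eventually_sequentially)
  qed simp
  obtain N where N: "\<And>m n. m \<ge> N \<Longrightarrow> n \<ge> N \<Longrightarrow> norm (X m - X n) < 1"
    using CauchyD[OF X, of 1] by auto
  have "(\<Sum>a\<in>S. \<bar>c a - coeff (X N) a\<bar>) \<le> 1" if "finite S" for S
    using bound[OF N order_refl that] by simp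
  note d = coeff_Abs_bounded(1)[OF this]
  \<comment> \<open>\<open>c\<close> is not yet known to be summable, but its difference from the
    single member \<open>X N\<close> has bounded partial sums; the limit is built from that
    difference.\<close>
  define L where "L = X N + Abs_l1 (\<lambda>a. c a - coeff (X N) a)"
  have L: "coeff L = c" by (simp add: L_def coeff_ops d)
  have "X \<longlonglongrightarrow> L"
  proof (rule LIMSEQ_I)
    fix e :: real assume e: "e > 0"
    then obtain N where N: "\<And>m n. m \<ge> N \<Longrightarrow> n \<ge> N \<Longrightarrow> norm (X m - X n) < e/2"
      using CauchyD[OF X, of "e/2"] by auto
    have "norm (X m - L) < e" if "m \<ge> N" for m
    proof -
      have "norm (L - X m) \<le> e/2"
        by (rule norm_l1_leI, unfold coeff_ops L) (rule bound[OF N that])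
      then show ?thesis using e by (simp add: norm_minus_commute)
    qed
    then show "\<exists>N. \<forall>m\<ge>N. norm (X m - L) < e" by blast
  qed
  then show "convergent X" by (auto simp: convergent_def)
qed

section \<open>Normalised power series\<close>

lemma finite_submultisets [simp]: "finite {b. b \<subseteq># a}"
proof (rule finite_subset)
  show "{b. b \<subseteq># a} \<subseteq> mset ` {xs. set xs \<subseteq> set_mset a \<and> length xs \<le> size a}"
  proof
    fix b assume "b \<in> {b. b \<subseteq># a}"
    then have "b \<subseteq># a" by simp
    moreover obtain xs where "mset xs = b" using ex_mset by blast
    ultimately show "b \<in> mset ` {xs. set xs \<subseteq> set_mset a \<and> length xs \<le> size a}"
      by (intro image_eqI[of _ _ xs]) (auto dest: size_mset_mono mset_subset_eqD simp: set_mset_mset[symmetric] simp del: set_mset_mset)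
  qed
qed (simp add: finite_lists_length_le)

text \<open>The multinomial coefficient \<open>|a|! / a!\<close>. As a count of lists it gets its
  inequalities from injections instead of from factorials.\<close>

definition arrangements :: "'a multiset \<Rightarrow> real" where
  "arrangements a = real (card (permutations_of_multiset a))"

lemma arrangements_pos [simp]: "arrangements a > 0"
  by (simp add: arrangements_def card_gt_0_iff)

lemma arrangements_nonneg [simp]: "0 \<le> arrangements a"
  using arrangements_pos[of a] by linarith

lemma arrangements_neq_0 [simp]: "arrangements a \<noteq> 0"
  using arrangements_pos[of a] by linarith

lemma arrangements_empty [simp]: "arrangements {#} = 1"
  by (simp add: arrangements_def)

text \<open>Differentiating the weighted monomial of \<open>add_mset i a\<close> in direction
  \<open>i\<close> brings down \<open>count a i + 1\<close>; this identity replaces it by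
  \<open>size a + 1\<close>, which does not depend on the direction. That independence is why
  \<open>slope\<close> only moves coefficients.\<close>

lemma arrangements_add:
  "arrangements (add_mset i a) * (real (count a i) + 1) = (real (size a) + 1) * arrangements a"
proof -
  have "real (card (permutations_of_multiset (a + {#i#})) * (count a i + 1)) =
    real ((size a + 1) * card (permutations_of_multiset a))"
    by (simp only: card_permutations_of_multiset_insert_aux)
  then show ?thesis by (simp add: arrangements_def algebra_simps)
qed

text \<open>Concatenating an ordering of \<open>a\<close> with one of \<open>b\<close> is injective
  because the lengths are fixed. This inequality makes the norm submultiplicative.\<close>

lemma arrangements_mult_le: "arrangements a * arrangements b \<le> arrangements (a + b)"
proof -
  let ?P = "permutations_of_multiset"
  have inj: "inj_on (\<lambda>(xs, ys). xs @ ys) (?P a \<times> ?P b)"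
    by (rule inj_onI) (auto dest!: length_finite_permutations_of_multiset)
  have "card (?P a \<times> ?P b) \<le> card (?P (a + b))"
    by (rule card_inj_on_le[OF inj _ finite_permutations_of_multiset])
      (auto simp: permutations_of_multiset_def)
  then show ?thesis
    by (simp add: arrangements_def card_cartesian_product of_nat_mult[symmetric] del: of_nat_mult)
qed

lemma arrangements_le:
  assumes "set_mset a \<subseteq> {..<n}"
  shows "arrangements a \<le> real n ^ size a"
proof -
  have "card (permutations_of_multiset a) \<le> card {xs. set xs \<subseteq> {..<n} \<and> length xs = size a}"
    using assms
    by (intro card_mono finite_lists_length_eq) (auto simp: permutations_of_multiset_def)
  then show ?thesis
    by (simp add: arrangements_def card_lists_length_eq of_nat_power[symmetric] del: of_nat_power)
qed

section \<open>Monomials on a cube\<close>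

definition monomial :: "(nat \<Rightarrow> real) \<Rightarrow> nat multiset \<Rightarrow> real" where
  "monomial x a = (\<Prod>i\<in>#a. x i)"

lemma monomial_empty [simp]: "monomial x {#} = 1"
  and monomial_add_mset [simp]: "monomial x (add_mset i a) = x i * monomial x a"
  and monomial_plus [simp]: "monomial x (a + b) = monomial x a * monomial x b"
  by (simp_all add: monomial_def)

lemma monomial_eq_0: "i \<in># a \<Longrightarrow> x i = 0 \<Longrightarrow> monomial x a = 0"
  by (auto simp: monomial_def prod_mset_zero_iff)

lemma abs_monomial_le:
  assumes "\<And>i. i \<in># a \<Longrightarrow> \<bar>x i\<bar> \<le> r"
  shows "\<bar>monomial x a\<bar> \<le> r ^ size a"
  using assms
proof (induction a)
  case (add i a)
  then have "0 \<le> r" using abs_ge_zero[of "x i"] by (meson order_trans union_single_eq_member)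
  with add show ?case by (auto simp: abs_mult intro!: mult_mono)
qed simp

lemma arrangements_monomial_le:
  assumes "\<And>i. i < n \<Longrightarrow> \<bar>x i\<bar> \<le> r" "\<And>i. n \<le> i \<Longrightarrow> x i = 0" "r \<ge> 0"
  shows "arrangements a * \<bar>monomial x a\<bar> \<le> (real n * r) ^ size a"
proof (cases "set_mset a \<subseteq> {..<n}")
  case True
  have "arrangements a * \<bar>monomial x a\<bar> \<le> real n ^ size a * r ^ size a"
    using True assms by (intro mult_mono arrangements_le abs_monomial_le) auto
  then show ?thesis by (simp add: power_mult_distrib)
next
  case False
  then obtain i where "i \<in># a" "n \<le> i" by (meson lessThan_iff not_le subsetI)
  then show ?thesis using assms monomial_eq_0[of i a x] by simp
qed

text \<open>On a cube of half side \<open>r\<close> the weighted monomials are at most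
  \<open>(n r)^|a|\<close>, so \<open>1/n\<close> would do for convergence. With
  \<open>1/(n+1)\<close> the ratio \<open>n r\<close> stays below 1, which also absorbs the factor
  \<open>|a|\<close> in differentiated series, and \<open>n = 0\<close> is no exception.\<close>

definition cube :: "nat \<Rightarrow> (nat \<Rightarrow> real) set" where
  "cube n = {x. (\<forall>i<n. \<bar>x i\<bar> < 1 / (real n + 1)) \<and> (\<forall>i\<ge>n. x i = 0)}"

lemma cube_fun_upd:
  "x \<in> cube n \<Longrightarrow> i < n \<Longrightarrow> x(i := t) \<in> cube n \<longleftrightarrow> \<bar>t\<bar> < 1 / (real n + 1)"
  by (auto simp: cube_def)

lemma arrangements_monomial_le_1:
  assumes "x \<in> cube n"
  shows "arrangements a * \<bar>monomial x a\<bar> \<le> 1"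
proof -
  have "arrangements a * \<bar>monomial x a\<bar> \<le> (real n * (1 / (real n + 1))) ^ size a"
    using assms by (intro arrangements_monomial_le) (auto simp: cube_def less_imp_le)
  also have "\<dots> \<le> 1" by (intro power_le_one) auto
  finally show ?thesis .
qed

text \<open>Equality is known on the cube only; for \<open>k < n\<close> the coordinate line through
  \<open>x\<close> stays inside it near \<open>x\<close>, which is all that the derivative
  sees.\<close>

lemma cube_has_derivative_cong:
  assumes "x \<in> cube n" "k < n" and eq: "\<And>y. y \<in> cube n \<Longrightarrow> f y = g y"
    and f: "((\<lambda>t. f (x(k := t))) has_real_derivative D) (at (x k))"
  shows "((\<lambda>t. g (x(k := t))) has_real_derivative D) (at (x k))"
proof (rule has_field_derivative_transform_within_open[OF f])
  show "open {t. \<bar>t\<bar> < 1 / (real n + 1)}" by (intro open_Collect_less continuous_intros)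
qed (use assms(1,2) cube_fun_upd[OF assms(1,2)] eq in \<open>auto simp: cube_def\<close>)

text \<open>The coefficient of the monomial \<open>x\<^sup>a\<close> is \<open>coeff f a \<bar>a\<bar>! / a!\<close>, so the norm of a power series
  \<open>\<Sum> c\<^sub>a x\<^sup>a\<close> is \<open>\<Sum> \<bar>c\<^sub>a\<bar> a! / \<bar>a\<bar>!\<close>.\<close>

definition eval :: "nat multiset l1 \<Rightarrow> (nat \<Rightarrow> real) \<Rightarrow> real" where
  "eval f x = (\<Sum>\<^sub>\<infinity>a. coeff f a * (arrangements a * monomial x a))"

section \<open>Evaluation of series\<close>

lemma summable_coeff_bounded:
  assumes "\<And>a. \<bar>h a\<bar> \<le> B"
  shows "(\<lambda>a. coeff f a * h a :: real) summable_on A"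
proof (rule abs_summable_summable, rule summable_on_comparison_test)
  show "(\<lambda>a. B * \<bar>coeff f a\<bar>) summable_on A"
    by (intro summable_on_cmult_right) simp
  show "norm (coeff f a * h a) \<le> B * \<bar>coeff f a\<bar>" for a
    using mult_right_mono[OF assms[of a], of "\<bar>coeff f a\<bar>"]
    by (simp add: abs_mult mult.commute)
qed simp

lemma eval_has_sum:
  assumes "x \<in> cube n"
  shows "((\<lambda>a. coeff f a * (arrangements a * monomial x a)) has_sum eval f x) UNIV"
  unfolding eval_def
  by (intro has_sum_infsum summable_coeff_bounded[of _ 1])
    (simp add: abs_mult arrangements_monomial_le_1[OF assms])

lemma abs_eval_le:
  assumes "x \<in> cube n"
  shows "\<bar>eval f x\<bar> \<le> norm f"
proof -
  have "norm (eval f x) \<le> norm f"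
  proof (rule norm_infsum_le[OF eval_has_sum[OF assms]])
    show "((\<lambda>a. \<bar>coeff f a\<bar>) has_sum norm f) UNIV" by (simp add: norm_l1_def)
    show "norm (coeff f a * (arrangements a * monomial x a)) \<le> \<bar>coeff f a\<bar>" for a
      using mult_left_mono[OF arrangements_monomial_le_1[OF assms, of a], of "\<bar>coeff f a\<bar>"]
      by (simp add: abs_mult)
  qed
  then show ?thesis by simp
qed

lemma eval_linear:
  assumes "x \<in> cube n"
  shows "eval (f + g) x = eval f x + eval g x" "eval (r *\<^sub>R f) x = r * eval f x"
    "eval (f - g) x = eval f x - eval g x" "eval 0 x = 0"
proof -
  note h = eval_has_sum[OF assms]
  show add: "eval (f + g) x = eval f x + eval g x" for f g
    using has_sum_add[OF h[of f] h[of g]] h[of "f + g"]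
    by (simp add: coeff_ops distrib_right has_sum_unique)
  show scale: "eval (r *\<^sub>R f) x = r * eval f x" for r f
    using has_sum_cmult_right[OF h[of f], of r] h[of "r *\<^sub>R f"]
    by (simp add: coeff_ops mult.assoc has_sum_unique)
  show "eval (f - g) x = eval f x - eval g x"
    using add[of f "-1 *\<^sub>R g"] scale[of "-1" g] by simp
  show "eval 0 x = 0" using scale[of 0 0] by simp
qed

lemma eval_sum:
  assumes "x \<in> cube n"
  shows "eval (\<Sum>i\<in>S. f i) x = (\<Sum>i\<in>S. eval (f i) x)"
  by (induction S rule: infinite_finite_induct) (simp_all add: eval_linear[OF assms])

lemma eval_at_0: "eval f (\<lambda>_. 0) = coeff f {#}"
proof -
  have "((\<lambda>a. coeff f a * (arrangements a * monomial (\<lambda>_. 0) a)) has_sum coeff f {#}) UNIV"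
    by (rule has_sum_finite_neutralI[of "{{#}}"])
      (auto simp: monomial_def)
  then show ?thesis unfolding eval_def by (rule infsumI)
qed

lemma eval_eq_partial_sum:
  assumes "x \<in> cube n" "finite S" "\<And>a. a \<notin> S \<Longrightarrow> coeff f a = 0"
  shows "eval f x = (\<Sum>a\<in>S. coeff f a * (arrangements a * monomial x a))"
  unfolding eval_def
  by (rule infsumI, rule has_sum_finite_neutralI[of S]) (use assms in auto)

section \<open>Multiplication of series\<close>

text \<open>Absolute convergence of the double family allows regrouping the pairs
  \<open>(a, b)\<close> by \<open>c = a + b\<close>; for fixed \<open>c\<close> they correspond to
  the finitely many submultisets of \<open>c\<close>.\<close>

lemma convolution_has_sum:
  fixes F G :: "'a multiset \<Rightarrow> real"
  assumes "F summable_on UNIV" "G summable_on UNIV"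
  shows "((\<lambda>c. \<Sum>a | a \<subseteq># c. F a * G (c - a)) has_sum (infsum F UNIV * infsum G UNIV)) UNIV"
proof -
  have "(\<lambda>p. norm (case p of (a, b) \<Rightarrow> F a * G b)) summable_on UNIV \<times> UNIV"
    unfolding Infinite_Sum.abs_summable_on_Sigma_iff
    using assms[THEN summable_on_iff_abs_summable_on_real[THEN iffD1]]
    by (auto simp: abs_mult infsum_cmult_right' infsum_nonneg
        intro!: summable_on_cmult_left summable_on_cmult_right)
  then have "(\<lambda>(a, b). F a * G b) summable_on UNIV \<times> UNIV"
    by (rule abs_summable_summable)
  then have "((\<lambda>(a, b). F a * G b) has_sum (infsum F UNIV * infsum G UNIV)) (UNIV \<times> UNIV)"
    using assms
    by (intro has_sum_SigmaI[where g = "\<lambda>a. F a * infsum G UNIV"])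
      (auto intro!: has_sum_cmult_right has_sum_cmult_left has_sum_infsum)
  also have "?this \<longleftrightarrow> ((\<lambda>(c, a). F a * G (c - a)) has_sum (infsum F UNIV * infsum G UNIV))
      (SIGMA c:UNIV. {a. a \<subseteq># c})"
    by (rule has_sum_reindex_bij_witness[of _ "\<lambda>(c, a). (a, c - a)" "\<lambda>(a, b). (a + b, a)"])
      auto
  finally show ?thesis
    by (rule has_sum_SigmaD) (auto intro: has_sum_finite)
qed

text \<open>The Cauchy product in the weighted monomials of \<open>eval\<close>. The quotient of
  \<open>arrangements\<close> converts the weights and is at most 1.\<close>

definition conv :: "nat multiset l1 \<Rightarrow> nat multiset l1 \<Rightarrow> nat multiset l1" where
  "conv f g = Abs_l1 (\<lambda>c. \<Sum>a | a \<subseteq># c. coeff f a * coeff g (c - a) *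
     (arrangements a * arrangements (c - a) / arrangements c))"

lemma conv_bound:
  fixes f g :: "nat multiset l1"
  assumes "finite S"
  shows "(\<Sum>c\<in>S. \<bar>\<Sum>a | a \<subseteq># c. coeff f a * coeff g (c - a) *
    (arrangements a * arrangements (c - a) / arrangements c)\<bar>) \<le> norm f * norm g"
proof -
  have K: "arrangements a * arrangements (c - a) / arrangements c \<le> 1" if "a \<subseteq># c" for a c :: "nat multiset"
    using arrangements_mult_le[of a "c - a"] that by (simp add: subset_mset.add_diff_inverse)
  have "(\<Sum>c\<in>S. \<bar>\<Sum>a | a \<subseteq># c. coeff f a * coeff g (c - a) *
      (arrangements a * arrangements (c - a) / arrangements c)\<bar>) \<le>
      (\<Sum>c\<in>S. \<Sum>a | a \<subseteq># c. \<bar>coeff f a\<bar> * \<bar>coeff g (c - a)\<bar>)"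
  proof (rule sum_mono, rule order_trans[OF sum_abs], rule sum_mono)
    fix a c :: "nat multiset" assume "a \<in> {a. a \<subseteq># c}"
    then show "\<bar>coeff f a * coeff g (c - a) * (arrangements a * arrangements (c - a) / arrangements c)\<bar>
        \<le> \<bar>coeff f a\<bar> * \<bar>coeff g (c - a)\<bar>"
      using mult_left_mono[OF K, of a c "\<bar>coeff f a\<bar> * \<bar>coeff g (c - a)\<bar>"]
      by (simp add: abs_mult)
  qed
  also have "\<dots> \<le> norm f * norm g"
    unfolding norm_l1_def
    by (rule finite_sum_le_has_sum[OF convolution_has_sum])
      (use assms in \<open>auto intro!: sum_nonneg\<close>)
  finally show ?thesis .
qed

lemma coeff_conv: "coeff (conv f g) = (\<lambda>c. \<Sum>a | a \<subseteq># c. coeff f a * coeff g (c - a) *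
     (arrangements a * arrangements (c - a) / arrangements c))"
  and norm_conv: "norm (conv f g) \<le> norm f * norm g"
  unfolding conv_def by (rule coeff_Abs_bounded, erule conv_bound)+

lemma bounded_bilinear_conv: "bounded_bilinear conv"
proof
  show "\<exists>K. \<forall>a b. norm (conv a b) \<le> norm a * norm b * K"
    by (rule exI[of _ 1]) (simp add: norm_conv)
qed (rule l1_eqI; simp add: coeff_conv coeff_ops algebra_simps add_divide_distrib sum.distrib sum_distrib_left)+

lemma eval_conv:
  assumes "x \<in> cube n"
  shows "eval (conv f g) x = eval f x * eval g x"
proof -
  let ?F = "\<lambda>f a. coeff f a * (arrangements a * monomial x a)"
  have s: "?F f summable_on UNIV" for f
    using eval_has_sum[OF assms] by (rule has_sum_imp_summable)
  have "(\<Sum>a | a \<subseteq># c. ?F f a * ?F g (c - a)) = ?F (conv f g) c" for c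
  proof -
    have "monomial x c = monomial x a * monomial x (c - a)" if "a \<subseteq># c" for a
      using monomial_plus[of x a "c - a"] that by (simp add: subset_mset.add_diff_inverse)
    then show ?thesis
      by (auto simp: coeff_conv sum_distrib_right intro!: sum.cong)
  qed
  with convolution_has_sum[OF s[of f] s[of g]]
  have "(?F (conv f g) has_sum (eval f x * eval g x)) UNIV" by (simp add: eval_def)
  then show ?thesis unfolding eval_def by (rule infsumI)
qed

section \<open>Integration and its compositions with derivatives\<close>

definition single_l1 :: "'a \<Rightarrow> 'a l1" where
  "single_l1 b = Abs_l1 (\<lambda>a. if a = b then 1 else 0)"

lemma coeff_single_l1: "coeff (single_l1 b) = (\<lambda>a. if a = b then 1 else 0)"
  unfolding single_l1_def
  by (rule coeff_Abs_bounded[of _ 1]) (simp add: if_distrib[of abs] sum.delta' cong: if_cong)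

lemma eval_single_l1: "x \<in> cube n \<Longrightarrow> eval (single_l1 b) x = arrangements b * monomial x b"
  by (subst eval_eq_partial_sum[of x n "{b}"]) (auto simp: coeff_single_l1)

definition var :: "nat \<Rightarrow> nat multiset l1" where "var i = single_l1 {#i#}"

definition const_l1 :: "real \<Rightarrow> nat multiset l1" where "const_l1 r = r *\<^sub>R single_l1 {#}"

lemma eval_var: "x \<in> cube n \<Longrightarrow> eval (var i) x = x i"
  by (simp add: var_def eval_single_l1 arrangements_def)

lemma eval_const: "x \<in> cube n \<Longrightarrow> eval (const_l1 r) x = r"
  by (simp add: const_l1_def eval_linear eval_single_l1)

text \<open>Moving coefficients injectively and dropping the others cannot increase the norm. This
  covers \<open>slope\<close> directly, and \<open>integrate\<close> once its denominators are
  estimated by 1.\<close>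

lemma shifted_coeff_bound:
  assumes "inj_on h {a. P a}" "finite S"
  shows "(\<Sum>a\<in>S. \<bar>if P a then coeff f (h a) else 0\<bar>) \<le> norm f"
proof -
  have "(\<Sum>a\<in>S. \<bar>if P a then coeff f (h a) else 0\<bar>) = (\<Sum>a\<in>{a\<in>S. P a}. \<bar>coeff f (h a)\<bar>)"
    using assms(2) by (auto simp: sum.inter_filter intro: sum.cong)
  also have "\<dots> = (\<Sum>b\<in>h ` {a\<in>S. P a}. \<bar>coeff f b\<bar>)"
    by (rule sum.reindex_cong[symmetric]) (use assms(1) in \<open>auto intro: inj_on_subset\<close>)
  also have "\<dots> \<le> norm f" by (rule sum_coeff_le_norm) (use assms(2) in auto)
  finally show ?thesis .
qed

text \<open>Integrating a plain monomial would give the denominator \<open>count a 0\<close>; by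
  \<open>arrangements_add\<close> the weights of \<open>eval\<close> turn it into
  \<open>size a\<close>.\<close>

definition integrate :: "nat multiset l1 \<Rightarrow> nat multiset l1" where
  "integrate f = Abs_l1 (\<lambda>a. if 0 \<in># a then coeff f (a - {#0#}) / real (size a) else 0)"

text \<open>The composition of \<open>integrate\<close>, which is integration from \<open>0\<close> in \<open>x\<^sub>0\<close>, with \<open>\<partial>/\<partial>x\<^sub>i\<close>. In
  the normalisation of \<open>eval\<close> it merely moves coefficients, so it is bounded although \<open>\<partial>/\<partial>x\<^sub>i\<close>
  is not.\<close>

definition slope :: "nat \<Rightarrow> nat multiset l1 \<Rightarrow> nat multiset l1" where
  "slope i f = Abs_l1 (\<lambda>a. if i = 0 \<or> 0 \<in># a then
     coeff f (if i = 0 then a else add_mset i (a - {#0#})) else 0)"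

lemma coeff_integrate:
    "coeff (integrate f) = (\<lambda>a. if 0 \<in># a then coeff f (a - {#0#}) / real (size a) else 0)"
  and norm_integrate: "norm (integrate f) \<le> norm f"
proof -
  have "(\<Sum>a\<in>S. \<bar>if 0 \<in># a then coeff f (a - {#0#}) / real (size a) else 0\<bar>) \<le> norm f"
    if "finite S" for S
  proof -
    have "(\<Sum>a\<in>S. \<bar>if 0 \<in># a then coeff f (a - {#0#}) / real (size a) else 0\<bar>) \<le>
        (\<Sum>a\<in>S. \<bar>if 0 \<in># a then coeff f (a - {#0#}) else 0\<bar>)"
    proof (rule sum_mono)
      fix a assume "a \<in> S"
      have "real (size a) \<ge> 1" if "0 \<in># a" using that by (cases a) auto
      then show "\<bar>if 0 \<in># a then coeff f (a - {#0#}) / real (size a) else 0\<bar>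
          \<le> \<bar>if 0 \<in># a then coeff f (a - {#0#}) else 0\<bar>"
        by (auto simp: abs_div divide_le_eq mult_left_le abs_divide mult_le_cancel_left1)
    qed
    also have "\<dots> \<le> norm f"
      by (rule shifted_coeff_bound[OF _ that]) (auto intro!: inj_onI dest!: multi_member_split)
    finally show ?thesis .
  qed
  note * = coeff_Abs_bounded[OF this]
  show "coeff (integrate f) = (\<lambda>a. if 0 \<in># a then coeff f (a - {#0#}) / real (size a) else 0)"
    "norm (integrate f) \<le> norm f"
    unfolding integrate_def by (rule *, assumption)+
qed

lemma coeff_slope:
    "coeff (slope i f) = (\<lambda>a. if i = 0 \<or> 0 \<in># a then
       coeff f (if i = 0 then a else add_mset i (a - {#0#})) else 0)"
  and norm_slope: "norm (slope i f) \<le> norm f"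
proof -
  have inj: "inj_on (\<lambda>a. if i = 0 then a else add_mset i (a - {#0#})) {a. i = 0 \<or> 0 \<in># a}"
    by (auto intro!: inj_onI dest!: multi_member_split split: if_splits)
  note * = coeff_Abs_bounded[OF shifted_coeff_bound[OF inj]]
  show "coeff (slope i f) = (\<lambda>a. if i = 0 \<or> 0 \<in># a then
       coeff f (if i = 0 then a else add_mset i (a - {#0#})) else 0)"
    "norm (slope i f) \<le> norm f"
    unfolding slope_def by (rule *, assumption)+
qed

lemma bounded_linear_integrate: "bounded_linear integrate"
proof
  show "\<exists>K. \<forall>x. norm (integrate x) \<le> norm x * K"
    by (rule exI[of _ 1]) (simp add: norm_integrate)
qed (rule l1_eqI; simp add: coeff_integrate coeff_ops add_divide_distrib)+

lemma bounded_linear_slope: "bounded_linear (slope i)"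
proof
  show "\<exists>K. \<forall>x. norm (slope i x) \<le> norm x * K"
    by (rule exI[of _ 1]) (simp add: norm_slope)
qed (rule l1_eqI; simp add: coeff_slope coeff_ops)+

lemma slope_0 [simp]: "slope 0 f = f"
  by (rule l1_eqI) (simp add: coeff_slope)

text \<open>With it the mixed second derivatives of \<open>integrate (integrate w)\<close> come from
  two uses of \<open>is_partial_integrate\<close>: the first derivative
  \<open>slope l (integrate w)\<close> is again an integral, namely of
  \<open>slope l w\<close>.\<close>

lemma slope_integrate: "slope i (integrate f) = integrate (slope i f)"
proof (cases "i = 0")
  case False
  show ?thesis
  proof (rule l1_eqI)
    fix a
    show "coeff (slope i (integrate f)) a = coeff (integrate (slope i f)) a"
    proof (cases "0 \<in># a")
      case True
      then obtain b where b: "a = add_mset 0 b" by (meson multi_member_split)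
      show ?thesis
        using False by (cases "0 \<in># b") (auto simp: b coeff_slope coeff_integrate dest!: multi_member_split)
    qed (use False in \<open>simp add: coeff_slope coeff_integrate\<close>)
  qed
qed simp

text \<open>The formal partial derivative in weighted coefficients. It is a relation because the
  factor \<open>size a + 1\<close> may destroy summability, so that not every \<open>f\<close> has
  such a \<open>g\<close>.\<close>

definition is_partial :: "nat \<Rightarrow> nat multiset l1 \<Rightarrow> nat multiset l1 \<Rightarrow> bool" where
  "is_partial i f g \<longleftrightarrow> (\<forall>a. coeff g a = (real (size a) + 1) * coeff f (add_mset i a))"

lemma is_partial_integrate: "is_partial i (integrate f) (slope i f)"
  unfolding is_partial_def
proof
  fix a
  show "coeff (slope i f) a = (real (size a) + 1) * coeff (integrate f) (add_mset i a)"
    by (cases "i = 0"; cases "0 \<in># a") (auto simp: coeff_slope coeff_integrate field_simps dest!: multi_member_split)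
qed

text \<open>By the third equation all iterated slopes of \<open>w\<close> vanish at the origin as
  soon as \<open>w\<close> does; hence so do all second derivatives of its double integral.\<close>

lemma coeff_0_integrate:
  "coeff (integrate f) {#} = 0" "coeff (slope i (integrate f)) {#} = 0"
  "coeff (slope i (slope j f)) {#} = (if i = 0 \<and> j = 0 then coeff f {#} else 0)"
  by (auto simp: slope_integrate) (auto simp: coeff_integrate coeff_slope)

section \<open>Differentiation term by term\<close>

lemma monomial_has_derivative:
  "((\<lambda>t. monomial (x(i := t)) a) has_real_derivative
     real (count a i) * monomial (x(i := t)) (a - {#i#})) (at t)"
proof (induction a)
  case (add j a)
  show ?case
  proof (cases "j = i")
    case True
    have *: "real (count a i) * monomial (x(i := t)) (a - {#i#}) * t =
        real (count a i) * monomial (x(i := t)) a"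
      by (cases "i \<in># a") (auto simp: not_in_iff dest!: multi_member_split)
    have "((\<lambda>t. t * monomial (x(i := t)) a) has_real_derivative
        1 * monomial (x(i := t)) a + real (count a i) * monomial (x(i := t)) a) (at t)"
      using DERIV_mult[OF DERIV_ident add.IH] unfolding * .
    then show ?thesis
      by (simp only: True monomial_add_mset fun_upd_same add_mset_remove_trivial count_add_mset
          simp_thms if_True of_nat_Suc distrib_right mult_1)
  next
    case False
    have "x j * (real (count a i) * monomial (x(i := t)) (a - {#i#})) =
        real (count (add_mset j a) i) * monomial (x(i := t)) (add_mset j a - {#i#})"
      using False by (cases "i \<in># a") (auto simp: not_in_iff dest!: multi_member_split)
    moreover have "(\<lambda>t. monomial (x(i := t)) (add_mset j a)) = (\<lambda>t. x j * monomial (x(i := t)) a)"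
      using False by simp
    ultimately show ?thesis
      using DERIV_cmult[OF add.IH, of "x j"] by (simp only:)
  qed
qed simp

text \<open>With \<open>\<theta> = n/(n+1)\<close> and \<open>m = size b\<close> the term is at most
  \<open>(m+1) \<theta>^m\<close>. As the powers of \<open>\<theta>\<close> decrease, this is at
  most \<open>1 + \<theta> + ... + \<theta>^m\<close>, hence at most
  \<open>1/(1-\<theta>) = n+1\<close>.\<close>

lemma arrangements_monomial_derivative_le:
  assumes "x \<in> cube n"
  shows "\<bar>arrangements a * (real (count a i) * monomial x (a - {#i#}))\<bar> \<le> real n + 1"
proof (cases "i \<in># a")
  case True
  then obtain b where a: "a = add_mset i b" by (meson multi_member_split)
  define \<theta> where "\<theta> = real n * (1 / (real n + 1))"
  have \<theta>: "0 \<le> \<theta>" "\<theta> < 1" "1 / (1 - \<theta>) = real n + 1" by (auto simp: \<theta>_def field_simps)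
  have "arrangements a * (real (count a i) * monomial x (a - {#i#})) =
      (real (size b) + 1) * (arrangements b * monomial x b)"
    using arg_cong[OF arrangements_add[of i b], of "\<lambda>z. z * monomial x b"]
    by (simp add: a algebra_simps)
  also have "\<bar>\<dots>\<bar> = (real (size b) + 1) * (arrangements b * \<bar>monomial x b\<bar>)"
    by (simp add: abs_mult)
  also have "\<dots> \<le> (real (size b) + 1) * \<theta> ^ size b"
    unfolding \<theta>_def using assms
    by (intro mult_left_mono arrangements_monomial_le) (auto simp: cube_def less_imp_le)
  also have "\<dots> = (\<Sum>k<Suc (size b). \<theta> ^ size b)" by simp
  also have "\<dots> \<le> (\<Sum>k<Suc (size b). \<theta> ^ k)"
    by (rule sum_mono, rule power_decreasing) (use \<theta> in auto)
  also have "\<dots> = (1 - \<theta> ^ Suc (size b)) / (1 - \<theta>)"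
    using \<theta> sum_gp_strict[of \<theta> "Suc (size b)"] by (simp del: sum.lessThan_Suc power_Suc)
  also have "\<dots> \<le> 1 / (1 - \<theta>)"
    using \<theta> by (intro divide_right_mono) auto
  finally show ?thesis by (simp only: \<theta>(3))
qed (simp add: not_in_iff)

text \<open>The differentiated series is dominated by \<open>(n+1) |coeff f a|\<close> throughout
  the cube. This holds for every \<open>f\<close>, even if the derivative is not itself an
  \<open>eval\<close>; the inverse metric, whose derivatives only have to exist, is treated this
  way.\<close>

lemma eval_has_derivative:
  assumes x: "x \<in> cube n" and i: "i < n"
  shows "((\<lambda>t. eval f (x(i := t))) has_real_derivative
    (\<Sum>\<^sub>\<infinity>a. coeff f a * (arrangements a * (real (count a i) * monomial x (a - {#i#}))))) (at (x i))"
proof -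
  define S where "S = {- 1 / (real n + 1)<..<1 / (real n + 1)}"
  have S: "t \<in> S \<longleftrightarrow> x(i := t) \<in> cube n" for t
    using cube_fun_upd[OF x i, of t] by (auto simp: S_def)
  have xi: "x i \<in> S" using S[of "x i"] x by simp
  have "surj (mset :: nat list \<Rightarrow> _)" by (metis surj_def ex_mset)
  then have count: "countable (UNIV :: nat multiset set)"
    using countable_image[of UNIV "mset :: nat list \<Rightarrow> _"] by simp
  \<comment> \<open>An enumeration of the multisets turns the unordered sums into series over
    \<open>nat\<close>, where uniform convergence of the differentiated series justifies the
    interchange.\<close>
  define e where "e = from_nat_into (UNIV :: nat multiset set)"
  have "inj (\<lambda>k::nat. replicate_mset k (0::nat))"
    by (rule injI) (metis size_replicate_mset)
  then have "infinite (UNIV :: nat multiset set)"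
    by (meson finite_subset infinite_UNIV_nat range_inj_infinite subset_UNIV)
  then have e: "bij e"
    unfolding e_def by (rule bij_betw_from_nat_into[OF count])
  let ?F = "\<lambda>a t. coeff f a * (arrangements a * monomial (x(i := t)) a)"
  let ?D = "\<lambda>a t. coeff f a * (arrangements a * (real (count a i) * monomial (x(i := t)) (a - {#i#})))"
  have sums: "(\<lambda>k. ?F (e k) t) sums eval f (x(i := t))" if "t \<in> S" for t
    using eval_has_sum[of "x(i := t)" n f] that unfolding S
    by (intro has_sum_imp_sums) (subst has_sum_reindex_bij_betw[OF e])
  have bound: "\<bar>?D a t\<bar> \<le> \<bar>coeff f a\<bar> * (real n + 1)" if "t \<in> S" for a t
    using arrangements_monomial_derivative_le[of "x(i := t)" n a i] that unfolding S
    by (simp only: abs_mult[of "coeff f a"]) (intro mult_left_mono; simp)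
  have "(\<lambda>a. \<bar>coeff f a\<bar> * (real n + 1)) summable_on UNIV"
    by (intro summable_on_cmult_left) simp
  then have "summable (\<lambda>k. \<bar>coeff f (e k)\<bar> * (real n + 1))"
    by (intro summable_on_imp_summable) (subst summable_on_reindex_bij_betw[OF e])
  then have unif: "uniformly_convergent_on S (\<lambda>m t. \<Sum>k<m. ?D (e k) t)"
    by (intro Weierstrass_m_test') (use bound in auto)
  have "((\<lambda>t. \<Sum>k. ?F (e k) t) has_real_derivative (\<Sum>k. ?D (e k) (x i))) (at (x i))"
  proof (rule has_field_derivative_series'(2)[OF _ _ unif xi])
    show "convex S" by (simp add: S_def)
    show "summable (\<lambda>k. ?F (e k) (x i))" using sums[OF xi] by (rule sums_summable)
    show "x i \<in> interior S" using xi by (simp add: S_def)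
    show "(?F (e k) has_real_derivative ?D (e k) t) (at t within S)" for k t
      by (intro DERIV_cmult has_field_derivative_at_within[OF monomial_has_derivative])
  qed
  moreover have "(\<Sum>k. ?D (e k) (x i)) = (\<Sum>\<^sub>\<infinity>a. ?D a (x i))"
  proof (rule sums_unique[symmetric], rule has_sum_imp_sums, subst has_sum_reindex_bij_betw[OF e])
    show "((\<lambda>a. ?D a (x i)) has_sum (\<Sum>\<^sub>\<infinity>a. ?D a (x i))) UNIV"
      by (intro has_sum_infsum summable_coeff_bounded[of _ "real n + 1"])
        (use arrangements_monomial_derivative_le[OF x] in simp)
  qed
  ultimately have "((\<lambda>t. \<Sum>k. ?F (e k) t) has_real_derivative (\<Sum>\<^sub>\<infinity>a. ?D a (x i))) (at (x i))"
    by simp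
  then show ?thesis
    unfolding fun_upd_triv
    by (rule has_field_derivative_transform_within_open[of _ _ _ S])
      (use xi sums in \<open>auto simp: S_def sums_iff\<close>)
qed

lemma eval_has_partial:
  assumes x: "x \<in> cube n" and i: "i < n" and fg: "is_partial i f g"
  shows "((\<lambda>t. eval f (x(i := t))) has_real_derivative eval g x) (at (x i))"
proof -
  let ?D = "\<lambda>a. coeff f a * (arrangements a * (real (count a i) * monomial x (a - {#i#})))"
  have "infsum ?D UNIV = infsum ?D {a. i \<in># a}"
    by (rule infsum_cong_neutral) (auto simp: not_in_iff)
  also have "\<dots> = (\<Sum>\<^sub>\<infinity>a. coeff g a * (arrangements a * monomial x a))"
  proof (rule infsum_reindex_bij_witness[of _ "add_mset i" "\<lambda>a. a - {#i#}"])
    fix a assume "a \<in> {a. i \<in># a}"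
    then obtain b where "a = add_mset i b" by (auto dest: multi_member_split)
    then show "coeff g (a - {#i#}) * (arrangements (a - {#i#}) * monomial x (a - {#i#})) = ?D a"
      using fg arg_cong[OF arrangements_add[of i b], of "\<lambda>z. z * monomial x b * coeff f (add_mset i b)"]
      by (simp add: is_partial_def algebra_simps)
  qed auto
  finally show ?thesis
    using eval_has_derivative[OF x i, of f] by (simp add: eval_def)
qed

section \<open>Analyticity by recentring\<close>

text \<open>The binomial coefficient kills all terms with some
  \<open>\<beta> i > \<alpha> i\<close>, where the subtraction is truncated, so the sum is a finite
  one. Writing it over all exponents gives a rectangular index set for exchanging
  summations.\<close>

lemma has_sum_binomial_product:
  fixes u v :: "nat \<Rightarrow> real"
  shows "((\<lambda>\<beta>. \<Prod>i<n. real (\<alpha> i choose \<beta> i) * u i ^ (\<alpha> i - \<beta> i) * v i ^ \<beta> i) has_sum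
    (\<Prod>i<n. (u i + v i) ^ \<alpha> i)) {\<beta>. \<forall>i\<ge>n. \<beta> i = 0}"
proof (rule has_sum_finite_neutralI)
  \<comment> \<open>Members of \<open>PiE\<close> are \<open>undefined\<close> outside
    \<open>{..<n}\<close>, exponents are 0 there; \<open>?ext\<close> translates.\<close>
  let ?ext = "\<lambda>g i. if i < n then g i else (0::nat)"
  let ?B = "?ext ` PiE {..<n} (\<lambda>i. {..\<alpha> i})"
  let ?t = "\<lambda>i k. real (\<alpha> i choose k) * u i ^ (\<alpha> i - k) * v i ^ k"
  show "finite ?B" by (intro finite_imageI finite_PiE) auto
  show "?B \<subseteq> {\<beta>. \<forall>i\<ge>n. \<beta> i = 0}" by (rule image_subsetI) simp
  show "(\<Prod>i<n. ?t i (\<beta> i)) = 0" if "\<beta> \<in> {\<beta>. \<forall>i\<ge>n. \<beta> i = 0} - ?B" for \<beta>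
  proof -
    have "\<exists>i<n. \<alpha> i < \<beta> i"
    proof (rule ccontr)
      assume "\<not> ?thesis"
      then have "\<beta> i \<le> \<alpha> i" if "i < n" for i using that by (meson not_le)
      then have "restrict \<beta> {..<n} \<in> PiE {..<n} (\<lambda>i. {..\<alpha> i})" by auto
      moreover have "\<beta> = ?ext (restrict \<beta> {..<n})" using that by (auto simp: fun_eq_iff)
      ultimately show False using that by blast
    qed
    then show ?thesis by (auto simp: binomial_eq_0)
  qed
  have "inj_on ?ext (PiE {..<n} (\<lambda>i. {..\<alpha> i}))"
  proof (rule inj_onI)
    fix g h assume gh: "g \<in> PiE {..<n} (\<lambda>i. {..\<alpha> i})" "h \<in> PiE {..<n} (\<lambda>i. {..\<alpha> i})" "?ext g = ?ext h"
    show "g = h"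
    proof (rule PiE_ext[OF gh(1,2)])
      fix i assume "i \<in> {..<n}"
      then show "g i = h i" using fun_cong[OF gh(3), of i] by simp
    qed
  qed
  then have "(\<Sum>\<beta>\<in>?B. \<Prod>i<n. ?t i (\<beta> i)) = (\<Sum>g\<in>PiE {..<n} (\<lambda>i. {..\<alpha> i}). \<Prod>i<n. ?t i (g i))"
    by (subst sum.reindex) (auto intro!: sum.cong prod.cong)
  also have "\<dots> = (\<Prod>i<n. \<Sum>k\<le>\<alpha> i. ?t i k)"
    by (rule prod_sum_PiE[symmetric]) auto
  also have "\<dots> = (\<Prod>i<n. (u i + v i) ^ \<alpha> i)"
  proof (rule prod.cong[OF refl])
    show "(\<Sum>k\<le>\<alpha> i. ?t i k) = (u i + v i) ^ \<alpha> i" for i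
      using binomial_ring[of "v i" "u i" "\<alpha> i"] by (simp add: add.commute mult_ac)
  qed
  finally show "(\<Prod>i<n. (u i + v i) ^ \<alpha> i) = (\<Sum>\<beta>\<in>?B. \<Prod>i<n. ?t i (\<beta> i))" by simp
qed

text \<open>Each \<open>x i = a i + (x i - a i)\<close> is expanded binomially and the sums are
  exchanged. Absolute convergence holds because
  \<open>\<bar>a i\<bar> + \<bar>x i - a i\<bar> \<le> \<rho>\<close>. The new coefficients must
  serve all \<open>x\<close> at once, hence the order of the quantifiers.\<close>

lemma power_series_recenter:
  fixes c :: "(nat \<Rightarrow> nat) \<Rightarrow> real"
  assumes c: "(\<lambda>\<alpha>. \<bar>c \<alpha>\<bar> * (\<Prod>i<n. \<rho> ^ \<alpha> i)) summable_on {\<alpha>. \<forall>i\<ge>n. \<alpha> i = 0}"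
    and r: "\<And>i. i < n \<Longrightarrow> \<bar>a i\<bar> + r \<le> \<rho>"
  shows "\<exists>c'. \<forall>x s. (\<forall>i<n. \<bar>x i - a i\<bar> < r) \<longrightarrow>
    ((\<lambda>\<alpha>. c \<alpha> * (\<Prod>i<n. x i ^ \<alpha> i)) has_sum s) {\<alpha>. \<forall>i\<ge>n. \<alpha> i = 0} \<longrightarrow>
    ((\<lambda>\<beta>. c' \<beta> * (\<Prod>i<n. (x i - a i) ^ \<beta> i)) has_sum s) {\<beta>. \<forall>i\<ge>n. \<beta> i = 0}"
proof (intro exI allI impI)
  let ?E = "{\<alpha>. \<forall>i\<ge>n. \<alpha> i = (0::nat)}"
  fix x :: "nat \<Rightarrow> real" and s
  assume x: "\<forall>i<n. \<bar>x i - a i\<bar> < r" and s: "((\<lambda>\<alpha>. c \<alpha> * (\<Prod>i<n. x i ^ \<alpha> i)) has_sum s) ?E"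
  let ?b = "\<lambda>u v \<alpha> \<beta>. \<Prod>i<n. real (\<alpha> i choose \<beta> i) * u i ^ (\<alpha> i - \<beta> i) * v i ^ \<beta> i"
  let ?y = "\<lambda>i. x i - a i"
  let ?t = "\<lambda>(\<alpha>, \<beta>). c \<alpha> * ?b a ?y \<alpha> \<beta>"
  have nt: "norm (?t (\<alpha>, \<beta>)) = \<bar>c \<alpha>\<bar> * ?b (\<lambda>i. \<bar>a i\<bar>) (\<lambda>i. \<bar>?y i\<bar>) \<alpha> \<beta>" for \<alpha> \<beta>
    by (simp add: abs_mult abs_prod power_abs)
  have nsum: "((\<lambda>\<beta>. norm (?t (\<alpha>, \<beta>))) has_sum (\<bar>c \<alpha>\<bar> * (\<Prod>i<n. (\<bar>a i\<bar> + \<bar>?y i\<bar>) ^ \<alpha> i))) ?E" for \<alpha>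
    unfolding nt by (intro has_sum_cmult_right has_sum_binomial_product)
  have "(\<lambda>\<alpha>. \<bar>c \<alpha>\<bar> * (\<Prod>i<n. (\<bar>a i\<bar> + \<bar>?y i\<bar>) ^ \<alpha> i)) summable_on ?E"
  proof (rule summable_on_comparison_test[OF c])
    show "\<bar>c \<alpha>\<bar> * (\<Prod>i<n. (\<bar>a i\<bar> + \<bar>?y i\<bar>) ^ \<alpha> i) \<le> \<bar>c \<alpha>\<bar> * (\<Prod>i<n. \<rho> ^ \<alpha> i)" for \<alpha>
      by (intro mult_left_mono prod_mono conjI power_mono zero_le_power add_nonneg_nonneg)
        (use x r in \<open>fastforce simp: less_imp_le\<close>)+
  qed (auto intro!: mult_nonneg_nonneg prod_nonneg)
  then have "(\<lambda>\<alpha>. norm (\<Sum>\<^sub>\<infinity>\<beta>\<in>?E. norm (?t (\<alpha>, \<beta>)))) summable_on ?E"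
    unfolding infsumI[OF nsum] by (simp add: abs_mult abs_prod power_abs)
  then have "(\<lambda>p. norm (?t p)) summable_on ?E \<times> ?E"
    unfolding Infinite_Sum.abs_summable_on_Sigma_iff
    using has_sum_imp_summable[OF nsum] by blast
  then have "?t summable_on ?E \<times> ?E" by (rule abs_summable_summable)
  moreover have inner: "((\<lambda>\<beta>. ?t (\<alpha>, \<beta>)) has_sum (c \<alpha> * (\<Prod>i<n. x i ^ \<alpha> i))) ?E" for \<alpha>
    using has_sum_cmult_right[OF has_sum_binomial_product[of \<alpha> a ?y n], of "c \<alpha>"] by simp
  ultimately have T: "(?t has_sum s) (?E \<times> ?E)"
    by (intro has_sum_SigmaI[OF _ s])
  then have T': "((\<lambda>(\<beta>, \<alpha>). ?t (\<alpha>, \<beta>)) has_sum s) (?E \<times> ?E)"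
    by (subst (asm) has_sum_swap) simp
  let ?d = "\<lambda>\<beta> \<alpha>. c \<alpha> * (\<Prod>i<n. real (\<alpha> i choose \<beta> i) * a i ^ (\<alpha> i - \<beta> i))"
  have split: "?t (\<alpha>, \<beta>) = ?d \<beta> \<alpha> * (\<Prod>i<n. ?y i ^ \<beta> i)" for \<alpha> \<beta>
    by (simp add: prod.distrib mult_ac)
  \<comment> \<open>Here the witness for \<open>c'\<close> is fixed: the sum over
    \<open>\<alpha>\<close> of \<open>c \<alpha>\<close> times the binomial coefficients times the
    powers of \<open>a\<close>.\<close>
  show "((\<lambda>\<beta>. (\<Sum>\<^sub>\<infinity>\<alpha>\<in>?E. ?d \<beta> \<alpha>) * (\<Prod>i<n. ?y i ^ \<beta> i)) has_sum s) ?E"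
  proof (rule has_sum_SigmaD[OF T'])
    fix \<beta> assume \<beta>: "\<beta> \<in> ?E"
    have "(\<lambda>\<alpha>. ?t (\<alpha>, \<beta>)) summable_on ?E"
      using summable_on_SigmaD1[OF has_sum_imp_summable[OF T'] \<beta>] by simp
    then have "((\<lambda>\<alpha>. ?t (\<alpha>, \<beta>)) has_sum (\<Sum>\<^sub>\<infinity>\<alpha>\<in>?E. ?t (\<alpha>, \<beta>))) ?E" by simp
    then show "((\<lambda>\<alpha>. case (\<beta>, \<alpha>) of (\<beta>, \<alpha>) \<Rightarrow> ?t (\<alpha>, \<beta>)) has_sum
        (\<Sum>\<^sub>\<infinity>\<alpha>\<in>?E. ?d \<beta> \<alpha>) * (\<Prod>i<n. ?y i ^ \<beta> i)) ?E"
      unfolding split by (simp add: infsum_cmult_left')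
  qed
qed

lemma monomial_eq_prod:
  assumes "set_mset a \<subseteq> {..<n}"
  shows "monomial x a = (\<Prod>i<n. x i ^ count a i)"
  unfolding monomial_def image_prod_mset_multiplicity
  by (rule prod.mono_neutral_left) (use assms in \<open>auto simp: not_in_iff\<close>)

lemma Abs_multiset_bounded:
  assumes "\<forall>i\<ge>n. \<alpha> i = (0::nat)"
  shows "count (Abs_multiset \<alpha>) = \<alpha>" "set_mset (Abs_multiset \<alpha>) \<subseteq> {..<n :: nat}"
proof -
  have "finite {i. 0 < \<alpha> i}"
    by (rule finite_subset[of _ "{..<n}"], rule subsetI, rule ccontr) (use assms in auto)
  then show c: "count (Abs_multiset \<alpha>) = \<alpha>" by simp
  show "set_mset (Abs_multiset \<alpha>) \<subseteq> {..<n}"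
  proof (rule subsetI, rule ccontr)
    fix i assume "i \<in># Abs_multiset \<alpha>" "i \<notin> {..<n}"
    then have "\<alpha> i \<noteq> 0" "n \<le> i" using count_eq_zero_iff[of "Abs_multiset \<alpha>" i] by (auto simp: c)
    with assms show False by simp
  qed
qed

text \<open>Passes from multisets to exponent functions. The hypothesis is met by monomials at
  points whose coordinates from \<open>n\<close> on are 0.\<close>

lemma has_sum_multiset_iff:
  fixes h :: "nat multiset \<Rightarrow> real"
  assumes "\<And>a. \<not> set_mset a \<subseteq> {..<n} \<Longrightarrow> h a = 0"
  shows "(h has_sum s) UNIV \<longleftrightarrow>
    ((\<lambda>\<alpha>. h (Abs_multiset \<alpha>)) has_sum s) {\<alpha>. \<forall>i\<ge>n. \<alpha> i = (0::nat)}"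
proof -
  have "(h has_sum s) UNIV \<longleftrightarrow> (h has_sum s) {a. set_mset a \<subseteq> {..<n}}"
    by (rule has_sum_cong_neutral) (use assms in auto)
  also have "\<dots> \<longleftrightarrow> ((\<lambda>\<alpha>. h (Abs_multiset \<alpha>)) has_sum s) {\<alpha>. \<forall>i\<ge>n. \<alpha> i = (0::nat)}"
  proof (rule has_sum_reindex_bij_witness[of _ Abs_multiset count])
    fix \<alpha> assume "\<alpha> \<in> {\<alpha>. \<forall>i\<ge>n. \<alpha> i = (0::nat)}"
    then have \<alpha>: "\<forall>i\<ge>n. \<alpha> i = 0" by simp
    show "count (Abs_multiset \<alpha>) = \<alpha>" "Abs_multiset \<alpha> \<in> {a. set_mset a \<subseteq> {..<n}}"
      using Abs_multiset_bounded[OF \<alpha>] by auto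
  next
    fix a :: "nat multiset" assume "a \<in> {a. set_mset a \<subseteq> {..<n}}"
    then have "i \<notin># a" if "i \<ge> n" for i using that by auto
    then show "count a \<in> {\<alpha>. \<forall>i\<ge>n. \<alpha> i = 0}" by (simp add: not_in_iff)
  qed (simp_all add: count_inverse)
  finally show ?thesis .
qed

lemma eval_real_analytic: "real_analytic_on n (cube n) (eval f)"
  unfolding real_analytic_on_def
proof
  fix a assume a: "a \<in> cube n"
  let ?\<rho> = "1 / (real n + 1)"
  let ?E = "{\<alpha>. \<forall>i\<ge>n. \<alpha> i = (0::nat)}"
  define c where "c \<alpha> = coeff f (Abs_multiset \<alpha>) * arrangements (Abs_multiset \<alpha>)" for \<alpha>
  \<comment> \<open>The distance of \<open>a\<close> to the boundary in the maximum norm, capped by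
    1 so that the set is nonempty for \<open>n = 0\<close>.\<close>
  define r where "r = Min (insert 1 ((\<lambda>i. ?\<rho> - \<bar>a i\<bar>) ` {..<n}))"
  have "r \<le> ?\<rho> - \<bar>a i\<bar>" if "i < n" for i
    unfolding r_def by (rule Min_le) (use that in auto)
  then have r: "r > 0" "\<And>i. i < n \<Longrightarrow> \<bar>a i\<bar> + r \<le> ?\<rho>"
    using a by (auto simp: r_def cube_def algebra_simps)
  have mon: "monomial x (Abs_multiset \<alpha>) = (\<Prod>i<n. x i ^ \<alpha> i)" if "\<alpha> \<in> ?E" for x \<alpha>
    using that Abs_multiset_bounded[of n \<alpha>] by (simp add: monomial_eq_prod)
  have neutral: "\<not> set_mset b \<subseteq> {..<n} \<Longrightarrow> monomial x b = 0" if "\<And>i. i \<ge> n \<Longrightarrow> x i = 0" for x b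
    using that by (metis lessThan_iff monomial_eq_0 not_le subsetI)
  \<comment> \<open>The corner of the cube: it lies outside the open cube for \<open>n > 0\<close>,
    but the weighted monomials are still at most 1 there, which provides one majorant for recentring
    at every point.\<close>
  let ?u = "\<lambda>i. if i < n then ?\<rho> else 0"
  have "(\<lambda>b. \<bar>coeff f b * (arrangements b * monomial ?u b)\<bar>) summable_on UNIV"
  proof (subst real_norm_def[symmetric], subst summable_on_iff_abs_summable_on_real[symmetric],
      rule summable_coeff_bounded[of _ 1])
    fix b
    have "arrangements b * \<bar>monomial ?u b\<bar> \<le> (real n * ?\<rho>) ^ size b"
      by (rule arrangements_monomial_le) auto
    also have "\<dots> \<le> 1" by (intro power_le_one) auto
    finally show "\<bar>arrangements b * monomial ?u b\<bar> \<le> 1" by (simp add: abs_mult)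
  qed
  then have "((\<lambda>\<alpha>. \<bar>coeff f (Abs_multiset \<alpha>) *
      (arrangements (Abs_multiset \<alpha>) * monomial ?u (Abs_multiset \<alpha>))\<bar>) summable_on ?E)"
    unfolding summable_on_def
    by (subst (asm) has_sum_multiset_iff[of n]) (auto simp: neutral)
  then have c: "(\<lambda>\<alpha>. \<bar>c \<alpha>\<bar> * (\<Prod>i<n. ?\<rho> ^ \<alpha> i)) summable_on ?E"
    by (rule summable_on_cong[THEN iffD1, rotated])
      (simp add: mon c_def abs_mult abs_prod mult.assoc)
  obtain c' where c': "\<And>x s. (\<forall>i<n. \<bar>x i - a i\<bar> < r) \<Longrightarrow>
      ((\<lambda>\<alpha>. c \<alpha> * (\<Prod>i<n. x i ^ \<alpha> i)) has_sum s) ?E \<Longrightarrow>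
      ((\<lambda>\<beta>. c' \<beta> * (\<Prod>i<n. (x i - a i) ^ \<beta> i)) has_sum s) ?E"
    using power_series_recenter[OF c, of a r] r by blast
  have "((\<lambda>\<beta>. c' \<beta> * (\<Prod>i<n. (x i - a i) ^ \<beta> i)) has_sum eval f x) ?E"
    if x: "x \<in> cube n" "\<forall>i<n. \<bar>x i - a i\<bar> < r" for x
  proof (rule c'[OF x(2)])
    have "((\<lambda>\<alpha>. coeff f (Abs_multiset \<alpha>) *
        (arrangements (Abs_multiset \<alpha>) * monomial x (Abs_multiset \<alpha>))) has_sum eval f x) ?E"
      using eval_has_sum[OF x(1), of f] x(1)
      by (subst (asm) has_sum_multiset_iff[of n]) (auto simp: neutral cube_def)
    then show "((\<lambda>\<alpha>. c \<alpha> * (\<Prod>i<n. x i ^ \<alpha> i)) has_sum eval f x) ?E"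
      by (rule has_sum_cong[THEN iffD1, rotated]) (simp add: mon c_def mult.assoc)
  qed
  then show "\<exists>r>0. \<exists>c. \<forall>x\<in>cube n. (\<forall>i<n. \<bar>x i - a i\<bar> < r) \<longrightarrow>
      ((\<lambda>\<alpha>. c \<alpha> * (\<Prod>i<n. (x i - a i) ^ \<alpha> i)) has_sum eval f x) ?E"
    using r(1) by blast
qed

section \<open>Contractive systems\<close>

type_synonym ps = "nat multiset l1"

text \<open>One radius bounds both the parameter and all unknowns. Quantifying over \<open>B\<close>
  states a Lipschitz estimate in the maximum of the differences without forming a maximum over
  \<open>K\<close>.\<close>

definition lip_est :: "'k set \<Rightarrow> real \<Rightarrow> (real \<Rightarrow> ('k \<Rightarrow> ps) \<Rightarrow> ps) \<Rightarrow> real \<Rightarrow> real \<Rightarrow> bool" where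
  "lip_est K \<rho> F a c \<longleftrightarrow> (\<forall>\<mu> z z' B. 0 < \<mu> \<and> \<mu> \<le> \<rho> \<and> 0 \<le> B \<and>
     (\<forall>k\<in>K. norm (z k) \<le> \<rho> \<and> norm (z' k) \<le> \<rho> \<and> norm (z k - z' k) \<le> B) \<longrightarrow>
     norm (F \<mu> z) \<le> a \<and> norm (F \<mu> z - F \<mu> z') \<le> c * B)"

text \<open>Three grades of smallness as \<open>\<mu>\<close> and \<open>z\<close> tend to \<open>0\<close>: the norm and the Lipschitz constant
  in \<open>z\<close> are both bounded; the norm tends to \<open>0\<close> as well; both tend to \<open>0\<close>. A system
  \<open>z\<^sub>k = F\<^sub>k \<mu> z\<close> with \<open>F\<^sub>k\<close> of the last kind is a contraction.\<close>

definition tame :: "'k set \<Rightarrow> (real \<Rightarrow> ('k \<Rightarrow> ps) \<Rightarrow> ps) \<Rightarrow> bool" where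
  "tame K F \<longleftrightarrow> (\<exists>C>0. \<forall>\<^sub>F \<rho> in at_right 0. lip_est K \<rho> F C C)"

definition small :: "'k set \<Rightarrow> (real \<Rightarrow> ('k \<Rightarrow> ps) \<Rightarrow> ps) \<Rightarrow> bool" where
  "small K F \<longleftrightarrow> (\<exists>C>0. \<forall>e>0. \<forall>\<^sub>F \<rho> in at_right 0. lip_est K \<rho> F e C)"

definition tiny :: "'k set \<Rightarrow> (real \<Rightarrow> ('k \<Rightarrow> ps) \<Rightarrow> ps) \<Rightarrow> bool" where
  "tiny K F \<longleftrightarrow> (\<forall>e>0. \<forall>\<^sub>F \<rho> in at_right 0. lip_est K \<rho> F e e)"

section \<open>Calculus of the three grades\<close>

lemma lip_est_mono: "lip_est K \<rho> F a c \<Longrightarrow> a \<le> a' \<Longrightarrow> c \<le> c' \<Longrightarrow> lip_est K \<rho> F a' c'"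
  unfolding lip_est_def by (meson mult_right_mono order_trans)

lemma lip_estD:
  assumes "lip_est K \<rho> F a c" "0 < \<mu>" "\<mu> \<le> \<rho>" "0 \<le> B" "\<And>k. k \<in> K \<Longrightarrow> norm (z k) \<le> \<rho>"
    "\<And>k. k \<in> K \<Longrightarrow> norm (z' k) \<le> \<rho>" "\<And>k. k \<in> K \<Longrightarrow> norm (z k - z' k) \<le> B"
  shows "norm (F \<mu> z) \<le> a" "norm (F \<mu> z - F \<mu> z') \<le> c * B"
  using assms unfolding lip_est_def by blast+

lemma lip_est_const: "lip_est K \<rho> (\<lambda>_ _. v) (norm v) 0"
  by (simp add: lip_est_def)

lemma lip_est_var: "k \<in> K \<Longrightarrow> lip_est K \<rho> (\<lambda>_ z. z k) \<rho> 1"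
  by (simp add: lip_est_def)

lemma lip_est_add:
  assumes "lip_est K \<rho> F a c" "lip_est K \<rho> G a' c'"
  shows "lip_est K \<rho> (\<lambda>\<mu> z. F \<mu> z + G \<mu> z) (a + a') (c + c')"
  unfolding lip_est_def
proof (intro allI impI)
  fix \<mu> B :: real and z z' :: "'a \<Rightarrow> ps"
  assume *: "0 < \<mu> \<and> \<mu> \<le> \<rho> \<and> 0 \<le> B \<and>
     (\<forall>k\<in>K. norm (z k) \<le> \<rho> \<and> norm (z' k) \<le> \<rho> \<and> norm (z k - z' k) \<le> B)"
  have "norm (F \<mu> z) \<le> a" "norm (G \<mu> z) \<le> a'" "norm (F \<mu> z - F \<mu> z') \<le> c * B"
    "norm (G \<mu> z - G \<mu> z') \<le> c' * B"
    using assms * unfolding lip_est_def by blast+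
  then show "norm (F \<mu> z + G \<mu> z) \<le> a + a' \<and>
      norm (F \<mu> z + G \<mu> z - (F \<mu> z' + G \<mu> z')) \<le> (c + c') * B"
    by (metis add_diff_add distrib_right norm_triangle_mono)
qed

lemma lip_est_bounded_linear:
  assumes "lip_est K \<rho> F a c" "bounded_linear T" "\<And>v. norm (T v) \<le> norm v"
  shows "lip_est K \<rho> (\<lambda>\<mu> z. T (F \<mu> z)) a c"
proof -
  interpret bounded_linear T by fact
  have "norm (T v - T w) \<le> norm (v - w)" for v w
    using assms(3)[of "v - w"] by (simp add: diff)
  with assms(1,3) show ?thesis
    unfolding lip_est_def by (blast intro: order_trans)
qed

lemma lip_est_scaleR:
  assumes "lip_est K \<rho> F a c"
  shows "lip_est K \<rho> (\<lambda>\<mu> z. r *\<^sub>R F \<mu> z) (\<bar>r\<bar> * a) (\<bar>r\<bar> * c)"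
  unfolding lip_est_def
proof (intro allI impI)
  fix \<mu> B :: real and z z' :: "'a \<Rightarrow> ps"
  assume "0 < \<mu> \<and> \<mu> \<le> \<rho> \<and> 0 \<le> B \<and>
     (\<forall>k\<in>K. norm (z k) \<le> \<rho> \<and> norm (z' k) \<le> \<rho> \<and> norm (z k - z' k) \<le> B)"
  then have "norm (F \<mu> z) \<le> a" "norm (F \<mu> z - F \<mu> z') \<le> c * B"
    using assms unfolding lip_est_def by blast+
  then show "norm (r *\<^sub>R F \<mu> z) \<le> \<bar>r\<bar> * a \<and>
      norm (r *\<^sub>R F \<mu> z - r *\<^sub>R F \<mu> z') \<le> \<bar>r\<bar> * c * B"
    by (simp add: scaleR_right_diff_distrib[symmetric] mult_left_mono mult.assoc)
qed

lemma lip_est_param: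
  assumes "lip_est K \<rho> F a c" "0 < \<rho>" "0 \<le> a" "0 \<le> c"
  shows "lip_est K \<rho> (\<lambda>\<mu> z. \<mu> *\<^sub>R F \<mu> z) (\<rho> * a) (\<rho> * c)"
  unfolding lip_est_def
proof (intro allI impI)
  fix \<mu> B :: real and z z' :: "'a \<Rightarrow> ps"
  assume *: "0 < \<mu> \<and> \<mu> \<le> \<rho> \<and> 0 \<le> B \<and>
     (\<forall>k\<in>K. norm (z k) \<le> \<rho> \<and> norm (z' k) \<le> \<rho> \<and> norm (z k - z' k) \<le> B)"
  have "norm (F \<mu> z) \<le> a" "norm (F \<mu> z - F \<mu> z') \<le> c * B"
    using assms(1) * unfolding lip_est_def by blast+
  then have "\<mu> * norm (F \<mu> z) \<le> \<rho> * a" "\<mu> * norm (F \<mu> z - F \<mu> z') \<le> \<rho> * (c * B)"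
    using * assms by (auto intro!: mult_mono)
  then show "norm (\<mu> *\<^sub>R F \<mu> z) \<le> \<rho> * a \<and> norm (\<mu> *\<^sub>R F \<mu> z - \<mu> *\<^sub>R F \<mu> z') \<le> \<rho> * c * B"
    using * by (simp add: scaleR_right_diff_distrib[symmetric] mult.assoc)
qed

lemma lip_est_conv:
  assumes "lip_est K \<rho> F a c" "lip_est K \<rho> G a' c'" "0 \<le> a" "0 \<le> a'" "0 \<le> c" "0 \<le> c'"
  shows "lip_est K \<rho> (\<lambda>\<mu> z. conv (F \<mu> z) (G \<mu> z)) (a * a') (a * c' + c * a')"
  unfolding lip_est_def
proof (intro allI impI)
  interpret bounded_bilinear conv by (rule bounded_bilinear_conv)
  fix \<mu> B :: real and z z' :: "'a \<Rightarrow> ps"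
  assume *: "0 < \<mu> \<and> \<mu> \<le> \<rho> \<and> 0 \<le> B \<and>
     (\<forall>k\<in>K. norm (z k) \<le> \<rho> \<and> norm (z' k) \<le> \<rho> \<and> norm (z k - z' k) \<le> B)"
  have FG: "norm (F \<mu> z) \<le> a" "norm (G \<mu> z) \<le> a'" "norm (F \<mu> z - F \<mu> z') \<le> c * B"
    "norm (G \<mu> z - G \<mu> z') \<le> c' * B"
    using assms * unfolding lip_est_def by blast+
  have "norm (G \<mu> z') \<le> a'"
    using assms(2) * unfolding lip_est_def by (metis norm_minus_commute)
  have "conv (F \<mu> z) (G \<mu> z) - conv (F \<mu> z') (G \<mu> z') =
      conv (F \<mu> z) (G \<mu> z - G \<mu> z') + conv (F \<mu> z - F \<mu> z') (G \<mu> z')"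
    by (simp add: diff_left diff_right)
  also have "norm \<dots> \<le> norm (F \<mu> z) * norm (G \<mu> z - G \<mu> z') + norm (F \<mu> z - F \<mu> z') * norm (G \<mu> z')"
    by (intro norm_triangle_mono norm_conv)
  also have "\<dots> \<le> a * (c' * B) + (c * B) * a'"
    using FG \<open>norm (G \<mu> z') \<le> a'\<close> assms * by (intro add_mono mult_mono) auto
  finally have "norm (conv (F \<mu> z) (G \<mu> z) - conv (F \<mu> z') (G \<mu> z')) \<le> (a * c' + c * a') * B"
    by (simp add: algebra_simps)
  moreover have "norm (conv (F \<mu> z) (G \<mu> z)) \<le> a * a'"
    by (rule order_trans[OF norm_conv]) (use FG assms in \<open>auto intro: mult_mono\<close>)
  ultimately show "norm (conv (F \<mu> z) (G \<mu> z)) \<le> a * a' \<and>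
      norm (conv (F \<mu> z) (G \<mu> z) - conv (F \<mu> z') (G \<mu> z')) \<le> (a * c' + c * a') * B" by blast
qed

lemma tiny_imp_small: "tiny K F \<Longrightarrow> small K F"
  unfolding tiny_def small_def
proof (rule exI[of _ 1], intro conjI allI impI)
  fix e :: real
  assume "\<forall>e>0. \<forall>\<^sub>F \<rho> in at_right 0. lip_est K \<rho> F e e" "e > 0"
  then have "\<forall>\<^sub>F \<rho> in at_right 0. lip_est K \<rho> F (min e 1) (min e 1)" by simp
  then show "\<forall>\<^sub>F \<rho> in at_right 0. lip_est K \<rho> F e 1"
    by (rule eventually_mono) (auto elim: lip_est_mono)
qed simp

lemma small_imp_tame: "small K F \<Longrightarrow> tame K F"
  unfolding tame_def small_def by metis

lemma tame_const: "tame K (\<lambda>_ _. v)"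
  unfolding tame_def
  by (rule exI[of _ "norm v + 1"])
    (auto intro!: always_eventually lip_est_mono[OF lip_est_const] add_nonneg_pos)

lemma small_var:
  assumes "k \<in> K"
  shows "small K (\<lambda>_ z. z k)"
  unfolding small_def
proof (rule exI[of _ 1], intro conjI allI impI)
  fix e :: real assume "e > 0"
  then have "\<forall>\<^sub>F \<rho> in at_right 0. \<rho> < e" by (auto simp: eventually_at_right_field)
  then show "\<forall>\<^sub>F \<rho> in at_right 0. lip_est K \<rho> (\<lambda>_ z. z k) e 1"
    by eventually_elim (rule lip_est_mono[OF lip_est_var[OF assms]], auto)
qed simp

lemma tame_add:
  assumes "tame K F" "tame K G"
  shows "tame K (\<lambda>\<mu> z. F \<mu> z + G \<mu> z)"
proof -
  obtain C D where C: "C > 0" "\<forall>\<^sub>F \<rho> in at_right 0. lip_est K \<rho> F C C"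
    and D: "D > 0" "\<forall>\<^sub>F \<rho> in at_right 0. lip_est K \<rho> G D D"
    using assms unfolding tame_def by blast
  from C(2) D(2) have "\<forall>\<^sub>F \<rho> in at_right 0. lip_est K \<rho> (\<lambda>\<mu> z. F \<mu> z + G \<mu> z) (C + D) (C + D)"
    by eventually_elim (rule lip_est_add)
  then show ?thesis unfolding tame_def using C D by (intro exI[of _ "C + D"]) simp
qed

lemma small_add:
  assumes "small K F" "small K G"
  shows "small K (\<lambda>\<mu> z. F \<mu> z + G \<mu> z)"
proof -
  obtain C D where C: "C > 0" "\<And>e. e > 0 \<Longrightarrow> \<forall>\<^sub>F \<rho> in at_right 0. lip_est K \<rho> F e C"
    and D: "D > 0" "\<And>e. e > 0 \<Longrightarrow> \<forall>\<^sub>F \<rho> in at_right 0. lip_est K \<rho> G e D"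
    using assms unfolding small_def by blast
  have "\<forall>\<^sub>F \<rho> in at_right 0. lip_est K \<rho> (\<lambda>\<mu> z. F \<mu> z + G \<mu> z) e (C + D)" if "e > 0" for e
  proof -
    have "\<forall>\<^sub>F \<rho> in at_right 0. lip_est K \<rho> F (e/2) C" "\<forall>\<^sub>F \<rho> in at_right 0. lip_est K \<rho> G (e/2) D"
      using C(2)[of "e/2"] D(2)[of "e/2"] that by simp_all
    then show ?thesis
      by eventually_elim (drule (1) lip_est_add, simp)
  qed
  then show ?thesis unfolding small_def using C D by (intro exI[of _ "C + D"]) simp
qed

lemma tiny_add:
  assumes "tiny K F" "tiny K G"
  shows "tiny K (\<lambda>\<mu> z. F \<mu> z + G \<mu> z)"
  unfolding tiny_def
proof (intro allI impI)
  fix e :: real assume "e > 0"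
  then have "\<forall>\<^sub>F \<rho> in at_right 0. lip_est K \<rho> F (e/2) (e/2)" "\<forall>\<^sub>F \<rho> in at_right 0. lip_est K \<rho> G (e/2) (e/2)"
    using assms unfolding tiny_def by simp_all
  then show "\<forall>\<^sub>F \<rho> in at_right 0. lip_est K \<rho> (\<lambda>\<mu> z. F \<mu> z + G \<mu> z) e e"
    by eventually_elim (drule (1) lip_est_add, simp)
qed

lemma tiny_0: "tiny K (\<lambda>_ _. 0)"
  unfolding tiny_def by (simp add: lip_est_def)

lemma tiny_sum: "(\<And>i. i \<in> S \<Longrightarrow> tiny K (F i)) \<Longrightarrow> tiny K (\<lambda>\<mu> z. \<Sum>i\<in>S. F i \<mu> z)"
  by (induction S rule: infinite_finite_induct) (auto intro: tiny_0 tiny_add)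

lemma small_sum: "(\<And>i. i \<in> S \<Longrightarrow> small K (F i)) \<Longrightarrow> small K (\<lambda>\<mu> z. \<Sum>i\<in>S. F i \<mu> z)"
  by (induction S rule: infinite_finite_induct) (auto intro: tiny_0 tiny_imp_small small_add)

lemma tame_sum: "(\<And>i. i \<in> S \<Longrightarrow> tame K (F i)) \<Longrightarrow> tame K (\<lambda>\<mu> z. \<Sum>i\<in>S. F i \<mu> z)"
  by (induction S rule: infinite_finite_induct) (auto intro: tame_const tame_add)

lemma bounded_linear_tame:
  assumes "bounded_linear T" "\<And>v. norm (T v) \<le> norm v"
  shows "tame K F \<Longrightarrow> tame K (\<lambda>\<mu> z. T (F \<mu> z))"
    and "small K F \<Longrightarrow> small K (\<lambda>\<mu> z. T (F \<mu> z))"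
proof -
  note lin = lip_est_bounded_linear[OF _ assms]
  show "tame K F \<Longrightarrow> tame K (\<lambda>\<mu> z. T (F \<mu> z))"
  proof -
    assume "tame K F"
    then obtain C where C: "C > 0" "\<forall>\<^sub>F \<rho> in at_right 0. lip_est K \<rho> F C C"
      unfolding tame_def by blast
    from C(2) have "\<forall>\<^sub>F \<rho> in at_right 0. lip_est K \<rho> (\<lambda>\<mu> z. T (F \<mu> z)) C C"
      by eventually_elim (rule lin)
    with C(1) show ?thesis unfolding tame_def by blast
  qed
  show "small K F \<Longrightarrow> small K (\<lambda>\<mu> z. T (F \<mu> z))"
  proof -
    assume "small K F"
    then obtain C where C: "C > 0" "\<And>e. e > 0 \<Longrightarrow> \<forall>\<^sub>F \<rho> in at_right 0. lip_est K \<rho> F e C"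
      unfolding small_def by blast
    have "\<forall>\<^sub>F \<rho> in at_right 0. lip_est K \<rho> (\<lambda>\<mu> z. T (F \<mu> z)) e C" if "e > 0" for e
      using C(2)[OF that] by eventually_elim (rule lin)
    with C(1) show ?thesis unfolding small_def by blast
  qed
qed

lemma tame_scaleR:
  assumes "tame K F"
  shows "tame K (\<lambda>\<mu> z. r *\<^sub>R F \<mu> z)"
proof -
  obtain C where C: "C > 0" "\<forall>\<^sub>F \<rho> in at_right 0. lip_est K \<rho> F C C"
    using assms unfolding tame_def by blast
  from C(2) have "\<forall>\<^sub>F \<rho> in at_right 0. lip_est K \<rho> (\<lambda>\<mu> z. r *\<^sub>R F \<mu> z) ((\<bar>r\<bar> + 1) * C) ((\<bar>r\<bar> + 1) * C)"
    by eventually_elim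
      (rule lip_est_mono[OF lip_est_scaleR], assumption, use C in \<open>auto simp: algebra_simps\<close>)
  then show ?thesis unfolding tame_def using C by (intro exI[of _ "(\<bar>r\<bar> + 1) * C"]) auto
qed

lemma small_scaleR:
  assumes "small K F"
  shows "small K (\<lambda>\<mu> z. r *\<^sub>R F \<mu> z)"
proof -
  obtain C where C: "C > 0" "\<And>e. e > 0 \<Longrightarrow> \<forall>\<^sub>F \<rho> in at_right 0. lip_est K \<rho> F e C"
    using assms unfolding small_def by blast
  have "\<forall>\<^sub>F \<rho> in at_right 0. lip_est K \<rho> (\<lambda>\<mu> z. r *\<^sub>R F \<mu> z) e ((\<bar>r\<bar> + 1) * C)" if "e > 0" for e
  proof -
    have "\<forall>\<^sub>F \<rho> in at_right 0. lip_est K \<rho> F (e / (\<bar>r\<bar> + 1)) C"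
      using that by (intro C) (auto intro: divide_pos_pos)
    then show ?thesis
      by eventually_elim
        (rule lip_est_mono[OF lip_est_scaleR], assumption,
          use C that in \<open>auto simp: field_simps add_nonneg_pos\<close>)
  qed
  then show ?thesis unfolding small_def using C by (intro exI[of _ "(\<bar>r\<bar> + 1) * C"]) auto
qed

lemma tiny_scaleR:
  assumes "tiny K F"
  shows "tiny K (\<lambda>\<mu> z. r *\<^sub>R F \<mu> z)"
  unfolding tiny_def
proof (intro allI impI)
  fix e :: real assume "e > 0"
  then have "\<forall>\<^sub>F \<rho> in at_right 0. lip_est K \<rho> F (e / (\<bar>r\<bar> + 1)) (e / (\<bar>r\<bar> + 1))"
    using assms unfolding tiny_def by (auto intro: divide_pos_pos)
  then show "\<forall>\<^sub>F \<rho> in at_right 0. lip_est K \<rho> (\<lambda>\<mu> z. r *\<^sub>R F \<mu> z) e e"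
    by eventually_elim
      (rule lip_est_mono[OF lip_est_scaleR], assumption,
        use \<open>e > 0\<close> in \<open>auto simp: field_simps add_nonneg_pos\<close>)
qed

text \<open>A factor \<open>\<mu> \<le> \<rho>\<close> multiplies both constants by
  \<open>\<rho>\<close>, which upgrades the weakest grade to the strongest.\<close>

lemma tiny_param:
  assumes "tame K F"
  shows "tiny K (\<lambda>\<mu> z. \<mu> *\<^sub>R F \<mu> z)"
  unfolding tiny_def
proof (intro allI impI)
  fix e :: real assume "e > 0"
  obtain C where C: "C > 0" "\<forall>\<^sub>F \<rho> in at_right 0. lip_est K \<rho> F C C"
    using assms unfolding tame_def by blast
  have "\<forall>\<^sub>F \<rho> in at_right 0. 0 < \<rho> \<and> \<rho> < e / C"
    using \<open>e > 0\<close> C by (auto simp: eventually_at_right_field intro!: exI[of _ "e / C"])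
  with C(2) show "\<forall>\<^sub>F \<rho> in at_right 0. lip_est K \<rho> (\<lambda>\<mu> z. \<mu> *\<^sub>R F \<mu> z) e e"
    by eventually_elim
      (rule lip_est_mono[OF lip_est_param], assumption, use C in \<open>auto simp: field_simps\<close>)
qed

lemma tame_conv:
  assumes "tame K F" "tame K G"
  shows "tame K (\<lambda>\<mu> z. conv (F \<mu> z) (G \<mu> z))"
proof -
  obtain C D where C: "C > 0" "\<forall>\<^sub>F \<rho> in at_right 0. lip_est K \<rho> F C C"
    and D: "D > 0" "\<forall>\<^sub>F \<rho> in at_right 0. lip_est K \<rho> G D D"
    using assms unfolding tame_def by blast
  from C(2) D(2) have "\<forall>\<^sub>F \<rho> in at_right 0.
      lip_est K \<rho> (\<lambda>\<mu> z. conv (F \<mu> z) (G \<mu> z)) (C * D + C * D) (C * D + C * D)"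
    by eventually_elim (rule lip_est_mono[OF lip_est_conv], assumption+, use C D in auto)
  then show ?thesis unfolding tame_def using C D by (intro exI[of _ "C * D + C * D"]) simp
qed

text \<open>The Lipschitz constant of a product pairs that of one factor with the norm of the other.
  Bounded Lipschitz constants therefore suffice when both norms tend to 0.\<close>

lemma small_conv:
  assumes "small K F" "small K G"
  shows "tiny K (\<lambda>\<mu> z. conv (F \<mu> z) (G \<mu> z))"
  unfolding tiny_def
proof (intro allI impI)
  fix e :: real assume e: "e > 0"
  obtain C D where C: "C > 0" "\<And>e. e > 0 \<Longrightarrow> \<forall>\<^sub>F \<rho> in at_right 0. lip_est K \<rho> F e C"
    and D: "D > 0" "\<And>e. e > 0 \<Longrightarrow> \<forall>\<^sub>F \<rho> in at_right 0. lip_est K \<rho> G e D"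
    using assms unfolding small_def by blast
  \<comment> \<open>Chosen so that the norm bound \<open>d * d\<close> and the Lipschitz constant
    \<open>d * D + C * d\<close> of the product are both at most \<open>e\<close>.\<close>
  define d where "d = min 1 (e / (C + D + 1))"
  have d: "d > 0" "d \<le> 1" "d * (C + D + 1) \<le> e"
    using e C D by (auto simp: d_def min_def field_simps add_pos_pos)
  have "d * d \<le> d * (C + D + 1)" using d C D by (intro mult_left_mono) auto
  moreover have "d * D + C * d \<le> d * (C + D + 1)" using d by (simp add: algebra_simps)
  moreover note d
  ultimately have le: "d * d \<le> e" "d * D + C * d \<le> e" by linarith+
  from C(2)[OF d(1)] D(2)[OF d(1)]
  show "\<forall>\<^sub>F \<rho> in at_right 0. lip_est K \<rho> (\<lambda>\<mu> z. conv (F \<mu> z) (G \<mu> z)) e e"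
    by eventually_elim (rule lip_est_mono[OF lip_est_conv], assumption+, use C D d le in auto)
qed

text \<open>Fixed point iteration from 0. First \<open>\<rho>\<close> is fixed so that the Lipschitz
  constants on radius \<open>\<rho>\<close> are 1/2; then \<open>\<mu>\<close> is taken so small
  that the values at 0 are at most \<open>\<rho>/2\<close>, which keeps the iterates within radius
  \<open>\<rho>\<close>.\<close>

lemma contraction_system:
  fixes F :: "'k \<Rightarrow> real \<Rightarrow> ('k \<Rightarrow> ps) \<Rightarrow> ps"
  assumes "finite K" "\<And>k. k \<in> K \<Longrightarrow> tiny K (F k)" "\<rho>0 > 0"
  obtains \<mu> z where "0 < \<mu>" "\<mu> \<le> \<rho>0" "\<And>k. k \<in> K \<Longrightarrow> norm (z k) \<le> \<rho>0" "\<And>k. k \<in> K \<Longrightarrow> z k = F k \<mu> z"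
proof -
  have ev: "\<forall>\<^sub>F \<rho> in at_right 0. (\<forall>k\<in>K. lip_est K \<rho> (F k) e e) \<and> 0 < \<rho> \<and> \<rho> < b" if "e > 0" "b > 0" for e b
    using assms(1,2) that
    by (intro eventually_conj eventually_ball_finite)
      (auto simp: tiny_def eventually_at_right_field)
  have exists: "\<exists>\<rho>. (\<forall>k\<in>K. lip_est K \<rho> (F k) e e) \<and> 0 < \<rho> \<and> \<rho> < b" if "e > 0" "b > 0" for e b
    using eventually_happens[OF ev[OF that]] by simp
  obtain \<rho> where \<rho>: "\<And>k. k \<in> K \<Longrightarrow> lip_est K \<rho> (F k) (1/2) (1/2)" "0 < \<rho>" "\<rho> < \<rho>0"
    using exists[of "1/2" \<rho>0] assms by auto
  obtain \<mu> where \<mu>: "\<And>k. k \<in> K \<Longrightarrow> lip_est K \<mu> (F k) (\<rho>/2) (\<rho>/2)" "0 < \<mu>" "\<mu> < \<rho>"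
    using exists[of "\<rho>/2" \<rho>] \<rho> by auto
  define Z where "Z = rec_nat (\<lambda>_. 0) (\<lambda>_ z k. F k \<mu> z)"
  have Z: "Z 0 = (\<lambda>_. 0)" "Z (Suc m) = (\<lambda>k. F k \<mu> (Z m))" for m by (simp_all add: Z_def)
  have F0: "norm (F k \<mu> (\<lambda>_. 0)) \<le> \<rho> / 2" if "k \<in> K" for k
    using lip_estD(1)[OF \<mu>(1)[OF that], of \<mu> 0 "\<lambda>_. 0" "\<lambda>_. 0"] \<mu> by simp
  have lip: "norm (F k \<mu> z - F k \<mu> z') \<le> 1/2 * B"
    if "k \<in> K" "\<And>k. k \<in> K \<Longrightarrow> norm (z k) \<le> \<rho>" "\<And>k. k \<in> K \<Longrightarrow> norm (z' k) \<le> \<rho>"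
      "\<And>k. k \<in> K \<Longrightarrow> norm (z k - z' k) \<le> B" "0 \<le> B" for k z z' B
    using lip_estD(2)[OF \<rho>(1)[OF that(1)], of \<mu> B z z'] that \<mu> by simp
  have Zb: "k \<in> K \<Longrightarrow> norm (Z m k) \<le> \<rho>" for k m
  proof (induction m arbitrary: k)
    case (Suc m)
    have "norm (F k \<mu> (Z m) - F k \<mu> (\<lambda>_. 0)) \<le> 1/2 * \<rho>"
      by (rule lip) (use Suc \<rho> in auto)
    moreover have "norm (Z (Suc m) k) \<le> norm (F k \<mu> (Z m) - F k \<mu> (\<lambda>_. 0)) + norm (F k \<mu> (\<lambda>_. 0))"
      unfolding Z by (metis diff_add_cancel norm_triangle_ineq)
    ultimately show ?case using F0[OF Suc.prems] by simp
  qed (use \<rho> in \<open>simp add: Z\<close>)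
  have Zd: "k \<in> K \<Longrightarrow> norm (Z (Suc m) k - Z m k) \<le> \<rho> * (1/2) ^ m" for k m
  proof (induction m arbitrary: k)
    case 0
    then show ?case using Zb[of k 1] by (simp add: Z)
  next
    case (Suc m)
    have "norm (F k \<mu> (Z (Suc m)) - F k \<mu> (Z m)) \<le> 1/2 * (\<rho> * (1/2) ^ m)"
      by (rule lip) (use Suc Zb \<rho> in auto)
    then show ?case unfolding Z by simp
  qed
  have "convergent (\<lambda>m. Z m k)" if "k \<in> K" for k
  proof -
    have "summable (\<lambda>m. \<rho> * (1/2) ^ m)" by (intro summable_mult summable_geometric) simp
    then have "summable (\<lambda>m. Z (Suc m) k - Z m k)"
      by (rule summable_comparison_test') (use Zd[OF that] in auto)
    then have "convergent (\<lambda>m. \<Sum>j<m. Z (Suc j) k - Z j k)"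
      by (simp add: summable_iff_convergent)
    then show ?thesis
      unfolding sum_lessThan_telescope[of "\<lambda>j. Z j k"] Z(1) by simp
  qed
  then obtain L where L: "\<And>k. k \<in> K \<Longrightarrow> (\<lambda>m. Z m k) \<longlonglongrightarrow> L k"
    unfolding convergent_def by metis
  have Lb: "norm (L k) \<le> \<rho>" if "k \<in> K" for k
    using tendsto_upperbound[OF tendsto_norm[OF L[OF that]]] Zb[OF that] by (simp add: eventually_sequentially)
  show thesis
  proof (rule that[of \<mu> L])
    fix k assume k: "k \<in> K"
    \<comment> \<open>A sum in place of the maximum: it dominates every difference and tends to 0
      because \<open>K\<close> is finite.\<close>
    let ?B = "\<lambda>m. \<Sum>k\<in>K. norm (Z m k - L k)"
    have "?B \<longlonglongrightarrow> (\<Sum>k\<in>K. norm (L k - L k))" by (intro tendsto_intros L)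
    then have B: "(\<lambda>m. 1/2 * ?B m) \<longlonglongrightarrow> 0" by (intro tendsto_mult_right_zero) simp
    have "norm (F k \<mu> (Z m) - F k \<mu> L) \<le> 1/2 * ?B m" for m
      by (rule lip[OF k]) (auto simp: Zb Lb sum_nonneg intro: member_le_sum assms(1))
    then have "(\<lambda>m. F k \<mu> (Z m)) \<longlonglongrightarrow> F k \<mu> L"
      by (intro Lim_null_comparison[OF _ B, THEN LIM_zero_cancel] always_eventually) auto
    then have "(\<lambda>m. Z (Suc m) k) \<longlonglongrightarrow> F k \<mu> L" by (simp add: Z)
    then show "L k = F k \<mu> L"
      using LIMSEQ_Suc[OF L[OF k]] LIMSEQ_unique by blast
    show "norm (L k) \<le> \<rho>0" using Lb[OF k] \<rho> by simp
  qed (use \<mu> \<rho> in auto)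
qed

section \<open>The system of equations for the metric\<close>

lemma tame_diff: "tame K F \<Longrightarrow> tame K G \<Longrightarrow> tame K (\<lambda>\<mu> z. F \<mu> z - G \<mu> z)"
  using tame_add[of K F "\<lambda>\<mu> z. (-1) *\<^sub>R G \<mu> z"] tame_scaleR[of K G "-1"] by simp

lemma small_diff: "small K F \<Longrightarrow> small K G \<Longrightarrow> small K (\<lambda>\<mu> z. F \<mu> z - G \<mu> z)"
  using small_add[of K F "\<lambda>\<mu> z. (-1) *\<^sub>R G \<mu> z"] small_scaleR[of K G "-1"] by simp

lemma tiny_diff: "tiny K F \<Longrightarrow> tiny K G \<Longrightarrow> tiny K (\<lambda>\<mu> z. F \<mu> z - G \<mu> z)"
  using tiny_add[of K F "\<lambda>\<mu> z. (-1) *\<^sub>R G \<mu> z"] tiny_scaleR[of K G "-1"] by simp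

type_synonym unknowns = "(nat \<times> nat) option \<Rightarrow> ps"

locale curvature_components =
  fixes n :: nat and eps :: "nat \<Rightarrow> real" and a :: "nat \<Rightarrow> nat \<Rightarrow> nat \<Rightarrow> nat \<Rightarrow> real"
  assumes eps: "eps i = 1 \<or> eps i = - 1"
    and a_skew: "a i j k l = - a j i k l"
    and a_pair: "a i j k l = a k l i j"
    and a_cyclic: "a i j k l + a j k i l + a k i j l = 0"
begin

lemma eps_sq [simp]: "eps i * eps i = 1"
  using eps[of i] by auto

lemma eps_sq_left [simp]: "eps i * (eps i * r) = r"
  by (simp flip: mult.assoc)

definition diag :: "nat \<Rightarrow> nat \<Rightarrow> real" where
  "diag i j = (if i = j then eps i else 0)"

text \<open>The second partial derivatives \<open>\<partial>\<^sub>k\<partial>\<^sub>l\<close> of \<open>\<Sum>\<^sub>k\<^sub>l a\<^sub>i\<^sub>k\<^sub>j\<^sub>l x\<^sub>k x\<^sub>l / 3\<close>, the quadratic term of a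
  metric in normal coordinates with curvature \<open>a\<close> at the origin.\<close>

definition quad :: "nat \<Rightarrow> nat \<Rightarrow> nat \<Rightarrow> nat \<Rightarrow> real" where
  "quad k l i j = (a i k j l + a i l j k) / 3"

lemma quad_sym: "quad k l i j = quad l k i j" "quad k l i j = quad k l j i"
  using a_pair[of i k j l] a_pair[of i l j k] by (auto simp: quad_def)

text \<open>The left side is the lowered curvature where the first derivatives of the metric vanish.
  Of the eight terms four equal \<open>a i j k l\<close> by the symmetries, and the cyclic identity
  combines the rest to twice that value; the total of 6 cancels the denominators 3 and 2.\<close>

lemma quad_curvature:
  "(quad i k j l - quad j k i l - quad i l j k + quad j l i k) / 2 = a i j k l"
proof -
  have skew2: "a i j k l = - a i j l k" for i j k l
    using a_skew[of k l i j] a_pair[of i j k l] a_pair[of i j l k] by simp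
  have "a j i l k = a i j k l" using a_skew[of j i l k] skew2[of i j l k] by simp
  moreover have "a j i k l = - a i j k l" by (rule a_skew)
  moreover have "a i j l k = - a i j k l" by (rule skew2)
  moreover have "a j k l i = a i l k j"
    using a_skew[of j k l i] skew2[of k j l i] a_pair[of k j i l] by simp
  moreover have "a j l k i = a i k l j"
    using a_skew[of j l k i] skew2[of l j k i] a_pair[of l j i k] by simp
  moreover have "a i l k j - a i k l j = a i j k l"
  proof -
    have "a i j k l = a k l i j" "a i l k j = - a l i k j" "a i k l j = a k i j l"
      using a_pair[of i j k l] a_skew[of i l k j] a_skew[of i k l j] skew2[of k i l j] by auto
    moreover have "a k i j l = - a i k j l" by (rule a_skew)
    moreover have "a l i k j = - a l i j k" by (rule skew2)
    moreover have "a k l i j + a l i k j + a i k l j = 0" by (rule a_cyclic)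
    ultimately show ?thesis by linarith
  qed
  ultimately show ?thesis
    unfolding quad_def by (simp add: field_simps)
qed

text \<open>The deformation \<open>h = \<phi> s\<close> of the flat metric is chosen such that the linearised scalar
  curvature \<open>div div h - \<Delta> tr h\<close> is \<open>(1 - n) eps\<^sub>0 \<partial>\<^sub>0\<^sup>2 \<phi>\<close>, without any other derivative of \<open>\<phi>\<close>.\<close>

definition shape :: "nat \<Rightarrow> nat \<Rightarrow> real" where
  "shape i j = (if i \<noteq> j then 0 else if i = 0 then (2 - real n) * eps 0 else eps i)"

lemma shape_sym: "shape i j = shape j i"
  by (simp add: shape_def)

text \<open>The double sum is \<open>2 * (\<Sum>i<n. (s i i - tr s * eps i) * W i i)\<close> with
  \<open>s = shape\<close>. Normalising \<open>tr s = 1\<close> and demanding that every coefficient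
  with \<open>i \<noteq> 0\<close> vanish forces \<open>s i i = eps i\<close> there; the trace then
  leaves \<open>1 - (n - 1) = 2 - n\<close> for the entry at 0.\<close>

lemma linearised_scalar_curvature:
  assumes "n > 0"
  shows "(\<Sum>i<n. \<Sum>j<n. eps i * eps j *
    (shape j i * W i j - shape i i * W j j - shape j j * W i i + shape i j * W j i)) =
    2 * ((1 - real n) * eps 0 * W 0 0)"
proof -
  have tr: "(\<Sum>i<n. eps i * shape i i) = 1"
  proof -
    have "(\<Sum>i<n. eps i * shape i i) = (\<Sum>i<n. 1 + (if i = 0 then 1 - real n else 0))"
      by (intro sum.cong) (auto simp: shape_def algebra_simps)
    also have "\<dots> = 1" using assms by (simp add: sum.distrib)
    finally show ?thesis .
  qed
  have off: "(\<Sum>j<n. eps i * eps j * (shape i j * X i j)) = shape i i * X i i" if "i < n" for i X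
  proof -
    have "(\<Sum>j<n. eps i * eps j * (shape i j * X i j)) = (\<Sum>j<n. if i = j then shape i i * X i i else 0)"
      by (intro sum.cong) (auto simp: shape_def)
    then show ?thesis using that by simp
  qed
  have d1: "(\<Sum>i<n. \<Sum>j<n. eps i * eps j * (shape j i * X i j)) = (\<Sum>i<n. shape i i * X i i)" for X
    using off[of _ X] by (simp add: shape_sym[of _ "_ :: nat"])
  have d2: "(\<Sum>i<n. \<Sum>j<n. eps i * eps j * (shape i i * W j j)) = (\<Sum>j<n. eps j * W j j)"
  proof -
    have "(\<Sum>i<n. \<Sum>j<n. eps i * eps j * (shape i i * W j j)) =
        (\<Sum>i<n. eps i * shape i i) * (\<Sum>j<n. eps j * W j j)"
      unfolding sum_product by (simp only: mult_ac)
    then show ?thesis by (simp add: tr)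
  qed
  have d3: "(\<Sum>i<n. \<Sum>j<n. eps i * eps j * (shape j j * W i i)) = (\<Sum>j<n. eps j * W j j)"
  proof -
    have "(\<Sum>i<n. \<Sum>j<n. eps i * eps j * (shape j j * W i i)) =
        (\<Sum>j<n. \<Sum>i<n. eps j * eps i * (shape j j * W i i))"
      by (subst sum.swap) (simp only: mult.commute)
    then show ?thesis using d2 by (simp only:)
  qed
  have "(\<Sum>i<n. \<Sum>j<n. eps i * eps j *
      (shape j i * W i j - shape i i * W j j - shape j j * W i i + shape i j * W j i)) =
      2 * (\<Sum>i<n. (shape i i - eps i) * W i i)"
    using d1[of W] d1[of "\<lambda>i j. W j i"] d2 d3
    by (simp add: algebra_simps sum.distrib sum_subtractf shape_sym[of _ "_ :: nat"])
  also have "(\<Sum>i<n. (shape i i - eps i) * W i i) =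
      (\<Sum>i<n. if i = 0 then (1 - real n) * eps 0 * W 0 0 else 0)"
    by (intro sum.cong) (auto simp: shape_def algebra_simps)
  finally show ?thesis using assms by simp
qed

text \<open>The unknowns are \<open>w\<close>, the second \<open>x\<^sub>0\<close>-derivative of the deformation up to the factor \<open>\<mu>\<close>,
  and the deviation \<open>h\<close> of the inverse metric from the constant diagonal one.\<close>

definition unknowns :: "(nat \<times> nat) option set" where
  "unknowns = insert None (Some ` ({..<n} \<times> {..<n}))"

definition dmet :: "real \<Rightarrow> unknowns \<Rightarrow> nat \<Rightarrow> nat \<Rightarrow> ps" where
  "dmet \<mu> z i j = \<mu> *\<^sub>R (\<mu> *\<^sub>R ((1/2) *\<^sub>R (\<Sum>k<n. \<Sum>l<n. quad k l i j *\<^sub>R conv (var k) (var l))) +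
     shape i j *\<^sub>R integrate (integrate (z None)))"

text \<open>\<open>dmet1\<close> and \<open>dmet2\<close> are the first and second derivatives of
  \<open>dmet\<close> with one factor \<open>\<mu>\<close> divided out; the derivatives of the
  double integral appear as slopes of \<open>z None\<close>.\<close>

definition dmet1 :: "real \<Rightarrow> unknowns \<Rightarrow> nat \<Rightarrow> nat \<Rightarrow> nat \<Rightarrow> ps" where
  "dmet1 \<mu> z k i j = \<mu> *\<^sub>R (\<Sum>l<n. quad k l i j *\<^sub>R var l) + shape i j *\<^sub>R slope k (integrate (z None))"

definition dmet2 :: "real \<Rightarrow> unknowns \<Rightarrow> nat \<Rightarrow> nat \<Rightarrow> nat \<Rightarrow> nat \<Rightarrow> ps" where
  "dmet2 \<mu> z k l i j = \<mu> *\<^sub>R const_l1 (quad k l i j) + shape i j *\<^sub>R slope k (slope l (z None))"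

definition inv_dev :: "real \<Rightarrow> unknowns \<Rightarrow> nat \<Rightarrow> nat \<Rightarrow> ps" where
  "inv_dev \<mu> z i j = z (Some (i, j))"

definition inv_met :: "real \<Rightarrow> unknowns \<Rightarrow> nat \<Rightarrow> nat \<Rightarrow> ps" where
  "inv_met \<mu> z i j = const_l1 (diag i j) + inv_dev \<mu> z i j"

definition chris :: "real \<Rightarrow> unknowns \<Rightarrow> nat \<Rightarrow> nat \<Rightarrow> nat \<Rightarrow> ps" where
  "chris \<mu> z l i j = (1/2) *\<^sub>R (dmet1 \<mu> z i j l + dmet1 \<mu> z j i l - dmet1 \<mu> z l i j)"

text \<open>\<open>chris\<close> being divided by \<open>\<mu>\<close> too, the lowered curvature of
  the metric \<open>met\<close> below is
  \<open>\<mu> * (curv_lin - \<mu> * curv_quad)\<close>.\<close>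

definition curv_lin :: "real \<Rightarrow> unknowns \<Rightarrow> nat \<Rightarrow> nat \<Rightarrow> nat \<Rightarrow> nat \<Rightarrow> ps" where
  "curv_lin \<mu> z i j k l = (1/2) *\<^sub>R
     (dmet2 \<mu> z i k j l - dmet2 \<mu> z j k i l - dmet2 \<mu> z i l j k + dmet2 \<mu> z j l i k)"

definition curv_quad :: "real \<Rightarrow> unknowns \<Rightarrow> nat \<Rightarrow> nat \<Rightarrow> nat \<Rightarrow> nat \<Rightarrow> ps" where
  "curv_quad \<mu> z i j k l = (\<Sum>p<n. \<Sum>q<n. conv (inv_met \<mu> z p q)
     (conv (chris \<mu> z p j k) (chris \<mu> z q i l) - conv (chris \<mu> z p i k) (chris \<mu> z q j l)))"

text \<open>What a product of two entries of \<open>inv_met\<close> exceeds the product of the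
  corresponding entries of \<open>diag\<close> by.\<close>

definition inv_sq_dev :: "real \<Rightarrow> unknowns \<Rightarrow> nat \<Rightarrow> nat \<Rightarrow> nat \<Rightarrow> nat \<Rightarrow> ps" where
  "inv_sq_dev \<mu> z i l j k = diag i l *\<^sub>R inv_dev \<mu> z j k + diag j k *\<^sub>R inv_dev \<mu> z i l +
     conv (inv_dev \<mu> z i l) (inv_dev \<mu> z j k)"

definition scal_rest :: "real \<Rightarrow> unknowns \<Rightarrow> ps" where
  "scal_rest \<mu> z =
     (\<Sum>i<n. \<Sum>j<n. \<Sum>k<n. \<Sum>l<n. conv (inv_sq_dev \<mu> z i l j k) (curv_lin \<mu> z i j k l)) -
     \<mu> *\<^sub>R (\<Sum>i<n. \<Sum>j<n. \<Sum>k<n. \<Sum>l<n.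
       conv (conv (inv_met \<mu> z i l) (inv_met \<mu> z j k)) (curv_quad \<mu> z i j k l))"

text \<open>Contracting \<open>curv_lin\<close> with \<open>diag\<close> gives
  \<open>\<mu> * scal + (1 - n) * eps 0 * w\<close>, and \<open>scal_rest\<close> is everything
  else; solving for \<open>w\<close> makes the whole contraction equal to
  \<open>\<mu> * scal\<close>. The other equations are \<open>met * inv_met = 1\<close>, solved for
  the deviation. For \<open>n = 1\<close> the division by 0 makes the first right side 0.\<close>

definition system :: "(nat \<times> nat) option \<Rightarrow> real \<Rightarrow> unknowns \<Rightarrow> ps" where
  "system u \<mu> z = (case u of
     None \<Rightarrow> (- 1 / ((1 - real n) * eps 0)) *\<^sub>R scal_rest \<mu> z
   | Some (i, j) \<Rightarrow> (- eps i) *\<^sub>R (\<Sum>k<n. conv (dmet \<mu> z i k) (inv_met \<mu> z k j)))"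

section \<open>Grades of the terms of the system\<close>

lemmas tame_intros = tame_add tame_diff tame_scaleR tame_sum tame_conv tame_const
lemmas small_intros = small_add small_diff small_scaleR small_sum
lemmas tiny_intros = tiny_add tiny_diff tiny_scaleR tiny_sum

lemmas integrate_tame = bounded_linear_tame[OF bounded_linear_integrate norm_integrate]
lemmas slope_tame = bounded_linear_tame[OF bounded_linear_slope norm_slope]

lemma small_None: "small unknowns (\<lambda>\<mu> z. z None)"
  by (rule small_var) (simp add: unknowns_def)

lemma small_inv_dev: "i < n \<Longrightarrow> j < n \<Longrightarrow> small unknowns (\<lambda>\<mu> z. inv_dev \<mu> z i j)"
  unfolding inv_dev_def by (rule small_var) (auto simp: unknowns_def)

lemma tame_inv_met: "i < n \<Longrightarrow> j < n \<Longrightarrow> tame unknowns (\<lambda>\<mu> z. inv_met \<mu> z i j)"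
  unfolding inv_met_def by (intro tame_intros small_imp_tame[OF small_inv_dev])

lemma tiny_dmet: "tiny unknowns (\<lambda>\<mu> z. dmet \<mu> z i j)"
  unfolding dmet_def
  by (intro tiny_param tame_intros tiny_param[THEN tiny_imp_small, THEN small_imp_tame]
      integrate_tame(1) small_imp_tame[OF small_None])

lemma tame_chris: "tame unknowns (\<lambda>\<mu> z. chris \<mu> z l i j)"
  unfolding chris_def dmet1_def
  by (intro tame_intros tiny_param[THEN tiny_imp_small, THEN small_imp_tame]
      integrate_tame(1) slope_tame(1) small_imp_tame[OF small_None])

text \<open>Its constant term has a factor \<open>\<mu>\<close> only because the deformation carries
  one power of \<open>\<mu>\<close> less than the quadratic term; with equal powers
  \<open>curv_lin\<close> would not tend to 0. It is not tiny, since \<open>w\<close> enters with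
  constant coefficients.\<close>

lemma small_curv_lin: "small unknowns (\<lambda>\<mu> z. curv_lin \<mu> z i j k l)"
  unfolding curv_lin_def dmet2_def
  by (intro small_intros tiny_param[THEN tiny_imp_small] tame_const slope_tame(2) small_None)

lemma tame_curv_quad: "tame unknowns (\<lambda>\<mu> z. curv_quad \<mu> z i j k l)"
  unfolding curv_quad_def by (intro tame_intros tame_chris tame_inv_met) auto

lemma small_inv_sq_dev:
  "i < n \<Longrightarrow> j < n \<Longrightarrow> k < n \<Longrightarrow> l < n \<Longrightarrow> small unknowns (\<lambda>\<mu> z. inv_sq_dev \<mu> z i l j k)"
  unfolding inv_sq_dev_def
  by (intro small_intros small_inv_dev small_conv[THEN tiny_imp_small])

text \<open>In \<open>scal_rest\<close> the small \<open>curv_lin\<close> is multiplied by the small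
  \<open>inv_sq_dev\<close>, and the tame quadratic terms by \<open>\<mu>\<close>; in the equations
  for the inverse, \<open>dmet\<close> supplies a factor \<open>\<mu>\<close>.\<close>

lemma tiny_system:
  assumes "u \<in> unknowns"
  shows "tiny unknowns (system u)"
proof (cases u)
  case None
  have "tiny unknowns (\<lambda>\<mu> z. scal_rest \<mu> z)"
    unfolding scal_rest_def
    by (intro tiny_intros tiny_param tame_intros small_conv small_inv_sq_dev small_curv_lin
        tame_inv_met tame_curv_quad) auto
  then have "tiny unknowns (\<lambda>\<mu> z. (- 1 / ((1 - real n) * eps 0)) *\<^sub>R scal_rest \<mu> z)"
    by (rule tiny_scaleR)
  moreover have "system None = (\<lambda>\<mu> z. (- 1 / ((1 - real n) * eps 0)) *\<^sub>R scal_rest \<mu> z)"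
    by (intro ext) (simp add: system_def)
  ultimately show ?thesis using None by (simp only:)
next
  case (Some p)
  then obtain i j where u: "u = Some (i, j)" "i < n" "j < n" using assms by (auto simp: unknowns_def)
  have "tiny unknowns (\<lambda>\<mu> z. conv (dmet \<mu> z i k) (inv_met \<mu> z k j))" if "k < n" for k
    \<comment> \<open>Pulls the outer \<open>\<mu>\<close> of \<open>dmet\<close> out of the
      product; for the rest, tameness is enough.\<close>
    unfolding dmet_def bounded_bilinear.scaleR_left[OF bounded_bilinear_conv] using that u
    by (intro tiny_param tame_intros tiny_param[THEN tiny_imp_small, THEN small_imp_tame]
        integrate_tame(1) small_imp_tame[OF small_None] tame_inv_met)
  then have "tiny unknowns (\<lambda>\<mu> z. (- eps i) *\<^sub>R (\<Sum>k<n. conv (dmet \<mu> z i k) (inv_met \<mu> z k j)))"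
    by (intro tiny_scaleR tiny_sum) auto
  moreover have "system u = (\<lambda>\<mu> z. (- eps i) *\<^sub>R (\<Sum>k<n. conv (dmet \<mu> z i k) (inv_met \<mu> z k j)))"
    by (intro ext) (simp add: u system_def)
  ultimately show ?thesis by (simp only:)
qed

section \<open>Solutions of the system\<close>

definition solution :: "real \<Rightarrow> unknowns \<Rightarrow> bool" where
  "solution \<mu> z \<longleftrightarrow> (\<forall>u\<in>unknowns. z u = system u \<mu> z)"

definition met :: "real \<Rightarrow> unknowns \<Rightarrow> nat \<Rightarrow> nat \<Rightarrow> ps" where
  "met \<mu> z i j = const_l1 (diag i j) + dmet \<mu> z i j"

text \<open>The bound on \<open>dmet\<close> keeps the metric close to the diagonal one on the whole
  cube, which will fix its signature.\<close>

lemma exists_solution: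
  assumes "\<eta> > 0"
  obtains \<mu> z where "\<mu> > 0" "solution \<mu> z" "\<And>i j. i < n \<Longrightarrow> j < n \<Longrightarrow> norm (dmet \<mu> z i j) \<le> \<eta>"
proof -
  have "\<forall>\<^sub>F \<rho> in at_right 0. \<forall>i\<in>{..<n}. \<forall>j\<in>{..<n}. lip_est unknowns \<rho> (\<lambda>\<mu> z. dmet \<mu> z i j) \<eta> \<eta>"
    using tiny_dmet assms unfolding tiny_def by (intro eventually_ball_finite ballI) auto
  then obtain \<rho> where \<rho>: "\<rho> > 0"
    "\<And>i j. i < n \<Longrightarrow> j < n \<Longrightarrow> lip_est unknowns \<rho> (\<lambda>\<mu> z. dmet \<mu> z i j) \<eta> \<eta>"
    unfolding eventually_at_right_field by (metis field_lbound_gt_zero lessThan_iff dense)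
  obtain \<mu> z where z: "0 < \<mu>" "\<mu> \<le> \<rho>" "\<And>k. k \<in> unknowns \<Longrightarrow> norm (z k) \<le> \<rho>"
      "\<And>k. k \<in> unknowns \<Longrightarrow> z k = system k \<mu> z"
    by (rule contraction_system[of unknowns system \<rho>])
      (use \<rho> tiny_system in \<open>auto simp: unknowns_def\<close>)
  show thesis
  proof (rule that[OF z(1)])
    show "solution \<mu> z" using z by (simp add: solution_def)
    show "norm (dmet \<mu> z i j) \<le> \<eta>" if "i < n" "j < n" for i j
      using lip_estD(1)[OF \<rho>(2)[OF that] z(1,2), of 0 z z] z by simp
  qed
qed

context
  fixes \<mu> z
  assumes sol: "solution \<mu> z" and \<mu>: "\<mu> > 0"
begin

lemma met_sym: "met \<mu> z i j = met \<mu> z j i"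
proof -
  have "dmet \<mu> z i j = dmet \<mu> z j i"
    by (simp add: dmet_def quad_sym(2)[of _ _ i j] shape_sym[of i j])
  then show ?thesis by (simp add: met_def diag_def)
qed

text \<open>The equation for \<open>Some (i, j)\<close>, multiplied by \<open>eps i\<close>, says
  that the contribution of \<open>dmet\<close> cancels that of the deviation in
  \<open>diag * inv_met\<close>; what is left is \<open>diag * diag\<close>, the identity.\<close>

lemma met_inverse:
  assumes x: "x \<in> cube n" and ij: "i < n" "j < n"
  shows "(\<Sum>k<n. eval (met \<mu> z i k) x * eval (inv_met \<mu> z k j) x) = (if i = j then 1 else 0)"
proof -
  have "z (Some (i, j)) = (- eps i) *\<^sub>R (\<Sum>k<n. conv (dmet \<mu> z i k) (inv_met \<mu> z k j))"
    using sol ij by (auto simp: solution_def unknowns_def system_def)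
  then have "eval (z (Some (i, j))) x =
      - eps i * (\<Sum>k<n. eval (dmet \<mu> z i k) x * eval (inv_met \<mu> z k j) x)"
    by (simp only: eval_linear[OF x] eval_sum[OF x] eval_conv[OF x])
  then have *: "eps i * eval (z (Some (i, j))) x =
      - (\<Sum>k<n. eval (dmet \<mu> z i k) x * eval (inv_met \<mu> z k j) x)"
    by simp
  have "(\<Sum>k<n. eval (met \<mu> z i k) x * eval (inv_met \<mu> z k j) x) =
      (\<Sum>k<n. diag i k * eval (inv_met \<mu> z k j) x) +
      (\<Sum>k<n. eval (dmet \<mu> z i k) x * eval (inv_met \<mu> z k j) x)"
    by (simp add: met_def eval_linear[OF x] eval_const[OF x] distrib_right sum.distrib)
  also have "(\<Sum>k<n. diag i k * eval (inv_met \<mu> z k j) x) =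
      (\<Sum>k<n. if i = k then eps i * eval (inv_met \<mu> z i j) x else 0)"
    by (rule sum.cong) (auto simp: diag_def)
  also have "\<dots> = eps i * eval (inv_met \<mu> z i j) x" using ij by simp
  also have "\<dots> = eps i * diag i j + eps i * eval (z (Some (i, j))) x"
    by (simp add: inv_met_def inv_dev_def eval_linear[OF x] eval_const[OF x] distrib_left)
  finally show ?thesis using * by (simp add: diag_def)
qed

text \<open>The quadratic part is differentiated as an explicit polynomial, where the symmetry of
  \<open>quad\<close> cancels the factor 1/2; the deformation is an integral of a series and falls
  to \<open>is_partial_integrate\<close>.\<close>

lemma has_partial_met:
  assumes x: "x \<in> cube n" and k: "k < n"
  shows "((\<lambda>t. eval (met \<mu> z i j) (x(k := t))) has_real_derivative \<mu> * eval (dmet1 \<mu> z k i j) x) (at (x k))"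
    and "((\<lambda>t. eval (dmet1 \<mu> z l i j) (x(k := t))) has_real_derivative eval (dmet2 \<mu> z k l i j) x) (at (x k))"
proof -
  note int = eval_has_partial[OF x k is_partial_integrate]
  let ?I = "integrate (integrate (z None))"
  let ?Q = "\<lambda>x::nat\<Rightarrow>real. \<Sum>p<n. \<Sum>l<n. quad p l i j * (x p * x l)"
  have coord: "((\<lambda>t. (x(k := t)) p) has_real_derivative (if p = k then 1 else 0)) (at (x k))" for p
    by (cases "p = k") auto
  have I: "((\<lambda>t. eval ?I (x(k := t))) has_real_derivative eval (slope k (integrate (z None))) x) (at (x k))"
    by (rule int)
  have Q: "((\<lambda>t. ?Q (x(k := t))) has_real_derivative
      (\<Sum>p<n. \<Sum>l<n. quad p l i j * ((if p = k then 1 else 0) * x l + (if l = k then 1 else 0) * x p))) (at (x k))"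
    using DERIV_mult[OF coord coord] by (intro DERIV_sum DERIV_cmult) simp
  have "(\<Sum>p<n. \<Sum>l<n. quad p l i j * ((if p = k then 1 else 0) * x l + (if l = k then 1 else 0) * x p)) =
      (\<Sum>p<n. \<Sum>l<n. if p = k then quad k l i j * x l else 0) +
      (\<Sum>p<n. \<Sum>l<n. if l = k then quad p k i j * x p else 0)"
    unfolding sum.distrib[symmetric] by (intro sum.cong refl) (auto simp: distrib_left)
  also have "(\<Sum>p<n. \<Sum>l<n. if p = k then quad k l i j * x l else 0) = (\<Sum>l<n. quad k l i j * x l)"
    using k by (subst sum.swap) simp
  also have "(\<Sum>p<n. \<Sum>l<n. if l = k then quad p k i j * x p else 0) = (\<Sum>l<n. quad k l i j * x l)"
    using k by (simp add: quad_sym(1)[of _ k])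
  finally have Q': "((\<lambda>t. ?Q (x(k := t))) has_real_derivative 2 * (\<Sum>l<n. quad k l i j * x l)) (at (x k))"
    using Q by simp
  have ev: "eval (met \<mu> z i j) y = diag i j + \<mu> * (\<mu> * (1/2 * ?Q y) + shape i j * eval ?I y)"
    if y: "y \<in> cube n" for y
    by (simp only: met_def dmet_def eval_linear[OF y] eval_const[OF y] eval_sum[OF y]
        eval_conv[OF y] eval_var[OF y])
  have "((\<lambda>t. diag i j + \<mu> * (\<mu> * (1/2 * ?Q (x(k := t))) + shape i j * eval ?I (x(k := t))))
      has_real_derivative \<mu> * (\<mu> * (1/2 * (2 * (\<Sum>l<n. quad k l i j * x l))) +
        shape i j * eval (slope k (integrate (z None))) x)) (at (x k))"
    using DERIV_add[OF DERIV_const[of "diag i j"]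
        DERIV_cmult[OF DERIV_add[OF DERIV_cmult[OF DERIV_cmult[OF Q', of "1/2"], of \<mu>]
            DERIV_cmult[OF I, of "shape i j"]], of \<mu>]] by simp
  also have "\<mu> * (\<mu> * (1/2 * (2 * (\<Sum>l<n. quad k l i j * x l))) +
      shape i j * eval (slope k (integrate (z None))) x) = \<mu> * eval (dmet1 \<mu> z k i j) x"
    by (simp add: dmet1_def eval_linear[OF x] eval_sum[OF x] eval_var[OF x])
  finally show "((\<lambda>t. eval (met \<mu> z i j) (x(k := t))) has_real_derivative \<mu> * eval (dmet1 \<mu> z k i j) x) (at (x k))"
    by (rule cube_has_derivative_cong[OF x k, rotated]) (rule ev[symmetric])
  have ev1: "eval (dmet1 \<mu> z l i j) y =
      \<mu> * (\<Sum>p<n. quad l p i j * y p) + shape i j * eval (integrate (slope l (z None))) y"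
    if y: "y \<in> cube n" for y
    by (simp only: dmet1_def eval_linear[OF y] eval_sum[OF y] eval_var[OF y] slope_integrate)
  have "((\<lambda>t. \<Sum>p<n. quad l p i j * (x(k := t)) p) has_real_derivative
      (\<Sum>p<n. quad l p i j * (if p = k then 1 else 0))) (at (x k))"
    by (intro DERIV_sum DERIV_cmult coord)
  also have "(\<Sum>p<n. quad l p i j * (if p = k then 1 else 0)) = quad k l i j"
    using k quad_sym(1)[of l k] by (simp add: if_distrib cong: if_cong)
  finally have "((\<lambda>t. \<mu> * (\<Sum>p<n. quad l p i j * (x(k := t)) p) +
      shape i j * eval (integrate (slope l (z None))) (x(k := t))) has_real_derivative
      \<mu> * quad k l i j + shape i j * eval (slope k (slope l (z None))) x) (at (x k))"
    by (intro DERIV_add DERIV_cmult int)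
  also have "\<mu> * quad k l i j + shape i j * eval (slope k (slope l (z None))) x = eval (dmet2 \<mu> z k l i j) x"
    by (simp only: dmet2_def eval_linear[OF x] eval_const[OF x])
  finally show "((\<lambda>t. eval (dmet1 \<mu> z l i j) (x(k := t))) has_real_derivative eval (dmet2 \<mu> z k l i j) x) (at (x k))"
    by (rule cube_has_derivative_cong[OF x k, rotated]) (rule ev1[symmetric])
qed



end


section \<open>Curvature of a solution\<close>

lemma sum_diag: "i < n \<Longrightarrow> (\<Sum>l<n. diag i l * f l) = eps i * f i"
proof -
  assume "i < n"
  have "(\<Sum>l<n. diag i l * f l) = (\<Sum>l<n. if i = l then eps i * f i else 0)"
    by (rule sum.cong) (auto simp: diag_def)
  then show ?thesis using \<open>i < n\<close> by simp
qed

lemma zero_in_cube: "(\<lambda>_. 0) \<in> cube n"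
  by (simp add: cube_def)

text \<open>The scalar curvature of the model in an orthonormal basis, where the inverse of
  \<open>diag\<close> is \<open>diag\<close> itself. It is the only possible constant, since the
  curvature at the origin is prescribed.\<close>

definition scal :: real where
  "scal = (\<Sum>i<n. \<Sum>j<n. eps i * eps j * a i j j i)"

lemma eval_curv_lin:
  assumes x: "x \<in> cube n"
  shows "eval (curv_lin \<mu> z i j k l) x = \<mu> * a i j k l +
    (shape j l * eval (slope i (slope k (z None))) x - shape i l * eval (slope j (slope k (z None))) x -
     shape j k * eval (slope i (slope l (z None))) x + shape i k * eval (slope j (slope l (z None))) x) / 2"
proof -
  have "\<mu> * a i j k l = (\<mu> * quad i k j l - \<mu> * quad j k i l - \<mu> * quad i l j k + \<mu> * quad j l i k) / 2"
    by (simp add: quad_curvature[symmetric] algebra_simps)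
  then show ?thesis
    by (simp add: curv_lin_def dmet2_def eval_linear[OF x] eval_const[OF x])
qed

lemma sum_diag_curv_lin:
  assumes x: "x \<in> cube n" and n: "n > 0"
  shows "(\<Sum>i<n. \<Sum>j<n. \<Sum>k<n. \<Sum>l<n. diag i l * diag j k * eval (curv_lin \<mu> z i j k l) x) =
    \<mu> * scal + (1 - real n) * eps 0 * eval (z None) x"
proof -
  let ?W = "\<lambda>i j. eval (slope i (slope j (z None))) x"
  have "(\<Sum>i<n. \<Sum>j<n. \<Sum>k<n. \<Sum>l<n. diag i l * diag j k * eval (curv_lin \<mu> z i j k l) x) =
      (\<Sum>i<n. \<Sum>j<n. \<Sum>k<n. diag j k * (\<Sum>l<n. diag i l * eval (curv_lin \<mu> z i j k l) x))"
    by (simp add: sum_distrib_left mult_ac)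
  also have "\<dots> = (\<Sum>i<n. \<Sum>j<n. eps i * eps j * eval (curv_lin \<mu> z i j j i) x)"
  proof (intro sum.cong refl)
    fix i j assume "i \<in> {..<n}" "j \<in> {..<n}"
    then show "(\<Sum>k<n. diag j k * (\<Sum>l<n. diag i l * eval (curv_lin \<mu> z i j k l) x)) =
        eps i * eps j * eval (curv_lin \<mu> z i j j i) x"
      using sum_diag[of j "\<lambda>k. eps i * eval (curv_lin \<mu> z i j k i) x"] by (simp add: sum_diag)
  qed
  also have "\<dots> = (\<Sum>i<n. \<Sum>j<n. \<mu> * (eps i * eps j * a i j j i) + 1/2 * (eps i * eps j *
      (shape j i * ?W i j - shape i i * ?W j j - shape j j * ?W i i + shape i j * ?W j i)))"
    by (intro sum.cong refl) (simp only: eval_curv_lin[OF x], simp add: field_simps)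
  also have "\<dots> = \<mu> * scal + 1/2 * (\<Sum>i<n. \<Sum>j<n. eps i * eps j *
      (shape j i * ?W i j - shape i i * ?W j j - shape j j * ?W i i + shape i j * ?W j i))"
    by (simp only: sum.distrib sum_distrib_left scal_def)
  also have "\<dots> = \<mu> * scal + (1 - real n) * eps 0 * eval (z None) x"
    using n by (simp add: linearised_scalar_curvature[of ?W])
  finally show ?thesis .
qed

context
  fixes \<mu> z
  assumes sol: "solution \<mu> z" and \<mu>: "\<mu> > 0"
begin

lemma scalar_curvature_equation:
  assumes x: "x \<in> cube n"
  shows "(\<Sum>i<n. \<Sum>j<n. \<Sum>k<n. \<Sum>l<n. eval (inv_met \<mu> z i l) x * eval (inv_met \<mu> z j k) x *
    (eval (curv_lin \<mu> z i j k l) x - \<mu> * eval (curv_quad \<mu> z i j k l) x)) = \<mu> * scal"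
proof (cases "n \<ge> 2")
  case True
  let ?h = "\<lambda>i j. eval (inv_met \<mu> z i j) x"
  let ?B = "\<lambda>i j k l. eval (curv_lin \<mu> z i j k l) x"
  let ?C = "\<lambda>i j k l. eval (curv_quad \<mu> z i j k l) x"
  let ?S = "\<lambda>f. \<Sum>i<n. \<Sum>j<n. \<Sum>k<n. \<Sum>l<n. f i j k l"
  have "z None = (- 1 / ((1 - real n) * eps 0)) *\<^sub>R scal_rest \<mu> z"
    using sol by (simp add: solution_def unknowns_def system_def)
  then have "eval (z None) x = (- 1 / ((1 - real n) * eps 0)) * eval (scal_rest \<mu> z) x"
    by (metis eval_linear(2)[OF x])
  then have w: "eval (scal_rest \<mu> z) x = - ((1 - real n) * eps 0 * eval (z None) x)"
    using True eps[of 0] by (auto simp: field_simps)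
  have "eval (scal_rest \<mu> z) x = ?S (\<lambda>i j k l. eval (inv_sq_dev \<mu> z i l j k) x * ?B i j k l) -
      \<mu> * ?S (\<lambda>i j k l. ?h i l * ?h j k * ?C i j k l)"
    by (simp only: scal_rest_def eval_linear[OF x] eval_sum[OF x] eval_conv[OF x])
  moreover
  have hh: "?h i l * ?h j k = diag i l * diag j k + eval (inv_sq_dev \<mu> z i l j k) x" for i j k l
    by (simp add: inv_sq_dev_def inv_met_def eval_linear[OF x] eval_conv[OF x] eval_const[OF x] algebra_simps)
  have "?h i l * ?h j k * (?B i j k l - \<mu> * ?C i j k l) =
      diag i l * diag j k * ?B i j k l + eval (inv_sq_dev \<mu> z i l j k) x * ?B i j k l -
      \<mu> * (?h i l * ?h j k * ?C i j k l)" for i j k l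
    unfolding distrib_right[symmetric] hh[symmetric] by (simp add: algebra_simps)
  then have "?S (\<lambda>i j k l. ?h i l * ?h j k * (?B i j k l - \<mu> * ?C i j k l)) =
      ?S (\<lambda>i j k l. diag i l * diag j k * ?B i j k l) +
      ?S (\<lambda>i j k l. eval (inv_sq_dev \<mu> z i l j k) x * ?B i j k l) -
      \<mu> * ?S (\<lambda>i j k l. ?h i l * ?h j k * ?C i j k l)"
    by (simp only: sum_subtractf sum.distrib sum_distrib_left)
  ultimately show ?thesis
    using w True sum_diag_curv_lin[OF x, of \<mu> z] by simp
next
  case False
  \<comment> \<open>The equation for \<open>w\<close> is not usable for \<open>n = 1\<close>; there
    the only component of the curvature vanishes by skew symmetry, and for \<open>n = 0\<close> the
    sums are empty.\<close>
  have "a 0 0 0 0 = 0" using a_skew[of 0 0 0 0] by simp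
  then have B: "eval (curv_lin \<mu> z 0 0 0 0) x = 0" by (simp add: eval_curv_lin[OF x])
  have C: "eval (curv_quad \<mu> z 0 0 0 0) x = 0"
    by (simp add: curv_quad_def eval_sum[OF x] eval_conv[OF x] eval_linear[OF x] mult_ac)
  have "n = 0 \<or> n = 1" using False by auto
  then show ?thesis using B C \<open>a 0 0 0 0 = 0\<close> by (auto simp: scal_def)
qed

lemma at_origin:
  shows "eval (met \<mu> z i j) (\<lambda>_. 0) = diag i j"
    and "eval (dmet1 \<mu> z k i j) (\<lambda>_. 0) = 0"
    and "eval (curv_quad \<mu> z i j k l) (\<lambda>_. 0) = 0"
proof -
  note 0 = zero_in_cube
  show m: "eval (met \<mu> z i j) (\<lambda>_. 0) = diag i j" for i j
    by (simp add: met_def dmet_def eval_linear[OF 0] eval_sum[OF 0] eval_conv[OF 0] eval_var[OF 0]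
        eval_const[OF 0] eval_at_0[of "integrate _"] coeff_0_integrate)
  show d: "eval (dmet1 \<mu> z k i j) (\<lambda>_. 0) = 0" for k i j
    by (simp add: dmet1_def eval_linear[OF 0] eval_sum[OF 0] eval_var[OF 0]
        eval_at_0[of "slope _ (integrate _)"] coeff_0_integrate)
  then show "eval (curv_quad \<mu> z i j k l) (\<lambda>_. 0) = 0"
    by (simp add: curv_quad_def chris_def eval_linear[OF 0] eval_sum[OF 0] eval_conv[OF 0])
qed

text \<open>At the origin the inverse metric is \<open>diag\<close> and the first derivatives
  vanish, so the scalar curvature equation reduces to its \<open>diag\<close> contraction and leaves
  \<open>(1 - n) * eps 0 * w = 0\<close>. With \<open>w\<close> all its slopes vanish there, and
  only the quadratic term contributes.\<close>

lemma curv_lin_at_origin: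
  assumes ijkl: "i < n" "j < n" "k < n" "l < n"
  shows "eval (curv_lin \<mu> z i j k l) (\<lambda>_. 0) = \<mu> * a i j k l"
proof (cases "n \<ge> 2")
  case True
  note 0 = zero_in_cube
  have h: "eval (inv_met \<mu> z i j) (\<lambda>_. 0) = diag i j" if "i < n" "j < n" for i j
  proof -
    have "eps i * eval (inv_met \<mu> z i j) (\<lambda>_. 0) = (if i = j then 1 else 0)"
      using met_inverse[OF sol \<mu> 0 that] that by (simp add: at_origin sum_diag)
    then have "eps i * (eps i * eval (inv_met \<mu> z i j) (\<lambda>_. 0)) = eps i * (if i = j then 1 else 0)"
      by simp
    then show ?thesis by (simp add: diag_def)
  qed
  have "(\<Sum>i<n. \<Sum>j<n. \<Sum>k<n. \<Sum>l<n. diag i l * diag j k * eval (curv_lin \<mu> z i j k l) (\<lambda>_. 0)) =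
      \<mu> * scal"
    unfolding scalar_curvature_equation[OF 0, symmetric]
    by (intro sum.cong refl) (simp add: h at_origin)
  then have "(1 - real n) * eps 0 * eval (z None) (\<lambda>_. 0) = 0"
    using sum_diag_curv_lin[OF 0, of \<mu> z] True by simp
  then have w: "coeff (z None) {#} = 0"
    using True eps[of 0] by (auto simp: eval_at_0)
  then have "eval (slope p (slope q (z None))) (\<lambda>_. 0) = 0" for p q
    by (simp add: eval_at_0 coeff_0_integrate)
  then show ?thesis by (simp add: eval_curv_lin[OF 0])
next
  case False
  then have "i = 0" "j = 0" "k = 0" "l = 0" using ijkl by auto
  then show ?thesis by (simp add: eval_curv_lin[OF zero_in_cube])
qed

end

end

section \<open>Coordinate expressions on a single chart\<close>

lemma linear_on_sum:
  assumes "linear_on V f" "subspace V" "\<And>i. i \<in> S \<Longrightarrow> v i \<in> V"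
  shows "f (\<Sum>i\<in>S. r i *\<^sub>R v i) = (\<Sum>i\<in>S. r i *\<^sub>R f (v i))"
proof -
  have f0: "f 0 = 0"
    using assms(1) subspace_0[OF assms(2)] unfolding linear_on_def
    by (metis scaleR_zero_left)
  show ?thesis
    using assms(3)
  proof (induction S rule: infinite_finite_induct)
    case (insert i S)
    then have "f (r i *\<^sub>R v i + (\<Sum>i\<in>S. r i *\<^sub>R v i)) = f (r i *\<^sub>R v i) + f (\<Sum>i\<in>S. r i *\<^sub>R v i)"
    proof -
      have "r i *\<^sub>R v i \<in> V" "(\<Sum>i\<in>S. r i *\<^sub>R v i) \<in> V"
        using insert.prems by (auto intro!: subspace_scale[OF assms(2)] subspace_sum[OF assms(2)])
      then show ?thesis using assms(1) unfolding linear_on_def by blast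
    qed
    moreover have "f (r i *\<^sub>R v i) = r i *\<^sub>R f (v i)"
      using assms(1) insert.prems by (auto simp: linear_on_def)
    ultimately show ?case using insert by simp
  qed (simp_all add: f0)
qed

lemma linear_on_sum_fun:
  assumes "\<And>i. i \<in> S \<Longrightarrow> linear_on V (f i)"
  shows "linear_on V (\<lambda>x. \<Sum>i\<in>S. f i x)"
  using assms unfolding linear_on_def by (simp add: sum.distrib scaleR_sum_right)

lemma linear_on_cmult: "linear_on V f \<Longrightarrow> linear_on V (\<lambda>x. c * f x :: real)"
  by (simp add: linear_on_def distrib_left)

text \<open>For symmetric \<open>G\<close> the transpose of a right inverse is a left inverse, so
  the transpose of \<open>H\<close> times \<open>G\<close> times \<open>H'\<close> evaluates in two
  ways. Taking \<open>H' = H\<close> gives symmetry, and then two right inverses coincide.\<close>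

lemma right_inverse_symmetric:
  fixes G H :: "'i \<Rightarrow> 'i \<Rightarrow> real"
  assumes I: "finite I" and sym: "\<And>i j. i \<in> I \<Longrightarrow> j \<in> I \<Longrightarrow> G i j = G j i"
    and inv: "\<And>i j. i \<in> I \<Longrightarrow> j \<in> I \<Longrightarrow> (\<Sum>k\<in>I. G i k * H k j) = (if i = j then 1 else 0)"
    and inv': "\<And>i j. i \<in> I \<Longrightarrow> j \<in> I \<Longrightarrow> (\<Sum>k\<in>I. G i k * H' k j) = (if i = j then 1 else 0)"
    and ij: "i \<in> I" "j \<in> I"
  shows "H' i j = H j i"
proof -
  have "H' i j = (\<Sum>l\<in>I. (if l = i then 1 else 0) * H' l j)"
    using I ij by (simp add: if_distrib[of "\<lambda>x. x * _"] sum.delta cong: if_cong)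
  also have "\<dots> = (\<Sum>l\<in>I. \<Sum>k\<in>I. G l k * H k i * H' l j)"
    using inv ij by (auto simp: sum_distrib_right[symmetric] intro!: sum.cong)
  also have "\<dots> = (\<Sum>k\<in>I. (\<Sum>l\<in>I. G k l * H' l j) * H k i)"
    by (subst sum.swap, unfold sum_distrib_right, intro sum.cong refl) (simp add: sym mult_ac)
  also have "\<dots> = (\<Sum>k\<in>I. if k = j then H k i else 0)"
    using inv' ij by (intro sum.cong) auto
  also have "\<dots> = H j i" using I ij by simp
  finally show ?thesis .
qed

lemma inverse_matrix_on_eq:
  assumes I: "finite I" and sym: "\<And>i j. i \<in> I \<Longrightarrow> j \<in> I \<Longrightarrow> G i j = G j i"
    and inv: "\<And>i j. i \<in> I \<Longrightarrow> j \<in> I \<Longrightarrow> (\<Sum>k\<in>I. G i k * H k j) = (if i = j then 1 else 0)"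
  shows "inverse_matrix_on I G = (\<lambda>i j. if i \<in> I \<and> j \<in> I then H i j else 0)"
  unfolding inverse_matrix_on_def
proof (rule the_equality)
  fix H' assume H': "(\<forall>i j. i \<notin> I \<or> j \<notin> I \<longrightarrow> H' i j = 0) \<and>
    (\<forall>i\<in>I. \<forall>j\<in>I. (\<Sum>k\<in>I. G i k * H' k j) = (if i = j then 1 else 0))"
  show "H' = (\<lambda>i j. if i \<in> I \<and> j \<in> I then H i j else 0)"
  proof (intro ext)
    fix i j
    have "H' i j = H i j" if "i \<in> I" "j \<in> I"
      using right_inverse_symmetric[OF I sym inv _ that, of H'] right_inverse_symmetric[OF I sym inv inv that(2,1)]
        H' by simp
    then show "H' i j = (if i \<in> I \<and> j \<in> I then H i j else 0)" using H' by auto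
  qed
qed (use inv in auto)

lemma sum_inner_last_first:
  "(\<Sum>j\<in>J. \<Sum>k\<in>K. \<Sum>l\<in>L. f j k l) = (\<Sum>l\<in>L. \<Sum>j\<in>J. \<Sum>k\<in>K. f j k l :: real)"
proof -
  have "(\<Sum>j\<in>J. \<Sum>k\<in>K. \<Sum>l\<in>L. f j k l) = (\<Sum>j\<in>J. \<Sum>l\<in>L. \<Sum>k\<in>K. f j k l)"
    by (rule sum.cong[OF refl], rule sum.swap)
  also have "\<dots> = (\<Sum>l\<in>L. \<Sum>j\<in>J. \<Sum>k\<in>K. f j k l)" by (rule sum.swap)
  finally show ?thesis .
qed

lemma sum_contract_pairs:
  "(\<Sum>i\<in>I. \<Sum>j\<in>I. \<Sum>k\<in>I. \<Sum>l\<in>I. F i l * G j k * f i j k l) =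
   (\<Sum>i\<in>I. \<Sum>l\<in>I. F i l * (\<Sum>j\<in>I. \<Sum>k\<in>I. G j k * f i j k l) :: real)"
  by (rule sum.cong[OF refl], subst sum_inner_last_first) (simp only: sum_distrib_left mult.assoc)

text \<open>Replaces the basis picked by \<open>SOME\<close> in \<open>scalar_curvature\<close> by a
  convenient spanning family. Both contractions are invariant because the inverse matrix transforms
  as a contravariant tensor.\<close>

lemma scalar_curvature_basis:
  fixes e :: "nat \<Rightarrow> 'v::real_vector"
  assumes V: "subspace V"
    and e: "\<And>v. v \<in> V \<Longrightarrow> \<exists>r. v = (\<Sum>i<n. r i *\<^sub>R e i)" "\<And>i. i < n \<Longrightarrow> e i \<in> V"
    and b: "nondegenerate_symmetric_form V b" and A: "\<And>x y z. x \<in> V \<Longrightarrow> y \<in> V \<Longrightarrow> z \<in> V \<Longrightarrow>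
        linear_on V (\<lambda>v. A v x y z) \<and> linear_on V (\<lambda>v. A x v y z) \<and>
        linear_on V (\<lambda>v. A x y v z) \<and> linear_on V (\<lambda>v. A x y z v)"
    and inv: "\<And>i j. i < n \<Longrightarrow> j < n \<Longrightarrow> (\<Sum>k<n. b (e i) (e k) * H k j) = (if i = j then 1 else 0)"
  shows "scalar_curvature (V, b, A) =
    (\<Sum>i<n. \<Sum>j<n. \<Sum>k<n. \<Sum>l<n. H i l * H j k * A (e i) (e j) (e k) (e l))"
proof -
  have bl: "\<And>y. y \<in> V \<Longrightarrow> linear_on V (\<lambda>x. b x y)" "\<And>x. x \<in> V \<Longrightarrow> linear_on V (b x)"
    "\<And>x y. x \<in> V \<Longrightarrow> y \<in> V \<Longrightarrow> b x y = b y x"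
    using b by (auto simp: nondegenerate_symmetric_form_def)
  define B where "B = (SOME B. independent B \<and> span B = V)"
  have "\<exists>B. independent B \<and> span B = V"
    using maximal_independent_subset[of V] V by (metis span_subspace)
  then have "independent B \<and> span B = V" unfolding B_def by (rule someI_ex)
  then have B: "independent B" "span B = V" by blast+
  then have BV: "\<And>u. u \<in> B \<Longrightarrow> u \<in> V" using span_superset by blast
  have finB: "finite B"
  proof -
    have "(\<Sum>i<n. r i *\<^sub>R e i) \<in> span (e ` {..<n})" for r
      by (intro span_sum span_scale span_base) simp
    then have "B \<subseteq> span (e ` {..<n})" using e(1) BV by fastforce
    then show ?thesis using independent_span_bound[OF _ B(1), of "e ` {..<n}"] by simp
  qed
  define \<xi> where "\<xi> = representation B"
  have rep: "(\<Sum>u\<in>B. \<xi> v u *\<^sub>R u) = v" if "v \<in> V" for v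
    unfolding \<xi>_def using that B finB by (intro sum_representation_eq) auto
  have \<xi>B: "\<xi> v u = (if u = v then 1 else 0)" if "v \<in> B" for u v
    unfolding \<xi>_def using representation_basis[OF B(1) that] by simp
  have \<xi>sum: "\<xi> (\<Sum>i\<in>S. r i *\<^sub>R v i) u = (\<Sum>i\<in>S. r i * \<xi> (v i) u)"
    if "\<And>i. i \<in> S \<Longrightarrow> v i \<in> V" for S r u and v :: "nat \<Rightarrow> 'v"
    unfolding \<xi>_def using that B by (subst representation_sum) (auto simp: representation_scale intro!: span_scale)
  \<comment> \<open>The contravariant tensor with components \<open>H\<close> along
    \<open>e\<close>, rewritten in the basis \<open>B\<close>.\<close>
  define K where "K u v = (\<Sum>i<n. \<Sum>j<n. H i j * \<xi> (e i) u * \<xi> (e j) v)" for u v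
  have K: "(\<Sum>v\<in>B. b u v * K v w) = (if u = w then 1 else 0)" if uw: "u \<in> B" "w \<in> B" for u w
  proof -
    obtain r where r: "u = (\<Sum>i<n. r i *\<^sub>R e i)" using e(1) BV uw by blast
    have "(\<Sum>v\<in>B. b u v * K v w) = (\<Sum>i<n. \<Sum>j<n. (\<Sum>v\<in>B. \<xi> (e i) v * b u v) * H i j * \<xi> (e j) w)"
      unfolding K_def sum_distrib_left sum_distrib_right
      by (subst sum.swap, rule sum.cong[OF refl], subst sum.swap) (simp add: mult_ac)
    also have "\<dots> = (\<Sum>i<n. \<Sum>j<n. b u (e i) * H i j * \<xi> (e j) w)"
    proof (intro sum.cong refl)
      fix i j assume "i \<in> {..<n}"
      then have "b u (e i) = b u (\<Sum>v\<in>B. \<xi> (e i) v *\<^sub>R v)" using rep e by simp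
      also have "\<dots> = (\<Sum>v\<in>B. \<xi> (e i) v * b u v)"
        using linear_on_sum[OF bl(2) V, of u B "\<lambda>v. v" "\<xi> (e i)"] BV uw by simp
      finally show "(\<Sum>v\<in>B. \<xi> (e i) v * b u v) * H i j * \<xi> (e j) w = b u (e i) * H i j * \<xi> (e j) w"
        by simp
    qed
    also have "\<dots> = (\<Sum>j<n. \<Sum>i<n. \<Sum>k<n. r k * (b (e k) (e i) * H i j) * \<xi> (e j) w)"
    proof (subst sum.swap, intro sum.cong refl)
      fix i j assume "i \<in> {..<n}"
      then have "b u (e i) = (\<Sum>k<n. r k * b (e k) (e i))"
        unfolding r using linear_on_sum[OF bl(1) V, of "e i" "{..<n}" e r] e by simp
      then show "b u (e i) * H i j * \<xi> (e j) w = (\<Sum>k<n. r k * (b (e k) (e i) * H i j) * \<xi> (e j) w)"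
        by (simp add: sum_distrib_left mult_ac)
    qed
    also have "\<dots> = (\<Sum>j<n. \<Sum>k<n. r k * (\<Sum>i<n. b (e k) (e i) * H i j) * \<xi> (e j) w)"
      by (rule sum.cong[OF refl], subst sum.swap) (simp add: sum_distrib_left sum_distrib_right)
    also have "\<dots> = (\<Sum>j<n. \<Sum>k<n. if k = j then r j * \<xi> (e j) w else 0)"
      using inv by (intro sum.cong refl) auto
    also have "\<dots> = (\<Sum>j<n. r j * \<xi> (e j) w)" by simp
    also have "\<dots> = \<xi> u w" unfolding r using \<xi>sum[of "{..<n}" e r w] e by simp
    finally show ?thesis using \<xi>B uw by simp
  qed
  have inverse: "inverse_matrix_on B b = (\<lambda>u v. if u \<in> B \<and> v \<in> B then K u v else 0)"
    by (rule inverse_matrix_on_eq[OF finB _ K]) (use bl(3) BV in auto)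
  \<comment> \<open>Invariance of one contraction, for any bilinear \<open>\<beta>\<close>; it is
    applied to the two middle slots of \<open>A\<close> and then to the two outer ones.\<close>
  have contract: "(\<Sum>u\<in>B. \<Sum>v\<in>B. K u v * \<beta> u v) = (\<Sum>i<n. \<Sum>j<n. H i j * \<beta> (e i) (e j))"
    if "\<And>x. x \<in> V \<Longrightarrow> linear_on V (\<beta> x)" "\<And>y. y \<in> V \<Longrightarrow> linear_on V (\<lambda>x. \<beta> x y)"
    for \<beta> :: "'v \<Rightarrow> 'v \<Rightarrow> real"
  proof -
    have "\<beta> (e i) (e j) = (\<Sum>u\<in>B. \<Sum>v\<in>B. \<xi> (e i) u * \<xi> (e j) v * \<beta> u v)" if "i < n" "j < n" for i j
    proof -
      have "\<beta> (e i) (e j) = (\<Sum>u\<in>B. \<xi> (e i) u * \<beta> u (e j))"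
        using linear_on_sum[OF \<open>\<And>y. y \<in> V \<Longrightarrow> linear_on V (\<lambda>x. \<beta> x y)\<close> V, of "e j" B "\<lambda>u. u" "\<xi> (e i)"]
          e(2) that rep BV by simp
      also have "\<dots> = (\<Sum>u\<in>B. \<xi> (e i) u * (\<Sum>v\<in>B. \<xi> (e j) v * \<beta> u v))"
        using linear_on_sum[OF \<open>\<And>x. x \<in> V \<Longrightarrow> linear_on V (\<beta> x)\<close> V, of _ B "\<lambda>u. u" "\<xi> (e j)"]
          e(2) that rep BV by (intro sum.cong refl) simp
      finally show ?thesis by (simp add: sum_distrib_left mult_ac)
    qed
    then have "(\<Sum>i<n. \<Sum>j<n. H i j * \<beta> (e i) (e j)) =
        (\<Sum>i<n. \<Sum>j<n. \<Sum>u\<in>B. \<Sum>v\<in>B. H i j * \<xi> (e i) u * \<xi> (e j) v * \<beta> u v)"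
      by (simp add: sum_distrib_left mult_ac)
    also have "\<dots> = (\<Sum>u\<in>B. \<Sum>i<n. \<Sum>j<n. \<Sum>v\<in>B. H i j * \<xi> (e i) u * \<xi> (e j) v * \<beta> u v)"
      by (subst sum.swap[of _ "{..<n}" B], rule sum.cong[OF refl]) (rule sum.swap)
    also have "\<dots> = (\<Sum>u\<in>B. \<Sum>v\<in>B. \<Sum>i<n. \<Sum>j<n. H i j * \<xi> (e i) u * \<xi> (e j) v * \<beta> u v)"
      by (subst sum.swap[of _ "{..<n}" B], subst sum.swap[of _ "{..<n}" B]) (rule refl)
    finally show ?thesis by (simp add: K_def sum_distrib_right)
  qed
  have "scalar_curvature (V, b, A) =
      (\<Sum>i\<in>B. \<Sum>j\<in>B. \<Sum>k\<in>B. \<Sum>l\<in>B. K i l * K j k * A i j k l)"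
    by (simp add: scalar_curvature_def B_def[symmetric] inverse cong: sum.cong)
  also have "\<dots> = (\<Sum>i\<in>B. \<Sum>l\<in>B. K i l * (\<Sum>j\<in>B. \<Sum>k\<in>B. K j k * A i j k l))"
    by (rule sum_contract_pairs)
  also have "\<dots> = (\<Sum>i\<in>B. \<Sum>l\<in>B. K i l * (\<Sum>j<n. \<Sum>k<n. H j k * A i (e j) (e k) l))"
    using A BV by (intro sum.cong refl, subst contract) auto
  also have "\<dots> = (\<Sum>i<n. \<Sum>l<n. H i l * (\<Sum>j<n. \<Sum>k<n. H j k * A (e i) (e j) (e k) (e l)))"
    using A e(2) by (intro contract linear_on_sum_fun linear_on_cmult) auto
  also have "\<dots> = (\<Sum>i<n. \<Sum>j<n. \<Sum>k<n. \<Sum>l<n. H i l * H j k * A (e i) (e j) (e k) (e l))"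
    by (rule sum_contract_pairs[symmetric])
  finally show ?thesis .
qed

section \<open>The cube as a manifold with one chart\<close>

lemma sum_fun_apply: "(\<Sum>i\<in>S. f i) x = (\<Sum>i\<in>S. f i x)"
  for f :: "'i \<Rightarrow> 'a \<Rightarrow> 'b::comm_monoid_add"
  by (induction S rule: infinite_finite_induct) (auto simp: plus_fun_def zero_fun_def)

definition cube_space :: "nat \<Rightarrow> (nat \<Rightarrow> real) topology" where
  "cube_space n = subtopology (Euclidean_space n) (cube n)"

definition cube_chart :: "nat \<Rightarrow> (nat \<Rightarrow> real) chart" where
  "cube_chart n = (cube n, \<lambda>x. x)"

lemma cube_subset: "cube n \<subseteq> topspace (Euclidean_space n)"
  by (auto simp: cube_def topspace_Euclidean_space)

lemma topspace_cube_space [simp]: "topspace (cube_space n) = cube n"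
  using cube_subset[of n] by (auto simp: cube_space_def)

lemma Euclidean_space_eq: "Euclidean_space n = subtopology euclidean {x. \<forall>i\<ge>n. x i = 0}"
  by (simp add: Euclidean_space_def euclidean_product_topology[symmetric])

lemma openin_cube: "openin (Euclidean_space n) (cube n)"
proof -
  let ?S = "\<Inter>i\<in>{..<n}. {x :: nat \<Rightarrow> real. \<bar>x i\<bar> < 1 / (real n + 1)}"
  have "open {x :: nat \<Rightarrow> real. \<bar>x i\<bar> < 1 / (real n + 1)}" for i
    by (intro open_Collect_less continuous_intros) (auto intro: continuous_on_product_coordinates)
  then have "open ?S" by (intro open_INT) auto
  then have "openin euclidean ?S" by (simp only: open_openin)
  moreover have "cube n = ?S \<inter> {x. \<forall>i\<ge>n. x i = 0}" by (auto simp: cube_def)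
  ultimately show ?thesis
    unfolding Euclidean_space_eq openin_subtopology by blast
qed

lemma inv_chart_cube: "x \<in> cube n \<Longrightarrow> inv_chart (cube_chart n) x = x"
  by (simp add: inv_chart_def cube_chart_def f_inv_into_f[of x "\<lambda>x. x"])

lemma real_analytic_on_cong:
  assumes "real_analytic_on n U f" "\<And>x. x \<in> U \<Longrightarrow> f x = g x"
  shows "real_analytic_on n U g"
proof -
  have "((\<lambda>\<alpha>. c \<alpha> * (\<Prod>i<n. (x i - a i) ^ \<alpha> i)) has_sum g x) {\<alpha>. \<forall>i\<ge>n. \<alpha> i = 0} \<longleftrightarrow>
      ((\<lambda>\<alpha>. c \<alpha> * (\<Prod>i<n. (x i - a i) ^ \<alpha> i)) has_sum f x) {\<alpha>. \<forall>i\<ge>n. \<alpha> i = 0}"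
    if "x \<in> U" for x a c
    using assms(2)[OF that] by simp
  then show ?thesis
    using assms(1) unfolding real_analytic_on_def by (simp cong: ball_cong)
qed

text \<open>The only coordinate change is the identity, whose components are the series
  \<open>var k\<close>.\<close>

lemma analytic_manifold_cube: "analytic_manifold (cube_space n) n {cube_chart n}"
  unfolding analytic_manifold_def
proof (intro conjI ballI allI impI)
  show "Hausdorff_space (cube_space n)"
    unfolding cube_space_def by (intro Hausdorff_space_subtopology Hausdorff_Euclidean_space)
  have "second_countable (euclidean :: (nat \<Rightarrow> real) topology)"
  proof -
    obtain B :: "(nat \<Rightarrow> real) set set" where B: "countable B" "\<And>C. C \<in> B \<Longrightarrow> open C"
      "\<And>S. open S \<Longrightarrow> \<exists>U. U \<subseteq> B \<and> S = \<Union>U"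
      using univ_second_countable by blast
    have "\<exists>C\<in>B. x \<in> C \<and> C \<subseteq> S" if "open S" "x \<in> S" for S x
      using B(3)[OF that(1)] that(2) by blast
    with B(1,2) show ?thesis unfolding second_countable_def by (intro exI[of _ B]) auto
  qed
  then show "second_countable (cube_space n)"
    unfolding cube_space_def Euclidean_space_eq by (intro second_countable_subtopology)
  have id: "homeomorphic_map (cube_space n) (cube_space n) (\<lambda>x. x)"
    using homeomorphic_map_id[of "cube_space n" "cube_space n"] by (simp add: id_def)
  show "is_chart (cube_space n) n c" if "c \<in> {cube_chart n}" for c
    using that openin_cube[of n] id openin_topspace[of "cube_space n", unfolded topspace_cube_space]
    by (auto simp: is_chart_def cube_chart_def cube_space_def subtopology_subtopology
        openin_subtopology_self image_ident intro: openin_subset_topspace_eq[THEN iffD2])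
  show "(\<Union>c\<in>{cube_chart n}. fst c) = topspace (cube_space n)" by (simp add: cube_chart_def)
  show "real_analytic_on n (snd c ` (fst c \<inter> fst d)) (\<lambda>x. snd d (inv_chart c x) k)"
    if "c \<in> {cube_chart n}" "d \<in> {cube_chart n}" for c d k
  proof -
    have "real_analytic_on n (cube n) (\<lambda>x. snd (cube_chart n) (inv_chart (cube_chart n) x) k)"
      by (rule real_analytic_on_cong[OF eval_real_analytic[of n "var k"]])
        (simp add: eval_var inv_chart_cube, simp add: cube_chart_def)
    then show ?thesis using that by (simp add: cube_chart_def)
  qed
qed

lemma charts_at_cube: "p \<in> cube n \<Longrightarrow> charts_at {cube_chart n} p = {cube_chart n}"
  by (auto simp: charts_at_def cube_chart_def)

lemma chart_partial_cube:
  assumes p: "p \<in> cube n" and i: "i < n"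
    and eq: "\<And>q. q \<in> cube n \<Longrightarrow> f q = F q"
    and F: "((\<lambda>t. F (p(i := t))) has_real_derivative D) (at (p i))"
  shows "chart_partial (cube_chart n) i f p = D"
proof -
  have "((\<lambda>t. f (inv_chart (cube_chart n) (p(i := t)))) has_real_derivative D) (at (p i))"
    by (rule cube_has_derivative_cong[OF p i _ F]) (simp add: eq inv_chart_cube)
  then show ?thesis
    by (simp add: chart_partial_def partial_deriv_def DERIV_imp_deriv cube_chart_def)
qed

lemma chart_partial_const:
  assumes "p \<in> cube n" "i < n" "\<And>q. q \<in> cube n \<Longrightarrow> f q = c"
  shows "chart_partial (cube_chart n) i f p = 0"
  by (rule chart_partial_cube[OF assms(1,2), of _ "\<lambda>_. c"]) (use assms(3) in auto)

lemma chart_partial_coord: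
  assumes "p \<in> cube n" "i < n"
  shows "chart_partial (cube_chart n) i (\<lambda>q. snd (cube_chart n) q k) p = (if k = i then 1 else 0)"
  by (rule chart_partial_cube[OF assms, of _ "\<lambda>x. x k"]) (auto simp: cube_chart_def)

text \<open>Only the first \<open>n\<close> entries of \<open>y\<close> matter, so different
  \<open>y\<close> may give the same vector.\<close>

definition chart_vec :: "nat \<Rightarrow> (nat \<Rightarrow> real) \<Rightarrow> (nat \<Rightarrow> real) tvec" where
  "chart_vec n y = (\<lambda>d k. if d = cube_chart n \<and> k < n then y k else 0)"

lemma chart_vec_apply [simp]: "chart_vec n y (cube_chart n) k = (if k < n then y k else 0)"
  by (simp add: chart_vec_def)

lemma chart_vec_linear:
  "chart_vec n x + chart_vec n y = chart_vec n (\<lambda>k. x k + y k)"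
  "r *\<^sub>R chart_vec n x = chart_vec n (\<lambda>k. r * x k)"
  "chart_vec n x - chart_vec n y = chart_vec n (\<lambda>k. x k - y k)"
  by (auto simp: chart_vec_def fun_eq_iff scaleR_fun_def plus_fun_def)

lemma chart_vec_eq_iff: "chart_vec n x = chart_vec n y \<longleftrightarrow> (\<forall>k<n. x k = y k)"
proof
  assume eq: "chart_vec n x = chart_vec n y"
  show "\<forall>k<n. x k = y k"
  proof (intro allI impI)
    show "x k = y k" if "k < n" for k
      using fun_cong[OF fun_cong[OF eq, of "cube_chart n"], of k] that by simp
  qed
qed (auto simp: chart_vec_def fun_eq_iff)

lemma tangent_space_cube:
  assumes p: "p \<in> cube n"
  shows "tangent_space n {cube_chart n} p = range (chart_vec n)"
proof -
  have sum: "v (cube_chart n) k = (\<Sum>i<n. chart_partial (cube_chart n) i (\<lambda>q. snd (cube_chart n) q k) p *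
      v (cube_chart n) i)" if "k < n" for v k
  proof -
    have "(\<Sum>i<n. chart_partial (cube_chart n) i (\<lambda>q. snd (cube_chart n) q k) p * v (cube_chart n) i) =
        (\<Sum>i<n. if k = i then v (cube_chart n) k else 0)"
      by (rule sum.cong) (auto simp: chart_partial_coord[OF p])
    then show ?thesis using that by simp
  qed
  have "tangent_space n {cube_chart n} p =
      {v. \<forall>c k. c \<noteq> cube_chart n \<or> n \<le> k \<longrightarrow> v c k = 0}"
    unfolding tangent_space_def charts_at_cube[OF p] using sum by auto
  also have "\<dots> = range (chart_vec n)"
  proof (intro equalityI subsetI)
    fix v assume "v \<in> {v. \<forall>c k. c \<noteq> cube_chart n \<or> n \<le> k \<longrightarrow> v c k = (0::real)}"
    then have "v = chart_vec n (v (cube_chart n))" by (auto simp: chart_vec_def fun_eq_iff)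
    then show "v \<in> range (chart_vec n)" by blast
  qed (auto simp: chart_vec_def)
  finally show ?thesis .
qed

lemma coord_field_cube:
  assumes "p \<in> cube n" "i < n"
  shows "coord_field n {cube_chart n} (cube_chart n) i p = chart_vec n (\<lambda>k. if k = i then 1 else 0)"
  using assms
  by (auto simp: coord_field_def chart_vec_def fun_eq_iff charts_at_cube chart_partial_coord)

lemma chart_vec_sum: "(\<Sum>i\<in>S. chart_vec n (f i)) = chart_vec n (\<lambda>k. \<Sum>i\<in>S. f i k)"
  by (auto simp: fun_eq_iff sum_fun_apply chart_vec_def)

lemma chart_vec_expansion:
  "(\<Sum>i<n. y i *\<^sub>R chart_vec n (\<lambda>k. if k = i then 1 else 0)) = chart_vec n y"
  unfolding chart_vec_linear chart_vec_sum chart_vec_eq_iff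
proof (intro allI impI)
  fix k assume "k < n"
  have "(\<Sum>i<n. y i * (if k = i then 1 else 0)) = (\<Sum>i<n. if k = i then y i else 0)"
    by (rule sum.cong) auto
  then show "(\<Sum>i<n. y i * (if k = i then 1 else 0)) = y k" using \<open>k < n\<close> by simp
qed

lemma extend_field_cube:
  assumes "q \<in> cube n"
  shows "extend_field n {cube_chart n} (cube_chart n) v q = chart_vec n (v (cube_chart n))"
  unfolding extend_field_def using assms
  by (simp add: coord_field_cube chart_vec_expansion)

lemma subspace_range_chart_vec: "subspace (range (chart_vec n))"
  by (auto simp: subspace_def chart_vec_linear)
    (metis (no_types, lifting) chart_vec_def ext rangeI zero_fun_def)

section \<open>The curvature tensor in coordinates\<close>

text \<open>Decouples the tensor calculus from power series: the metric, its inverse and the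
  derivatives are arbitrary functions with the stated relations, and \<open>H1\<close> merely has to
  be some derivative of \<open>H\<close>.\<close>

locale chart_metric =
  fixes n :: nat and G H :: "nat \<Rightarrow> nat \<Rightarrow> (nat \<Rightarrow> real) \<Rightarrow> real"
    and G1 H1 :: "nat \<Rightarrow> nat \<Rightarrow> nat \<Rightarrow> (nat \<Rightarrow> real) \<Rightarrow> real"
    and G2 :: "nat \<Rightarrow> nat \<Rightarrow> nat \<Rightarrow> nat \<Rightarrow> (nat \<Rightarrow> real) \<Rightarrow> real"
  assumes G_sym: "x \<in> cube n \<Longrightarrow> G i j x = G j i x"
    and dG: "x \<in> cube n \<Longrightarrow> k < n \<Longrightarrow> ((\<lambda>t. G i j (x(k := t))) has_real_derivative G1 k i j x) (at (x k))"
    and dG1: "x \<in> cube n \<Longrightarrow> k < n \<Longrightarrow>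
      ((\<lambda>t. G1 l i j (x(k := t))) has_real_derivative G2 k l i j x) (at (x k))"
    and dH: "x \<in> cube n \<Longrightarrow> k < n \<Longrightarrow> ((\<lambda>t. H i j (x(k := t))) has_real_derivative H1 k i j x) (at (x k))"
    and G1_sym: "x \<in> cube n \<Longrightarrow> G1 k i j x = G1 k j i x"
    and G2_sym: "x \<in> cube n \<Longrightarrow> G2 k l i j x = G2 l k i j x"
      "x \<in> cube n \<Longrightarrow> G2 k l i j x = G2 k l j i x"
    and GH: "x \<in> cube n \<Longrightarrow> i < n \<Longrightarrow> j < n \<Longrightarrow> (\<Sum>k<n. G i k x * H k j x) = (if i = j then 1 else 0)"
    and G_analytic: "real_analytic_on n (cube n) (G i j)"
begin

abbreviation (input) ch :: "(nat \<Rightarrow> real) chart" where "ch \<equiv> cube_chart n"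

definition metric :: "(nat \<Rightarrow> real) \<Rightarrow> (nat \<Rightarrow> real) tvec \<Rightarrow> (nat \<Rightarrow> real) tvec \<Rightarrow> real" where
  "metric p v w = (\<Sum>i<n. \<Sum>j<n. G i j p * v ch i * w ch j)"

definition Gam_low :: "nat \<Rightarrow> nat \<Rightarrow> nat \<Rightarrow> (nat \<Rightarrow> real) \<Rightarrow> real" where
  "Gam_low l i j x = (G1 i j l x + G1 j i l x - G1 l i j x) / 2"

definition Gam :: "nat \<Rightarrow> nat \<Rightarrow> nat \<Rightarrow> (nat \<Rightarrow> real) \<Rightarrow> real" where
  "Gam k i j x = (\<Sum>l<n. H k l x * Gam_low l i j x)"

definition Gam_low1 :: "nat \<Rightarrow> nat \<Rightarrow> nat \<Rightarrow> nat \<Rightarrow> (nat \<Rightarrow> real) \<Rightarrow> real" where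
  "Gam_low1 m l i j x = (G2 m i j l x + G2 m j i l x - G2 m l i j x) / 2"

definition Gam1 :: "nat \<Rightarrow> nat \<Rightarrow> nat \<Rightarrow> nat \<Rightarrow> (nat \<Rightarrow> real) \<Rightarrow> real" where
  "Gam1 m k i j x = (\<Sum>l<n. H1 m k l x * Gam_low l i j x + H k l x * Gam_low1 m l i j x)"

text \<open>The lowered curvature in Christoffel symbols of the first kind. In this form no
  derivative of the inverse metric occurs, and the two parts match \<open>curv_lin\<close> and
  \<open>curv_quad\<close>.\<close>

definition Riem :: "nat \<Rightarrow> nat \<Rightarrow> nat \<Rightarrow> nat \<Rightarrow> (nat \<Rightarrow> real) \<Rightarrow> real" where
  "Riem i j k l x = (G2 i k j l x - G2 j k i l x - G2 i l j k x + G2 j l i k x) / 2 -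
     (\<Sum>p<n. \<Sum>q<n. H p q x * (Gam_low p j k x * Gam_low q i l x - Gam_low p i k x * Gam_low q j l x))"

lemma metric_chart_vec:
  "metric p (chart_vec n y) (chart_vec n z) = (\<Sum>i<n. \<Sum>j<n. G i j p * y i * z j)"
  by (simp add: metric_def)

lemma metric_coeff_cube:
  assumes "p \<in> cube n" "i < n" "j < n"
  shows "metric_coeff n {ch} metric ch i j p = G i j p"
proof -
  have "metric_coeff n {ch} metric ch i j p =
      (\<Sum>a<n. \<Sum>b<n. G a b p * (if a = i then 1 else 0) * (if b = j then 1 else 0))"
    using assms by (simp add: metric_coeff_def coord_field_cube metric_chart_vec)
  also have "\<dots> = (\<Sum>a<n. if a = i then G i j p else 0)"
    using assms by (intro sum.cong refl) (auto simp: if_distrib[of "\<lambda>x. _ * x"] cong: if_cong)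
  finally show ?thesis using assms by simp
qed

lemma H_sym:
  assumes "x \<in> cube n" "i < n" "j < n"
  shows "H i j x = H j i x"
  using right_inverse_symmetric[of "{..<n}" "\<lambda>i j. G i j x" "\<lambda>i j. H i j x" "\<lambda>i j. H i j x" i j]
    assms G_sym GH by simp

lemma christoffel_cube:
  assumes p: "p \<in> cube n" and ij: "k < n" "i < n" "j < n"
  shows "christoffel n {ch} metric ch k i j p = Gam k i j p"
proof -
  have "inverse_matrix_on {..<n} (\<lambda>a b. metric_coeff n {ch} metric ch a b p) =
      (\<lambda>i j. if i \<in> {..<n} \<and> j \<in> {..<n} then H i j p else 0)"
  proof (rule inverse_matrix_on_eq)
    fix i j assume ij: "i \<in> {..<n}" "j \<in> {..<n}"
    then have "(\<Sum>k<n. metric_coeff n {ch} metric ch i k p * H k j p) = (\<Sum>k<n. G i k p * H k j p)"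
      by (intro sum.cong refl) (simp add: metric_coeff_cube[OF p])
    then show "(\<Sum>k\<in>{..<n}. metric_coeff n {ch} metric ch i k p * H k j p) = (if i = j then 1 else 0)"
      using ij GH[OF p] by simp
    show "metric_coeff n {ch} metric ch i j p = metric_coeff n {ch} metric ch j i p"
      using ij G_sym[OF p, of i j] by (simp add: metric_coeff_cube[OF p])
  qed simp
  moreover have "chart_partial ch a (metric_coeff n {ch} metric ch b c) p = G1 a b c p"
    if "a < n" "b < n" "c < n" for a b c
    by (rule chart_partial_cube[OF p _ _ dG[OF p]]) (use that metric_coeff_cube in auto)
  ultimately show ?thesis
    using ij by (simp add: christoffel_def Gam_def Gam_low_def sum_divide_distrib)
qed

lemma dGam_low:
  assumes "x \<in> cube n" "m < n"
  shows "((\<lambda>t. Gam_low l i j (x(m := t))) has_real_derivative Gam_low1 m l i j x) (at (x m))"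
  unfolding Gam_low_def Gam_low1_def
  by (intro DERIV_cdivide DERIV_add DERIV_diff dG1 assms)

lemma dGam:
  assumes "x \<in> cube n" "m < n"
  shows "((\<lambda>t. Gam k i j (x(m := t))) has_real_derivative Gam1 m k i j x) (at (x m))"
proof -
  have "((\<lambda>t. Gam k i j (x(m := t))) has_real_derivative
      (\<Sum>l<n. H1 m k l x * Gam_low l i j (x(m := x m)) + Gam_low1 m l i j x * H k l (x(m := x m)))) (at (x m))"
    unfolding Gam_def by (intro DERIV_sum DERIV_mult dGam_low dH assms)
  then show ?thesis by (simp add: Gam1_def mult.commute)
qed

lemma levi_civita_const:
  assumes q: "q \<in> cube n"
    and YZ: "\<And>q. q \<in> cube n \<Longrightarrow> Y q = chart_vec n y" "\<And>q. q \<in> cube n \<Longrightarrow> Z q = chart_vec n z"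
  shows "levi_civita n {ch} metric Y Z q = chart_vec n (\<lambda>k. \<Sum>i<n. y i * (\<Sum>j<n. Gam k i j q * z j))"
proof -
  have "chart_partial ch i (\<lambda>q. Z q ch k) q = 0" if "i < n" for i k
    by (rule chart_partial_const[OF q that, of _ "if k < n then z k else 0"]) (simp add: YZ)
  then show ?thesis
    using q by (auto simp: levi_civita_def charts_at_cube chart_vec_def fun_eq_iff YZ christoffel_cube)
qed


lemma levi_civita_field:
  assumes p: "p \<in> cube n" and X: "X p = chart_vec n x"
    and Y: "\<And>q. q \<in> cube n \<Longrightarrow> Y q = chart_vec n (\<lambda>k. F k q)"
    and F: "\<And>i k. i < n \<Longrightarrow> k < n \<Longrightarrow> ((\<lambda>t. F k (p(i := t))) has_real_derivative D i k) (at (p i))"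
  shows "levi_civita n {ch} metric X Y p =
    chart_vec n (\<lambda>k. \<Sum>i<n. x i * (D i k + (\<Sum>j<n. Gam k i j p * F j p)))"
proof -
  have "chart_partial ch i (\<lambda>q. Y q ch k) p = D i k" if "i < n" "k < n" for i k
    by (rule chart_partial_cube[OF p that(1) _ F[OF that]]) (simp add: Y that)
  then show ?thesis
    using p by (auto simp: levi_civita_def charts_at_cube chart_vec_def fun_eq_iff X Y christoffel_cube)
qed

lemma Gam_lower:
  assumes x: "x \<in> cube n" and l: "l < n"
  shows "(\<Sum>k<n. G l k x * Gam k i j x) = Gam_low l i j x"
proof -
  have "(\<Sum>k<n. G l k x * Gam k i j x) = (\<Sum>k<n. \<Sum>q<n. G l k x * H k q x * Gam_low q i j x)"
    by (simp add: Gam_def sum_distrib_left mult.assoc)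
  also have "\<dots> = (\<Sum>q<n. (\<Sum>k<n. G l k x * H k q x) * Gam_low q i j x)"
    by (subst sum.swap) (simp add: sum_distrib_right)
  also have "\<dots> = (\<Sum>q<n. if l = q then Gam_low l i j x else 0)"
    using GH[OF x l] by (intro sum.cong refl) auto
  finally show ?thesis using l by simp
qed

text \<open>Differentiates the identity \<open>Gam_lower\<close> instead of the definition of
  \<open>Gam\<close>; comparing the two derivatives of the same function eliminates
  \<open>H1\<close>.\<close>

lemma Gam1_lower:
  assumes x: "x \<in> cube n" and "l < n" "m < n"
  shows "(\<Sum>k<n. G l k x * Gam1 m k i j x) = Gam_low1 m l i j x - (\<Sum>k<n. G1 m l k x * Gam k i j x)"
proof -
  have "((\<lambda>t. \<Sum>k<n. G l k (x(m := t)) * Gam k i j (x(m := t))) has_real_derivative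
      Gam_low1 m l i j x) (at (x m))"
    by (rule cube_has_derivative_cong[OF x \<open>m < n\<close> _ dGam_low[OF x \<open>m < n\<close>]])
      (rule Gam_lower[OF _ \<open>l < n\<close>, symmetric])
  moreover have "((\<lambda>t. \<Sum>k<n. G l k (x(m := t)) * Gam k i j (x(m := t))) has_real_derivative
      (\<Sum>k<n. G1 m l k x * Gam k i j (x(m := x m)) + Gam1 m k i j x * G l k (x(m := x m)))) (at (x m))"
    by (intro DERIV_sum DERIV_mult dG dGam x \<open>m < n\<close>)
  ultimately have "Gam_low1 m l i j x = (\<Sum>k<n. G1 m l k x * Gam k i j x + Gam1 m k i j x * G l k x)"
    using DERIV_unique by fastforce
  then show ?thesis by (simp add: sum.distrib mult.commute)
qed

text \<open>The components of \<open>\<nabla>\<^sub>i \<nabla>\<^sub>j \<partial>\<^sub>k\<close>.\<close>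

definition second_cov :: "nat \<Rightarrow> nat \<Rightarrow> nat \<Rightarrow> nat \<Rightarrow> (nat \<Rightarrow> real) \<Rightarrow> real" where
  "second_cov i j k m x = Gam1 i m j k x + (\<Sum>q<n. Gam m i q x * Gam q j k x)"

text \<open>After \<open>Gam1_lower\<close> the term with \<open>G1 i l q\<close> is split by
  compatibility of the connection with the metric into \<open>Gam_low l i q + Gam_low q i l\<close>.
  The first half cancels the product coming from the outer covariant derivative.\<close>

lemma second_cov_lower:
  assumes x: "x \<in> cube n" and "l < n" "i < n"
  shows "(\<Sum>m<n. G m l x * second_cov i j k m x) =
    Gam_low1 i l j k x - (\<Sum>q<n. \<Sum>p<n. H p q x * (Gam_low p j k x * Gam_low q i l x))"
proof -
  have "(\<Sum>m<n. G l m x * (\<Sum>q<n. Gam m i q x * Gam q j k x)) =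
      (\<Sum>q<n. (\<Sum>m<n. G l m x * Gam m i q x) * Gam q j k x)"
    by (simp add: sum_distrib_left sum_distrib_right mult.assoc) (rule sum.swap)
  also have "\<dots> = (\<Sum>q<n. Gam_low l i q x * Gam q j k x)"
    by (simp add: Gam_lower[OF x \<open>l < n\<close>])
  finally have 1: "(\<Sum>m<n. G l m x * (\<Sum>q<n. Gam m i q x * Gam q j k x)) =
      (\<Sum>q<n. Gam_low l i q x * Gam q j k x)" .
  have "G1 i l q x = Gam_low l i q x + Gam_low q i l x" for q
    using G1_sym[OF x, of i q l] G1_sym[OF x, of l i q] G1_sym[OF x, of q i l]
    by (simp add: Gam_low_def field_simps)
  then have 2: "(\<Sum>q<n. G1 i l q x * Gam q j k x) =
      (\<Sum>q<n. Gam_low l i q x * Gam q j k x) + (\<Sum>q<n. Gam_low q i l x * Gam q j k x)"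
    by (simp add: distrib_right sum.distrib)
  have "(\<Sum>q<n. Gam_low q i l x * Gam q j k x) =
      (\<Sum>q<n. \<Sum>p<n. H p q x * (Gam_low p j k x * Gam_low q i l x))"
    by (auto simp: Gam_def sum_distrib_left H_sym[OF x] mult_ac intro!: sum.cong)
  then show ?thesis
    using 1 2 Gam1_lower[OF x \<open>l < n\<close> \<open>i < n\<close>, of j k] G_sym[OF x, of _ l]
    by (simp add: second_cov_def distrib_left sum.distrib)
qed

lemma Riem_second_cov:
  assumes x: "x \<in> cube n" and "l < n" "i < n" "j < n"
  shows "(\<Sum>m<n. G m l x * (second_cov i j k m x - second_cov j i k m x)) = Riem i j k l x"
proof -
  have "Gam_low1 i l j k x - Gam_low1 j l i k x =
      (G2 i k j l x - G2 j k i l x - G2 i l j k x + G2 j l i k x) / 2"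
    using G2_sym[OF x] by (simp add: Gam_low1_def field_simps)
  moreover have "(\<Sum>q<n. \<Sum>p<n. H p q x * (Gam_low p j k x * Gam_low q i l x)) =
      (\<Sum>p<n. \<Sum>q<n. H p q x * (Gam_low p j k x * Gam_low q i l x))"
    "(\<Sum>q<n. \<Sum>p<n. H p q x * (Gam_low p i k x * Gam_low q j l x)) =
      (\<Sum>p<n. \<Sum>q<n. H p q x * (Gam_low p i k x * Gam_low q j l x))"
    by (rule sum.swap)+
  ultimately show ?thesis
    using second_cov_lower[OF x \<open>l < n\<close> \<open>i < n\<close>, of j k] second_cov_lower[OF x \<open>l < n\<close> \<open>j < n\<close>, of i k]
    by (simp add: Riem_def right_diff_distrib sum_subtractf)
qed

text \<open>The extended fields have constant components in the only chart, so their bracket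
  vanishes and the nested derivatives reduce to \<open>second_cov\<close>.\<close>

lemma curvature_tensor_cube:
  assumes p: "p \<in> cube n"
  shows "curvature_tensor n {ch} metric p v1 v2 v3 v4 =
    (\<Sum>i<n. \<Sum>j<n. \<Sum>k<n. \<Sum>l<n. Riem i j k l p * v1 ch i * v2 ch j * v3 ch k * v4 ch l)"
proof -
  define x y z w where v: "x = v1 ch" "y = v2 ch" "z = v3 ch" "w = v4 ch"
  have c: "(SOME c. c \<in> charts_at {ch} p) = ch" using p by (simp add: charts_at_cube)
  define X Y Z where XYZ: "X = extend_field n {ch} ch v1" "Y = extend_field n {ch} ch v2"
    "Z = extend_field n {ch} ch v3"
  have fld: "X q = chart_vec n x" "Y q = chart_vec n y" "Z q = chart_vec n z" if "q \<in> cube n" for q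
    using that by (simp_all add: XYZ v extend_field_cube)
  let ?D = "levi_civita n {ch} metric"
  have D2: "?D X' (?D Y' Z) p = chart_vec n (\<lambda>m. \<Sum>i<n. \<Sum>j<n. \<Sum>k<n. x' i * y' j * z k * second_cov i j k m p)"
    if X': "\<And>q. q \<in> cube n \<Longrightarrow> X' q = chart_vec n x'" and Y': "\<And>q. q \<in> cube n \<Longrightarrow> Y' q = chart_vec n y'"
    for X' Y' x' y'
  proof -
    have "?D X' (?D Y' Z) p = chart_vec n (\<lambda>m. \<Sum>i<n. x' i *
        ((\<Sum>j<n. y' j * (\<Sum>k<n. Gam1 i m j k p * z k)) +
         (\<Sum>q<n. Gam m i q p * (\<Sum>j<n. y' j * (\<Sum>k<n. Gam q j k p * z k)))))"
    proof (rule levi_civita_field[where F = "\<lambda>m q. \<Sum>j<n. y' j * (\<Sum>k<n. Gam m j k q * z k)"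
          and D = "\<lambda>i m. \<Sum>j<n. y' j * (\<Sum>k<n. Gam1 i m j k p * z k)"])
      show "p \<in> cube n" "X' p = chart_vec n x'" using p X' by auto
      show "?D Y' Z q = chart_vec n (\<lambda>m. \<Sum>j<n. y' j * (\<Sum>k<n. Gam m j k q * z k))" if "q \<in> cube n" for q
        by (rule levi_civita_const[OF that Y' fld(3)])
      show "((\<lambda>t. \<Sum>j<n. y' j * (\<Sum>k<n. Gam m j k (p(i := t)) * z k)) has_real_derivative
          (\<Sum>j<n. y' j * (\<Sum>k<n. Gam1 i m j k p * z k))) (at (p i))" if "i < n" "m < n" for i m
        by (intro DERIV_sum DERIV_cmult DERIV_cmult_right dGam p that)
    qed
    also have "(\<lambda>m. \<Sum>i<n. x' i * ((\<Sum>j<n. y' j * (\<Sum>k<n. Gam1 i m j k p * z k)) +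
         (\<Sum>q<n. Gam m i q p * (\<Sum>j<n. y' j * (\<Sum>k<n. Gam q j k p * z k))))) =
         (\<lambda>m. \<Sum>i<n. \<Sum>j<n. \<Sum>k<n. x' i * y' j * z k * second_cov i j k m p)"
    proof (intro ext sum.cong refl)
      fix m i
      have "(\<Sum>q<n. Gam m i q p * (\<Sum>j<n. y' j * (\<Sum>k<n. Gam q j k p * z k))) =
          (\<Sum>q<n. \<Sum>j<n. \<Sum>k<n. y' j * z k * (Gam m i q p * Gam q j k p))"
        by (simp add: sum_distrib_left mult_ac)
      also have "\<dots> = (\<Sum>j<n. \<Sum>k<n. \<Sum>q<n. y' j * z k * (Gam m i q p * Gam q j k p))"
        by (rule sum_inner_last_first[symmetric])
      finally show "x' i * ((\<Sum>j<n. y' j * (\<Sum>k<n. Gam1 i m j k p * z k)) +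
         (\<Sum>q<n. Gam m i q p * (\<Sum>j<n. y' j * (\<Sum>k<n. Gam q j k p * z k)))) =
         (\<Sum>j<n. \<Sum>k<n. x' i * y' j * z k * second_cov i j k m p)"
        by (simp add: second_cov_def sum_distrib_left distrib_left sum.distrib mult_ac)
    qed
    finally show ?thesis .
  qed
  have bracket: "lie_bracket n {ch} X Y p = chart_vec n (\<lambda>_. 0)"
  proof -
    have "chart_partial ch i (\<lambda>q. W q ch k) p = 0"
      if "i < n" "\<And>q. q \<in> cube n \<Longrightarrow> W q = chart_vec n u" for i k W u
      by (rule chart_partial_const[OF p that(1), of _ "if k < n then u k else 0"]) (simp add: that(2))
    from this[OF _ fld(1)] this[OF _ fld(2)] show ?thesis
      using p by (auto simp: lie_bracket_def charts_at_cube chart_vec_def fun_eq_iff)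
  qed
  \<comment> \<open>The derivative at \<open>p\<close> sees the direction field only through its
    value at \<open>p\<close>, so the vanishing of the bracket at this one point suffices.\<close>
  have D0: "?D (lie_bracket n {ch} X Y) Z p = chart_vec n (\<lambda>_. 0)"
  proof -
    have "lie_bracket n {ch} X Y p ch i = 0" for i using bracket by simp
    then show ?thesis
      by (intro ext) (simp add: levi_civita_def charts_at_cube[OF p] chart_vec_def)
  qed
  have "(\<Sum>i<n. \<Sum>j<n. \<Sum>k<n. y i * x j * z k * second_cov i j k m p) =
      (\<Sum>i<n. \<Sum>j<n. \<Sum>k<n. x i * y j * z k * second_cov j i k m p)" for m
    by (subst sum.swap) (simp add: mult_ac)
  then have op: "?D X (?D Y Z) p - ?D Y (?D X Z) p - ?D (lie_bracket n {ch} X Y) Z p =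
      chart_vec n (\<lambda>m. \<Sum>i<n. \<Sum>j<n. \<Sum>k<n. x i * y j * z k * (second_cov i j k m p - second_cov j i k m p))"
    by (simp add: D2[OF fld(1) fld(2)] D2[OF fld(2) fld(1)] D0 chart_vec_linear
        sum_subtractf right_diff_distrib)
  have "curvature_tensor n {ch} metric p v1 v2 v3 v4 = metric p (chart_vec n (\<lambda>m. \<Sum>i<n. \<Sum>j<n. \<Sum>k<n.
      x i * y j * z k * (second_cov i j k m p - second_cov j i k m p))) v4"
    unfolding curvature_tensor_def Let_def c XYZ[symmetric] op ..
  also have "\<dots> = (\<Sum>m<n. \<Sum>l<n. G m l p * (\<Sum>i<n. \<Sum>j<n. \<Sum>k<n.
      x i * y j * z k * (second_cov i j k m p - second_cov j i k m p)) * w l)"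
    by (simp add: metric_def v)
  also have "\<dots> = (\<Sum>l<n. \<Sum>m<n. \<Sum>i<n. \<Sum>j<n. \<Sum>k<n.
      x i * y j * z k * w l * (G m l p * (second_cov i j k m p - second_cov j i k m p)))"
    by (subst sum.swap) (simp add: sum_distrib_left sum_distrib_right mult_ac)
  also have "\<dots> = (\<Sum>l<n. \<Sum>i<n. \<Sum>j<n. \<Sum>k<n. \<Sum>m<n.
      x i * y j * z k * w l * (G m l p * (second_cov i j k m p - second_cov j i k m p)))"
    by (rule sum.cong[OF refl], subst sum.swap, rule sum.cong[OF refl])
      (rule sum_inner_last_first[symmetric])
  also have "\<dots> = (\<Sum>l<n. \<Sum>i<n. \<Sum>j<n. \<Sum>k<n. x i * y j * z k * w l * Riem i j k l p)"
    by (simp add: sum_distrib_left[symmetric] Riem_second_cov[OF p])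
  also have "\<dots> = (\<Sum>i<n. \<Sum>j<n. \<Sum>k<n. \<Sum>l<n. x i * y j * z k * w l * Riem i j k l p)"
    by (subst sum.swap, rule sum.cong[OF refl]) (rule sum_inner_last_first[symmetric])
  finally show ?thesis by (simp add: v mult_ac)
qed

end

section \<open>Nondegeneracy and scalar curvature in the chart\<close>

definition comp :: "nat \<Rightarrow> nat \<Rightarrow> (nat \<Rightarrow> real) tvec \<Rightarrow> real" where
  "comp n i v = v (cube_chart n) i"

lemma comp_linear: "comp n i (v + w) = comp n i v + comp n i w" "comp n i (r *\<^sub>R v) = r * comp n i v"
  by (simp_all add: comp_def plus_fun_def scaleR_fun_def)

lemma sum_kronecker:
  fixes f :: "nat \<Rightarrow> real"
  assumes "j < n"
  shows "(\<Sum>i<n. f i * (if i = j then 1 else 0)) = f j"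
proof -
  have "(\<Sum>i<n. f i * (if i = j then 1 else 0)) = (\<Sum>i<n. if i = j then f i else 0)"
    by (rule sum.cong) auto
  then show ?thesis using assms by simp
qed

lemma comp_chart_vec: "comp n i (chart_vec n y) = (if i < n then y i else 0)"
  by (simp add: comp_def)

lemma comp_combination:
  assumes "finite N" "j < n"
  shows "comp n j (\<Sum>i\<in>N. r i *\<^sub>R chart_vec n (\<lambda>k. if k = i then 1 else 0)) = (if j \<in> N then r j else 0)"
proof -
  have "comp n j (\<Sum>i\<in>N. r i *\<^sub>R chart_vec n (\<lambda>k. if k = i then 1 else 0)) =
      (\<Sum>i\<in>N. if j = i then r j else 0)"
    using assms(2) by (auto simp: comp_def sum_fun_apply scaleR_fun_def intro!: sum.cong)
  then show ?thesis using assms(1) by simp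
qed

context chart_metric
begin

abbreviation (input) TS :: "(nat \<Rightarrow> real) tvec set" where "TS \<equiv> range (chart_vec n)"

abbreviation (input) basis :: "nat \<Rightarrow> (nat \<Rightarrow> real) tvec" where
  "basis i \<equiv> chart_vec n (\<lambda>k. if k = i then 1 else 0)"

lemma metric_comp: "metric p v w = (\<Sum>i<n. \<Sum>j<n. G i j p * comp n i v * comp n j w)"
  by (simp add: metric_def comp_def)

lemma metric_basis_right: "j < n \<Longrightarrow> metric p v (basis j) = (\<Sum>i<n. G i j p * comp n i v)"
  by (simp add: metric_comp comp_chart_vec sum_kronecker)

lemma metric_basis: "i < n \<Longrightarrow> j < n \<Longrightarrow> metric p (basis i) (basis j) = G i j p"
  by (simp add: metric_basis_right comp_chart_vec sum_kronecker)

lemma metric_sym: "p \<in> cube n \<Longrightarrow> metric p v w = metric p w v"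
  unfolding metric_comp by (subst sum.swap) (simp add: G_sym[of p] mult_ac)

text \<open>Applying \<open>H\<close> to the pairings of a vector with the coordinate basis recovers
  its components.\<close>

lemma metric_nondegenerate:
  assumes p: "p \<in> cube n"
  shows "nondegenerate_symmetric_form TS (metric p)"
  unfolding nondegenerate_symmetric_form_def
proof (intro conjI ballI impI)
  show "linear_on TS (\<lambda>x. metric p x y)" "linear_on TS (metric p x)" for x y
    by (simp_all add: linear_on_def metric_comp comp_linear algebra_simps sum.distrib sum_distrib_left)
  show "metric p x y = metric p y x" for x y by (rule metric_sym[OF p])
  fix x assume x: "x \<in> TS" "\<forall>y\<in>TS. metric p x y = 0"
  then obtain u where u: "x = chart_vec n u" by blast
  have "u m = 0" if m: "m < n" for m
  proof -
    have "u m = (\<Sum>i<n. u i * (if i = m then 1 else 0))"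
      using m by (simp add: if_distrib cong: if_cong)
    also have "\<dots> = (\<Sum>i<n. \<Sum>j<n. u i * (G i j p * H j m p))"
      by (rule sum.cong[OF refl]) (use GH[OF p _ m] in \<open>simp add: sum_distrib_left[symmetric]\<close>)
    also have "\<dots> = (\<Sum>j<n. (\<Sum>i<n. G i j p * comp n i x) * H j m p)"
      by (subst sum.swap) (simp add: u comp_def sum_distrib_left mult_ac)
    also have "\<dots> = (\<Sum>j<n. metric p x (basis j) * H j m p)"
      by (rule sum.cong[OF refl]) (simp add: metric_basis_right)
    also have "\<dots> = 0" using x(2) by simp
    finally show ?thesis .
  qed
  then have "x = chart_vec n (\<lambda>_. 0)" unfolding u chart_vec_eq_iff by simp
  also have "\<dots> = 0" by (auto simp: chart_vec_def fun_eq_iff zero_fun_def)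
  finally show "x = 0" .
qed

lemma scalar_curvature_cube:
  assumes p: "p \<in> cube n"
  shows "scalar_curvature (tangent_model n {ch} metric p) =
    (\<Sum>i<n. \<Sum>j<n. \<Sum>k<n. \<Sum>l<n. H i l p * H j k p * Riem i j k l p)"
proof -
  let ?R = "curvature_tensor n {ch} metric p"
  have R: "?R v1 v2 v3 v4 =
      (\<Sum>i<n. \<Sum>j<n. \<Sum>k<n. \<Sum>l<n. Riem i j k l p * comp n i v1 * comp n j v2 * comp n k v3 * comp n l v4)"
    for v1 v2 v3 v4
    by (simp add: curvature_tensor_cube[OF p] comp_def)
  have basis_R: "?R (basis i) (basis j) (basis k) (basis l) = Riem i j k l p"
    if "i < n" "j < n" "k < n" "l < n" for i j k l
    using that by (simp add: R comp_chart_vec sum_kronecker)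
  have "scalar_curvature (TS, metric p, ?R) = (\<Sum>i<n. \<Sum>j<n. \<Sum>k<n. \<Sum>l<n.
      H i l p * H j k p * ?R (basis i) (basis j) (basis k) (basis l))"
  proof (rule scalar_curvature_basis[OF subspace_range_chart_vec _ _ metric_nondegenerate[OF p]])
    show "\<exists>r. v = (\<Sum>i<n. r i *\<^sub>R basis i)" if "v \<in> TS" for v
      using that chart_vec_expansion by (metis (no_types, lifting) imageE)
    show "linear_on TS (\<lambda>v. ?R v x y z) \<and> linear_on TS (\<lambda>v. ?R x v y z) \<and>
        linear_on TS (\<lambda>v. ?R x y v z) \<and> linear_on TS (\<lambda>v. ?R x y z v)" for x y z
      unfolding R linear_on_def
      by (simp add: comp_linear algebra_simps sum.distrib sum_distrib_left)
    show "(\<Sum>k<n. metric p (basis i) (basis k) * H k j p) = (if i = j then 1 else 0)"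
      if "i < n" "j < n" for i j
    proof -
      have "(\<Sum>k<n. metric p (basis i) (basis k) * H k j p) = (\<Sum>k<n. G i k p * H k j p)"
        by (rule sum.cong[OF refl]) (use that in \<open>simp add: metric_basis\<close>)
      then show ?thesis using GH[OF p that] by simp
    qed
  qed auto
  also have "\<dots> = (\<Sum>i<n. \<Sum>j<n. \<Sum>k<n. \<Sum>l<n. H i l p * H j k p * Riem i j k l p)"
    by (intro sum.cong refl) (simp add: basis_R)
  finally show ?thesis by (simp add: tangent_model_def tangent_space_cube[OF p])
qed

end

section \<open>Constancy of the signature\<close>

text \<open>A basis of \<open>W\<close> has an independent image since \<open>f\<close> is injective
  on \<open>W\<close>, and an independent set in \<open>span E\<close> has at most
  \<open>card E\<close> members.\<close>

lemma independent_image_card_le: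
  fixes f :: "'a::real_vector \<Rightarrow> 'b::real_vector"
  assumes W: "subspace W" and f: "linear f" and inj: "\<And>w. w \<in> W \<Longrightarrow> f w = 0 \<Longrightarrow> w = 0"
    and fW: "f ` W \<subseteq> span E" and E: "finite E"
  shows "dim W \<le> card E"
proof -
  obtain B where B: "B \<subseteq> W" "independent B" "W \<subseteq> span B" "card B = dim W"
    using basis_exists[of W] by blast
  have "span B = W" using B W by (metis span_minimal subset_antisym)
  have "inj_on f (span B)"
    unfolding \<open>span B = W\<close>
  proof (rule inj_onI)
    fix x y assume "x \<in> W" "y \<in> W" "f x = f y"
    then have "f (x - y) = 0" "x - y \<in> W"
      using linear_diff[OF f] subspace_diff[OF W] by auto
    then show "x = y" using inj by fastforce
  qed
  then have "independent (f ` B)" "card (f ` B) = card B"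
    using linear_independent_injective_image[OF f B(2)] card_image[of f B] span_superset[of B]
    by (auto intro: inj_on_subset)
  then show ?thesis
    using independent_span_bound[OF E, of "f ` B"] fW B by auto
qed

text \<open>The tolerance \<open>s / (n + 1)\<close> per entry adds up to at most
  \<open>s * n / (n + 1)\<close> times the sum of squares, strictly less than the diagonal form
  yields where all signs agree.\<close>

locale near_diagonal_metric = chart_metric +
  fixes s :: real and eps :: "nat \<Rightarrow> real"
  assumes s: "s > 0" and eps: "eps i = 1 \<or> eps i = -1"
    and near: "x \<in> cube n \<Longrightarrow> i < n \<Longrightarrow> j < n \<Longrightarrow>
      \<bar>G i j x - s * (if i = j then eps i else 0)\<bar> \<le> s / (real n + 1)"
begin

text \<open>Each product of components is at most half the sum of their squares; in the double sum
  every square is thereby counted \<open>n\<close> times.\<close>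

lemma metric_near:
  assumes p: "p \<in> cube n"
  shows "\<bar>metric p v v - s * (\<Sum>i<n. eps i * (comp n i v)\<^sup>2)\<bar> \<le>
    s * (real n / (real n + 1)) * (\<Sum>i<n. (comp n i v)\<^sup>2)"
proof -
  let ?y = "\<lambda>i. comp n i v"
  let ?E = "\<lambda>i j. G i j p - s * (if i = j then eps i else 0)"
  have "s * (\<Sum>i<n. eps i * (?y i)\<^sup>2) = (\<Sum>i<n. \<Sum>j<n. s * (if i = j then eps i else 0) * ?y i * ?y j)"
  proof -
    have "(\<Sum>i<n. \<Sum>j<n. s * (if i = j then eps i else 0) * ?y i * ?y j) =
        (\<Sum>i<n. \<Sum>j<n. if i = j then s * (eps i * (?y i)\<^sup>2) else 0)"
      by (intro sum.cong refl) (auto simp: power2_eq_square)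
    then show ?thesis by (simp add: sum_distrib_left)
  qed
  then have eq: "metric p v v - s * (\<Sum>i<n. eps i * (?y i)\<^sup>2) = (\<Sum>i<n. \<Sum>j<n. ?E i j * ?y i * ?y j)"
    by (simp add: metric_comp sum_subtractf left_diff_distrib)
  have "\<bar>\<Sum>i<n. \<Sum>j<n. ?E i j * ?y i * ?y j\<bar> \<le> (\<Sum>i<n. \<bar>\<Sum>j<n. ?E i j * ?y i * ?y j\<bar>)"
    by (rule sum_abs)
  also have "\<dots> \<le> (\<Sum>i<n. \<Sum>j<n. \<bar>?E i j * ?y i * ?y j\<bar>)"
  proof (rule sum_mono)
    show "\<bar>\<Sum>j<n. ?E i j * ?y i * ?y j\<bar> \<le> (\<Sum>j<n. \<bar>?E i j * ?y i * ?y j\<bar>)" for i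
      by (rule sum_abs)
  qed
  also have "\<dots> \<le> (\<Sum>i<n. \<Sum>j<n. s / (real n + 1) * (((?y i)\<^sup>2 + (?y j)\<^sup>2) / 2))"
  proof (intro sum_mono)
    fix i j assume "i \<in> {..<n}" "j \<in> {..<n}"
    have "\<bar>?E i j * ?y i * ?y j\<bar> = \<bar>?E i j\<bar> * (\<bar>?y i\<bar> * \<bar>?y j\<bar>)" by (simp add: abs_mult)
    also have "\<dots> \<le> s / (real n + 1) * (((?y i)\<^sup>2 + (?y j)\<^sup>2) / 2)"
    proof (rule mult_mono)
      show "\<bar>?y i\<bar> * \<bar>?y j\<bar> \<le> ((?y i)\<^sup>2 + (?y j)\<^sup>2) / 2"
        using sum_squares_bound[of "\<bar>?y i\<bar>" "\<bar>?y j\<bar>"] by simp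
    qed (use near[OF p] \<open>i \<in> _\<close> \<open>j \<in> _\<close> s in auto)
    finally show "\<bar>?E i j * ?y i * ?y j\<bar> \<le> s / (real n + 1) * (((?y i)\<^sup>2 + (?y j)\<^sup>2) / 2)" .
  qed
  also have "\<dots> = s * (real n / (real n + 1)) * (\<Sum>i<n. (?y i)\<^sup>2)"
    unfolding sum_distrib_left[symmetric] sum_divide_distrib[symmetric]
    by (simp add: sum.distrib sum_distrib_left[symmetric])
  finally show ?thesis unfolding eq .
qed

text \<open>The argument of Sylvester's law. The span of the negative coordinate directions is
  negative definite; conversely, the projection \<open>f\<close> onto them is injective on any
  negative definite \<open>W\<close>, since on its kernel the form is positive. The value is the
  same at every point.\<close>

lemma form_index_cube:
  assumes p: "p \<in> cube n"
  shows "form_index TS (metric p) = card {i. i < n \<and> eps i = -1}"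
proof -
  define N where "N = {i. i < n \<and> eps i = -1}"
  define E where "E = basis ` N"
  have finN: "finite N" by (simp add: N_def)
  have inj: "inj_on basis N"
  proof (rule inj_onI)
    fix i j assume "i \<in> N" "j \<in> N" "basis i = basis j"
    then show "i = j" unfolding chart_vec_eq_iff N_def by (auto split: if_splits) 
  qed
  have span_zero: "comp n i v = 0" if "v \<in> span E" "i < n" "i \<notin> N" for v i
    using that(1)
  proof (induction rule: span_induct)
    case base
    show ?case by (simp add: subspace_def comp_linear) (simp add: comp_def)
  next
    case (step v)
    then show ?case using that by (auto simp: E_def comp_def)
  qed
  have zero: "v = 0" if "v \<in> TS" "\<And>i. i < n \<Longrightarrow> comp n i v = 0" for v
    using that by (auto simp: comp_def chart_vec_def fun_eq_iff)
  have indep: "independent E"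
    unfolding E_def
  proof (rule independent_if_scalars_zero)
    fix c v assume "(\<Sum>x\<in>basis ` N. c x *\<^sub>R x) = 0" and v: "v \<in> basis ` N"
    then have *: "(\<Sum>i\<in>N. c (basis i) *\<^sub>R basis i) = 0" by (simp add: sum.reindex[OF inj])
    obtain j where j: "j \<in> N" "v = basis j" using v by blast
    have "0 = comp n j (\<Sum>i\<in>N. c (basis i) *\<^sub>R basis i)" unfolding * by (simp add: comp_def)
    also have "\<dots> = c v"
      using j comp_combination[OF finN, of j n "\<lambda>i. c (basis i)"] by (simp add: N_def)
    finally show "c v = 0" by simp
  qed (use finN in simp)
  have E_TS: "span E \<subseteq> TS"
    by (rule span_minimal[OF _ subspace_range_chart_vec]) (auto simp: E_def)
  have pos: "(\<Sum>i<n. (comp n i v)\<^sup>2) > 0" if v: "v \<in> TS" "v \<noteq> 0" for v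
  proof -
    obtain i where "i < n" "comp n i v \<noteq> 0" using zero[OF v(1)] v(2) by blast
    then have "0 < (comp n i v)\<^sup>2" by simp
    also have "\<dots> \<le> (\<Sum>i<n. (comp n i v)\<^sup>2)"
      using \<open>i < n\<close> by (intro member_le_sum) auto
    finally show ?thesis .
  qed
  have small: "s * (real n / (real n + 1)) * q < s * q" if "q > 0" for q
    using that s by (simp add: field_simps)
  have neg: "metric p v v < 0" if v: "v \<in> span E" "v \<noteq> 0" for v
  proof -
    have "(\<Sum>i<n. eps i * (comp n i v)\<^sup>2) = (\<Sum>i<n. - (comp n i v)\<^sup>2)"
    proof (intro sum.cong refl)
      fix i assume "i \<in> {..<n}"
      then show "eps i * (comp n i v)\<^sup>2 = - (comp n i v)\<^sup>2"
        using span_zero[OF v(1), of i] eps[of i] by (auto simp: N_def)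
    qed
    then have "(\<Sum>i<n. eps i * (comp n i v)\<^sup>2) = - (\<Sum>i<n. (comp n i v)\<^sup>2)"
      by (simp add: sum_negf)
    then show ?thesis
      using metric_near[OF p, of v] small[OF pos] E_TS v by fastforce
  qed
  have upper: "dim W \<le> card N"
    if W: "subspace W" "W \<subseteq> TS" "\<forall>w\<in>W. w \<noteq> 0 \<longrightarrow> metric p w w < 0" for W
  proof -
    define f where "f v = (\<Sum>i\<in>N. comp n i v *\<^sub>R basis i)" for v
    have "dim W \<le> card E"
    proof (rule independent_image_card_le[OF W(1)])
      show "linear f"
        by (rule linearI) (simp_all add: f_def comp_linear scaleR_add_left sum.distrib scaleR_sum_right)
      show "f ` W \<subseteq> span E"
        unfolding f_def E_def
        by (rule image_subsetI, rule span_sum, rule span_scale, rule span_base) simp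
      show "finite E" using finN by (simp add: E_def)
      fix w assume w: "w \<in> W" "f w = 0"
      have comp0: "comp n j w = 0" if "j \<in> N" for j
        using comp_combination[OF finN, of j n "\<lambda>i. comp n i w"] that w(2)
        by (simp add: f_def N_def comp_def)
      have "(\<Sum>i<n. eps i * (comp n i w)\<^sup>2) = (\<Sum>i<n. (comp n i w)\<^sup>2)"
      proof (intro sum.cong refl)
        fix i assume "i \<in> {..<n}"
        then show "eps i * (comp n i w)\<^sup>2 = (comp n i w)\<^sup>2"
          using comp0[of i] eps[of i] by (auto simp: N_def)
      qed
      show "w = 0"
      proof (rule ccontr)
        assume "w \<noteq> 0"
        then show False
          using metric_near[OF p, of w] small[OF pos[of w]] W w
            \<open>(\<Sum>i<n. eps i * (comp n i w)\<^sup>2) = (\<Sum>i<n. (comp n i w)\<^sup>2)\<close> by fastforce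
      qed
    qed
    then show ?thesis using card_image[OF inj] by (simp add: E_def)
  qed
  let ?D = "{dim W |W. subspace W \<and> W \<subseteq> TS \<and> (\<forall>w\<in>W. w \<noteq> 0 \<longrightarrow> metric p w w < 0)}"
  have "Max ?D = card N"
  proof (rule Max_eqI)
    have le: "y \<le> card N" if "y \<in> ?D" for y
    proof -
      obtain W where "y = dim W" "subspace W" "W \<subseteq> TS" "\<forall>w\<in>W. w \<noteq> 0 \<longrightarrow> metric p w w < 0"
        using \<open>y \<in> ?D\<close> by (elim CollectE exE conjE)
      then show ?thesis using upper by simp
    qed
    then show "finite ?D" by (intro finite_subset[of ?D "{..card N}"] subsetI) (rule atMost_iff[THEN iffD2], simp_all)
    show "y \<le> card N" if "y \<in> ?D" for y using that by (rule le)
    have "dim (span E) = card N"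
      using dim_span_eq_card_independent[OF indep] card_image[OF inj] by (simp add: E_def)
    then show "card N \<in> ?D"
      using E_TS neg by (intro CollectI exI[of _ "span E"]) (auto intro: subspace_span)
  qed
  then show ?thesis by (simp add: form_index_def N_def)
qed

lemma analytic_pseudo_riemannian_cube:
  "analytic_pseudo_riemannian_manifold (cube_space n) n {ch} metric"
  unfolding analytic_pseudo_riemannian_manifold_def
proof (intro conjI ballI allI impI exI)
  show "analytic_manifold (cube_space n) n {ch}" by (rule analytic_manifold_cube)
  show "nondegenerate_symmetric_form (tangent_space n {ch} p) (metric p)"
    if "p \<in> topspace (cube_space n)" for p
    using that by (simp add: tangent_space_cube metric_nondegenerate)
  show "form_index (tangent_space n {ch} p) (metric p) = card {i. i < n \<and> eps i = -1}"
    if "p \<in> topspace (cube_space n)" for p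
    using that by (simp add: tangent_space_cube form_index_cube)
  show "real_analytic_on n (snd c ` fst c) (\<lambda>x. metric_coeff n {ch} metric c i j (inv_chart c x))"
    if "c \<in> {ch}" "i < n" "j < n" for c i j
  proof -
    have "real_analytic_on n (cube n) (\<lambda>x. metric_coeff n {ch} metric ch i j (inv_chart ch x))"
      by (rule real_analytic_on_cong[OF G_analytic[of i j]])
        (use that in \<open>simp add: inv_chart_cube metric_coeff_cube\<close>)
    moreover have "snd ch ` fst ch = cube n" by (simp add: cube_chart_def)
    ultimately show ?thesis using that by simp
  qed
qed

end

section \<open>Realisation of a curvature model\<close>

text \<open>Membership in \<open>V\<close> and the sign condition are required for all indices, as
  \<open>curvature_components\<close> makes its assumptions for all indices; orthonormality concerns
  those below \<open>n\<close>.\<close>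

definition orthonormal_family ::
    "'v::real_vector set \<Rightarrow> ('v \<Rightarrow> 'v \<Rightarrow> real) \<Rightarrow> nat \<Rightarrow> (nat \<Rightarrow> 'v) \<Rightarrow> (nat \<Rightarrow> real) \<Rightarrow> bool" where
  "orthonormal_family V b n e eps \<longleftrightarrow> (\<forall>i. e i \<in> V) \<and> (\<forall>i. eps i = 1 \<or> eps i = -1) \<and>
     (\<forall>i<n. \<forall>j<n. b (e i) (e j) = (if i = j then eps i else 0))"

context
  fixes V :: "'v::real_vector set" and b
  assumes V: "subspace V" and b: "nondegenerate_symmetric_form V b"
begin

lemma form_linear:
  "y \<in> V \<Longrightarrow> linear_on V (\<lambda>x. b x y)" "x \<in> V \<Longrightarrow> linear_on V (b x)"
  using b by (auto simp: nondegenerate_symmetric_form_def)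

lemma form_sym: "x \<in> V \<Longrightarrow> y \<in> V \<Longrightarrow> b x y = b y x"
  using b by (auto simp: nondegenerate_symmetric_form_def)

lemma form_add_scale:
  assumes "x \<in> V" "y \<in> V" "z \<in> V"
  shows "b (x + y) z = b x z + b y z" "b z (x + y) = b z x + b z y"
    "b (r *\<^sub>R x) z = r * b x z" "b z (r *\<^sub>R x) = r * b z x"
  using form_linear[OF assms(3)] assms by (simp_all add: linear_on_def)

lemma orthonormal_family_sum:
  assumes "orthonormal_family V b n e eps" "j < n"
  shows "b (\<Sum>i<n. r i *\<^sub>R e i) (e j) = r j * eps j"
proof -
  have eV: "\<And>i. e i \<in> V" using assms by (simp add: orthonormal_family_def)
  have "b (\<Sum>i<n. r i *\<^sub>R e i) (e j) = (\<Sum>i<n. r i * b (e i) (e j))"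
    using linear_on_sum[OF form_linear(1)[OF eV] V, of "{..<n}" e r j] eV by simp
  also have "\<dots> = (\<Sum>i<n. if i = j then r j * eps j else 0)"
    using assms by (intro sum.cong refl) (auto simp: orthonormal_family_def)
  finally show ?thesis using assms(2) by simp
qed

lemma orthonormal_family_bound:
  assumes e: "orthonormal_family V b n e eps" and B: "finite B" "span B = V"
  shows "n \<le> card B"
proof -
  have eV: "\<And>i. e i \<in> V" and eps: "\<And>i. eps i \<noteq> 0"
    using e by (auto simp: orthonormal_family_def) (metis zero_neq_neg_one zero_neq_one)
  have inj: "inj_on e {..<n}"
  proof (rule inj_onI)
    fix i j assume "i \<in> {..<n}" "j \<in> {..<n}" "e i = e j"
    then show "i = j"
      using e eps[of i] unfolding orthonormal_family_def by (metis lessThan_iff)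
  qed
  have "independent (e ` {..<n})"
  proof (rule independent_if_scalars_zero)
    fix c v assume 0: "(\<Sum>x\<in>e ` {..<n}. c x *\<^sub>R x) = 0" and "v \<in> e ` {..<n}"
    then obtain j where j: "j < n" "v = e j" by blast
    have "(\<Sum>i<n. c (e i) *\<^sub>R e i) = 0" using 0 by (simp add: sum.reindex[OF inj])
    then have "c (e j) * eps j = b 0 (e j)"
      using orthonormal_family_sum[OF e j(1), of "\<lambda>i. c (e i)"] by simp
    also have "b 0 (e j) = 0"
      using form_add_scale(3)[of 0 0 "e j" 0] eV subspace_0[OF V] by simp
    finally show "c v = 0" using eps j by simp
  qed simp
  moreover have "e ` {..<n} \<subseteq> span B" using eV B by auto
  ultimately have "card (e ` {..<n}) \<le> card B" using independent_span_bound[OF B(1)] by blast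
  then show ?thesis by (simp add: card_image[OF inj])
qed

text \<open>The remainder \<open>v - pr v\<close> is nonzero but may be isotropic, so it cannot
  simply be normalised. If the whole complement \<open>U\<close> were isotropic, polarisation would
  make the form vanish on \<open>U\<close>; the remainder would then be orthogonal to all of
  \<open>V\<close>, against nondegeneracy.\<close>

lemma orthonormal_family_extend:
  assumes e: "orthonormal_family V b n e eps"
    and v: "v \<in> V" "v \<noteq> (\<Sum>i<n. (eps i * b v (e i)) *\<^sub>R e i)"
  shows "\<exists>e' eps'. orthonormal_family V b (Suc n) e' eps'"
proof -
  have eV: "\<And>i. e i \<in> V" and eps: "\<And>i. eps i * eps i = 1"
    using e by (auto simp: orthonormal_family_def) (metis mult_minus_left mult_minus_right mult_1 minus_minus)
  define U where "U = {u\<in>V. \<forall>i<n. b u (e i) = 0}"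
  define pr where "pr v = (\<Sum>i<n. (eps i * b v (e i)) *\<^sub>R e i)" for v
  have prV: "pr v \<in> V" for v
    unfolding pr_def by (intro subspace_sum[OF V] subspace_scale[OF V] eV)
  have diff: "b (x - y) z = b x z - b y z" if "x \<in> V" "y \<in> V" "z \<in> V" for x y z
    using form_add_scale(1)[of x "(-1) *\<^sub>R y" z] form_add_scale(3)[of y y z "-1"]
      subspace_scale[OF V, of y "-1"] that by simp
  have prU: "v - pr v \<in> U" if "v \<in> V" for v
    unfolding U_def
  proof (intro CollectI conjI allI impI)
    show "v - pr v \<in> V" by (rule subspace_diff[OF V that prV])
    fix j assume "j < n"
    have "b (pr v) (e j) = b v (e j)"
      unfolding pr_def using orthonormal_family_sum[OF e \<open>j < n\<close>, of "\<lambda>i. eps i * b v (e i)"] eps[of j]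
      by (simp add: mult_ac)
    then show "b (v - pr v) (e j) = 0" using diff[OF that prV eV] by simp
  qed
  have U: "u + u' \<in> U" if "u \<in> U" "u' \<in> U" for u u'
    using that form_add_scale(1)[OF _ _ eV] by (auto simp: U_def intro: subspace_add[OF V])
  have "\<exists>u\<in>U. b u u \<noteq> 0"
  proof (rule ccontr)
    assume "\<not> ?thesis"
    then have iso: "b u u = 0" if "u \<in> U" for u using that by blast
    have orth: "b u u' = 0" if "u \<in> U" "u' \<in> U" for u u'
    proof -
      have V': "u \<in> V" "u' \<in> V" "u + u' \<in> V" using that U by (auto simp: U_def)
      have "b (u + u') (u + u') = b u u + b u u' + (b u' u + b u' u')"
        using V' by (simp add: form_add_scale)
      then show ?thesis
        using iso[OF that(1)] iso[OF that(2)] iso[OF U[OF that]] form_sym[OF V'(1,2)] by simp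
    qed
    define u where "u = v - pr v"
    have u: "u \<in> U" "u \<in> V" using prU[OF v(1)] by (auto simp: u_def U_def)
    have "b u y = 0" if "y \<in> V" for y
    proof -
      have "b u (pr y) = (\<Sum>i<n. eps i * b y (e i) * b u (e i))"
        unfolding pr_def using linear_on_sum[OF form_linear(2)[OF u(2)] V, of "{..<n}" e "\<lambda>i. eps i * b y (e i)"] eV
        by simp
      also have "\<dots> = 0" using u(1) by (simp add: U_def)
      finally have "b u ((y - pr y) + pr y) = b u (y - pr y)"
        using form_add_scale(2)[of "y - pr y" "pr y" u] u(2) prV subspace_diff[OF V that prV] by simp
      then show ?thesis using orth[OF u(1) prU[OF that]] by simp
    qed
    then have "u = 0" using b u(2) by (auto simp: nondegenerate_symmetric_form_def)
    then show False using v(2) by (simp add: u_def pr_def)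
  qed
  then obtain u where u: "u \<in> V" "\<And>i. i < n \<Longrightarrow> b u (e i) = 0" "b u u \<noteq> 0" by (auto simp: U_def)
  define c where "c = 1 / sqrt \<bar>b u u\<bar>"
  have c: "c * (c * b u u) = sgn (b u u)"
  proof -
    have "c * c = 1 / \<bar>b u u\<bar>" by (simp add: c_def)
    then show ?thesis using u(3) by (simp add: mult.assoc[symmetric] sgn_if)
  qed
  have cu: "c *\<^sub>R u \<in> V" by (rule subspace_scale[OF V u(1)])
  have "b (c *\<^sub>R u) (e i) = 0" "b (e i) (c *\<^sub>R u) = 0" if "i < n" for i
    using u that eV form_sym[OF cu eV, of i] by (simp_all add: form_add_scale)
  moreover have "b (c *\<^sub>R u) (c *\<^sub>R u) = sgn (b u u)"
    using u(1) cu c by (simp add: form_add_scale)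
  ultimately have "orthonormal_family V b (Suc n) (e(n := c *\<^sub>R u)) (eps(n := sgn (b u u)))"
    using e cu u(3) unfolding orthonormal_family_def by (auto simp: less_Suc_eq sgn_if)
  then show ?thesis by blast
qed

text \<open>If no family expanded every vector, extension would produce families of every length,
  against the bound by a finite spanning set.\<close>

lemma exists_orthonormal_basis:
  assumes "finite_dim V"
  obtains n e eps where "orthonormal_family V b n e eps"
    "\<And>v. v \<in> V \<Longrightarrow> v = (\<Sum>i<n. (eps i * b v (e i)) *\<^sub>R e i)"
proof -
  obtain B where B: "finite B" "span B = V" using assms by (auto simp: finite_dim_def)
  have "\<exists>n e eps. orthonormal_family V b n e eps \<and> (\<forall>v\<in>V. v = (\<Sum>i<n. (eps i * b v (e i)) *\<^sub>R e i))"
  proof (rule ccontr)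
    assume *: "\<not> ?thesis"
    have "\<exists>e eps. orthonormal_family V b n e eps" for n
    proof (induction n)
      case 0
      have "orthonormal_family V b 0 (\<lambda>_. 0) (\<lambda>_. 1)"
        using subspace_0[OF V] by (simp add: orthonormal_family_def)
      then show ?case by blast
    next
      case (Suc n)
      then obtain e eps where e: "orthonormal_family V b n e eps" by blast
      then obtain v where "v \<in> V" "v \<noteq> (\<Sum>i<n. (eps i * b v (e i)) *\<^sub>R e i)" using * by blast
      then show ?case by (rule orthonormal_family_extend[OF e])
    qed
    then show False using orthonormal_family_bound[OF _ B] by (metis not_less_eq_eq order_refl)
  qed
  then show thesis using that by blast
qed

end

text \<open>For nonzero \<open>k\<close> and \<open>l\<close> both sides trade two copies of 0 for
  \<open>k\<close> and \<open>l\<close>. It gives the symmetry of \<open>dmet2\<close> in its two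
  differentiations.\<close>

lemma slope_slope_commute: "slope k (slope l f) = slope l (slope k f)"
proof (cases "k = 0 \<or> l = 0")
  case False
  show ?thesis
  proof (rule l1_eqI)
    fix a
    show "coeff (slope k (slope l f)) a = coeff (slope l (slope k f)) a"
    proof (cases "0 \<in># a")
      case True
      then obtain c where "a = add_mset 0 c" by (meson multi_member_split)
      then show ?thesis
        using False by (cases "0 \<in># c") (auto simp: coeff_slope add_mset_commute dest!: multi_member_split)
    qed (use False in \<open>simp add: coeff_slope\<close>)
  qed
qed auto

context curvature_components
begin

lemma dmet1_sym: "dmet1 \<mu> z k i j = dmet1 \<mu> z k j i"
  by (simp add: dmet1_def quad_sym(2)[of _ _ i j] shape_sym[of i j])

lemma dmet2_sym: "dmet2 \<mu> z k l i j = dmet2 \<mu> z l k i j" "dmet2 \<mu> z k l i j = dmet2 \<mu> z k l j i"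
  by (simp_all add: dmet2_def quad_sym(1)[of k l] quad_sym(2)[of k l i j]
      quad_sym(2)[of l k i j] shape_sym[of i j] slope_slope_commute[of k l])

text \<open>For \<open>G = \<mu>^2 met\<close> the lowered curvature is
  \<open>\<mu>^3 (curv_lin - \<mu> curv_quad)\<close>. Two inverse metrics contribute
  \<open>\<mu>^-4\<close> and the contraction of the bracket is \<open>\<mu> scal\<close>, so all
  powers of \<open>\<mu>\<close> cancel in the scalar curvature.\<close>

lemma exists_metric:
  obtains \<mu> G H G1 H1 G2 where "\<mu> > 0" "near_diagonal_metric n G H G1 H1 G2 (\<mu>\<^sup>2) eps"
    "\<And>x. x \<in> cube n \<Longrightarrow> (\<Sum>i<n. \<Sum>j<n. \<Sum>k<n. \<Sum>l<n. H i l x * H j k x * chart_metric.Riem n H G1 G2 i j k l x) = scal"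
    "\<And>i j. G i j (\<lambda>_. 0) = \<mu>\<^sup>2 * (if i = j then eps i else 0)"
    "\<And>i j k l. i < n \<Longrightarrow> j < n \<Longrightarrow> k < n \<Longrightarrow> l < n \<Longrightarrow>
       chart_metric.Riem n H G1 G2 i j k l (\<lambda>_. 0) = \<mu> ^ 4 * a i j k l"
proof -
  have "1 / (real n + 1) > 0" by simp
  then obtain \<mu> z where \<mu>: "\<mu> > 0" and sol: "solution \<mu> z"
    and dm: "\<And>i j. i < n \<Longrightarrow> j < n \<Longrightarrow> norm (dmet \<mu> z i j) \<le> 1 / (real n + 1)"
    using exists_solution by blast
  define G where "G i j x = \<mu>\<^sup>2 * eval (met \<mu> z i j) x" for i j x
  \<comment> \<open>Third power: two factors from \<open>\<mu>^2\<close>, and one because the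
    derivative of \<open>met\<close> is \<open>\<mu> * dmet1\<close>.\<close>
  define G1 where "G1 k i j x = \<mu> ^ 3 * eval (dmet1 \<mu> z k i j) x" for k i j x
  define G2 where "G2 k l i j x = \<mu> ^ 3 * eval (dmet2 \<mu> z k l i j) x" for k l i j x
  define H where "H i j x = inverse (\<mu>\<^sup>2) * eval (inv_met \<mu> z i j) x" for i j x
  \<comment> \<open>The termwise derivative from \<open>eval_has_derivative\<close>; it need not be
    the value of a series in the Banach space.\<close>
  define H1 where "H1 k i j x = inverse (\<mu>\<^sup>2) * (\<Sum>\<^sub>\<infinity>a. coeff (inv_met \<mu> z i j) a *
    (arrangements a * (real (count a k) * monomial x (a - {#k#}))))" for k i j x
  interpret near_diagonal_metric n G H G1 H1 G2 "\<mu>\<^sup>2" eps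
  proof
    show "G i j x = G j i x" for i j x by (simp add: G_def met_sym[OF sol \<mu>, of i j])
    show "((\<lambda>t. G i j (x(k := t))) has_real_derivative G1 k i j x) (at (x k))"
      if "x \<in> cube n" "k < n" for x k i j
      using DERIV_cmult[OF has_partial_met(1)[OF sol \<mu> that, of i j], of "\<mu>\<^sup>2"]
      by (simp add: G_def G1_def power2_eq_square power3_eq_cube mult.assoc)
    show "((\<lambda>t. G1 l i j (x(k := t))) has_real_derivative G2 k l i j x) (at (x k))"
      if "x \<in> cube n" "k < n" for x k l i j
      unfolding G1_def G2_def by (intro DERIV_cmult has_partial_met(2)[OF sol \<mu>] that)
    show "((\<lambda>t. H i j (x(k := t))) has_real_derivative H1 k i j x) (at (x k))"
      if "x \<in> cube n" "k < n" for x k i j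
      unfolding H_def H1_def by (intro DERIV_cmult eval_has_derivative[OF that])
    show "G1 k i j x = G1 k j i x" for x k i j by (simp add: G1_def dmet1_sym[of _ _ k i j])
    show "G2 k l i j x = G2 l k i j x" for x k l i j by (simp add: G2_def dmet2_sym(1)[of _ _ k l])
    show "G2 k l i j x = G2 k l j i x" for x k l i j by (simp add: G2_def dmet2_sym(2)[of _ _ k l i j])
    show "(\<Sum>k<n. G i k x * H k j x) = (if i = j then 1 else 0)"
      if "x \<in> cube n" "i < n" "j < n" for x i j
    proof -
      have "G i k x * H k j x = eval (met \<mu> z i k) x * eval (inv_met \<mu> z k j) x" for k
        using \<mu> by (simp add: G_def H_def field_simps)
      then show ?thesis using met_inverse[OF sol \<mu> that] by simp
    qed
    show "real_analytic_on n (cube n) (G i j)" for i j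
      by (rule real_analytic_on_cong[OF eval_real_analytic[of n "\<mu>\<^sup>2 *\<^sub>R met \<mu> z i j"]])
        (simp add: G_def eval_linear)
    show "\<mu>\<^sup>2 > 0" using \<mu> by simp
    show "eps i = 1 \<or> eps i = -1" for i by (rule eps)
    show "\<bar>G i j x - \<mu>\<^sup>2 * (if i = j then eps i else 0)\<bar> \<le> \<mu>\<^sup>2 / (real n + 1)"
      if x: "x \<in> cube n" "i < n" "j < n" for x i j
    proof -
      have "G i j x - \<mu>\<^sup>2 * (if i = j then eps i else 0) = \<mu>\<^sup>2 * eval (dmet \<mu> z i j) x"
        by (simp add: G_def met_def eval_linear[OF x(1)] eval_const[OF x(1)] diag_def algebra_simps)
      moreover have "\<bar>eval (dmet \<mu> z i j) x\<bar> \<le> 1 / (real n + 1)"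
        using abs_eval_le[OF x(1)] dm[OF x(2,3)] by (rule order_trans)
      ultimately show ?thesis
        using mult_left_mono[of "\<bar>eval (dmet \<mu> z i j) x\<bar>" "1 / (real n + 1)" "\<mu>\<^sup>2"] by (simp add: abs_mult)
    qed
  qed
  have Riem_eq: "Riem i j k l x =
      \<mu> ^ 3 * (eval (curv_lin \<mu> z i j k l) x - \<mu> * eval (curv_quad \<mu> z i j k l) x)"
    if x: "x \<in> cube n" for i j k l x
  proof -
    have low: "Gam_low l i j x = \<mu> ^ 3 * eval (chris \<mu> z l i j) x" for l i j
      by (simp add: Gam_low_def G1_def chris_def eval_linear[OF x] field_simps)
    have summand: "H p q x * (Gam_low p j k x * Gam_low q i l x - Gam_low p i k x * Gam_low q j l x) =
        \<mu> ^ 4 * (eval (inv_met \<mu> z p q) x * (eval (chris \<mu> z p j k) x * eval (chris \<mu> z q i l) x -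
          eval (chris \<mu> z p i k) x * eval (chris \<mu> z q j l) x))" for p q
    proof -
      have "\<mu> ^ 4 = inverse (\<mu>\<^sup>2) * (\<mu> ^ 3 * \<mu> ^ 3)" using \<mu> by (simp add: field_simps power_numeral_reduce)
      then show ?thesis by (simp add: low H_def algebra_simps)
    qed
    have lin: "(G2 i k j l x - G2 j k i l x - G2 i l j k x + G2 j l i k x) / 2 =
        \<mu> ^ 3 * eval (curv_lin \<mu> z i j k l) x"
      by (simp add: G2_def curv_lin_def eval_linear[OF x] field_simps)
    have sq: "(\<Sum>p<n. \<Sum>q<n. H p q x *
        (Gam_low p j k x * Gam_low q i l x - Gam_low p i k x * Gam_low q j l x)) =
        \<mu> ^ 4 * eval (curv_quad \<mu> z i j k l) x"
      unfolding summand
      by (simp only: curv_quad_def eval_linear[OF x] eval_sum[OF x] eval_conv[OF x] sum_distrib_left)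
    show ?thesis
      unfolding Riem_def lin sq by (simp add: algebra_simps power_numeral_reduce)
  qed
  show thesis
  proof (rule that[OF \<mu>])
    show "near_diagonal_metric n G H G1 H1 G2 (\<mu>\<^sup>2) eps" by unfold_locales
    show "(\<Sum>i<n. \<Sum>j<n. \<Sum>k<n. \<Sum>l<n. H i l x * H j k x * Riem i j k l x) = scal"
      if x: "x \<in> cube n" for x
    proof -
      have "H i l x * H j k x * Riem i j k l x = inverse \<mu> * (eval (inv_met \<mu> z i l) x *
          eval (inv_met \<mu> z j k) x * (eval (curv_lin \<mu> z i j k l) x - \<mu> * eval (curv_quad \<mu> z i j k l) x))"
        for i j k l
        unfolding Riem_eq[OF x] H_def using \<mu> by (simp add: field_simps power_numeral_reduce)
      then have "(\<Sum>i<n. \<Sum>j<n. \<Sum>k<n. \<Sum>l<n. H i l x * H j k x * Riem i j k l x) = inverse \<mu> * (\<mu> * scal)"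
        unfolding scalar_curvature_equation[OF sol \<mu> x, symmetric] by (simp only: sum_distrib_left)
      then show ?thesis using \<mu> by simp
    qed
    show "G i j (\<lambda>_. 0) = \<mu>\<^sup>2 * (if i = j then eps i else 0)" for i j
      by (simp add: G_def at_origin[OF sol \<mu>] diag_def)
    show "Riem i j k l (\<lambda>_. 0) = \<mu> ^ 4 * a i j k l" if "i < n" "j < n" "k < n" "l < n" for i j k l
      unfolding Riem_eq[OF zero_in_cube] curv_lin_at_origin[OF sol \<mu> that] at_origin(3)[OF sol \<mu>]
      by (simp add: power_numeral_reduce)
  qed
qed

end

theorem theorem1p2:
  fixes V :: "'v::real_vector set"
    and b :: "'v \<Rightarrow> 'v \<Rightarrow> real"
    and A :: "'v \<Rightarrow> 'v \<Rightarrow> 'v \<Rightarrow> 'v \<Rightarrow> real"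
  assumes "curvature_model (V, b, A)"
  shows "\<exists>(X :: (nat \<Rightarrow> real) topology) n \<A> g P.
           analytic_pseudo_riemannian_manifold X n \<A> g \<and> P \<in> topspace X \<and>
           constant_scalar_curvature X n \<A> g \<and>
           model_isomorphic (V, b, A) (tangent_model n \<A> g P)"
proof -
  have V: "subspace V" and fin: "finite_dim V" and b: "nondegenerate_symmetric_form V b"
    and A: "algebraic_curvature_tensor V A"
    using assms by (auto simp: curvature_model_def)
  obtain n e eps where e: "orthonormal_family V b n e eps"
    and expand: "\<And>v. v \<in> V \<Longrightarrow> v = (\<Sum>i<n. (eps i * b v (e i)) *\<^sub>R e i)"
    using exists_orthonormal_basis[OF V b fin] by blast
  have eV: "\<And>i. e i \<in> V" and eps: "\<And>i. eps i = 1 \<or> eps i = -1"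
    using e by (auto simp: orthonormal_family_def)
  interpret curvature_components n eps "\<lambda>i j k l. A (e i) (e j) (e k) (e l)"
  proof
    have "A x y z w = - A y x z w \<and> A x y z w = A z w x y \<and> A x y z w + A y z x w + A z x y w = 0"
      if "x \<in> V" "y \<in> V" "z \<in> V" "w \<in> V" for x y z w
      using A that unfolding algebraic_curvature_tensor_def by blast
    note A_sym = this[OF eV eV eV eV]
    fix i j k l
    show "eps i = 1 \<or> eps i = -1" by (rule eps)
    show "A (e i) (e j) (e k) (e l) = - A (e j) (e i) (e k) (e l)"
      "A (e i) (e j) (e k) (e l) = A (e k) (e l) (e i) (e j)"
      "A (e i) (e j) (e k) (e l) + A (e j) (e k) (e i) (e l) + A (e k) (e i) (e j) (e l) = 0"
      using A_sym[of i j k l] by blast+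
  qed
  obtain \<mu> G H G1 H1 G2 where \<mu>: "\<mu> > 0" and met: "near_diagonal_metric n G H G1 H1 G2 (\<mu>\<^sup>2) eps"
    and scalar: "\<And>x. x \<in> cube n \<Longrightarrow> (\<Sum>i<n. \<Sum>j<n. \<Sum>k<n. \<Sum>l<n.
        H i l x * H j k x * chart_metric.Riem n H G1 G2 i j k l x) = scal"
    and G0: "\<And>i j. G i j (\<lambda>_. 0) = \<mu>\<^sup>2 * (if i = j then eps i else 0)"
    and R0: "\<And>i j k l. i < n \<Longrightarrow> j < n \<Longrightarrow> k < n \<Longrightarrow> l < n \<Longrightarrow>
       chart_metric.Riem n H G1 G2 i j k l (\<lambda>_. 0) = \<mu> ^ 4 * A (e i) (e j) (e k) (e l)"
    using exists_metric by blast
  interpret near_diagonal_metric n G H G1 H1 G2 "\<mu>\<^sup>2" eps by (rule met)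
  let ?c = "\<lambda>v i. eps i * b v (e i)"
  define \<phi> where "\<phi> v = chart_vec n (\<lambda>i. ?c v i / \<mu>)" for v
  note P = zero_in_cube
  have lin: "b (u + v) (e i) = b u (e i) + b v (e i)" "b (r *\<^sub>R u) (e i) = r * b u (e i)"
    if "u \<in> V" "v \<in> V" for u v i r
    using form_add_scale[OF V b that eV] by auto
  have "linear_on V \<phi>"
    by (auto simp: linear_on_def \<phi>_def chart_vec_linear lin distrib_left add_divide_distrib mult_ac)
  moreover have "bij_betw \<phi> V (range (chart_vec n))"
  proof (rule bij_betw_imageI)
    show "inj_on \<phi> V"
    proof (rule inj_onI)
      fix u v assume uv: "u \<in> V" "v \<in> V" "\<phi> u = \<phi> v"
      then have "?c u i = ?c v i" if "i < n" for i
        using \<mu> that unfolding \<phi>_def chart_vec_eq_iff by simp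
      then have "(\<Sum>i<n. ?c u i *\<^sub>R e i) = (\<Sum>i<n. ?c v i *\<^sub>R e i)"
        by (intro sum.cong refl) (simp only: lessThan_iff)
      then show "u = v" using expand uv by simp
    qed
    show "\<phi> ` V = range (chart_vec n)"
    proof
      show "range (chart_vec n) \<subseteq> \<phi> ` V"
      proof
        fix t assume "t \<in> range (chart_vec n)"
        then obtain y where y: "t = chart_vec n y" by blast
        define v where "v = (\<Sum>i<n. (\<mu> * y i) *\<^sub>R e i)"
        have "v \<in> V" unfolding v_def by (intro subspace_sum[OF V] subspace_scale[OF V] eV)
        moreover have "?c v j / \<mu> = y j" if "j < n" for j
          using orthonormal_family_sum[OF V b e that, of "\<lambda>i. \<mu> * y i"] \<mu>
          by (simp add: v_def mult_ac)
        then have "\<phi> v = t" by (simp add: \<phi>_def y chart_vec_eq_iff)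
        ultimately show "t \<in> \<phi> ` V" by blast
      qed
    qed (auto simp: \<phi>_def)
  qed
  moreover have "metric (\<lambda>_. 0) (\<phi> x) (\<phi> y) = b x y" if xy: "x \<in> V" "y \<in> V" for x y
  proof -
    have "metric (\<lambda>_. 0) (\<phi> x) (\<phi> y) = (\<Sum>i<n. \<Sum>j<n. if i = j then ?c x i * b y (e i) else 0)"
      unfolding \<phi>_def metric_chart_vec G0 using \<mu>
      by (intro sum.cong refl) (simp add: power2_eq_square mult_ac)
    also have "\<dots> = (\<Sum>i<n. ?c x i * b (e i) y)"
      using form_sym[OF V b xy(2) eV] by simp
    also have "\<dots> = b (\<Sum>i<n. ?c x i *\<^sub>R e i) y"
      using linear_on_sum[OF form_linear(1)[OF V b xy(2)] V, of "{..<n}" e "?c x"] eV by simp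
    finally show ?thesis using expand[OF xy(1)] by simp
  qed
  moreover have "curvature_tensor n {ch} metric (\<lambda>_. 0) (\<phi> x) (\<phi> y) (\<phi> z) (\<phi> w) = A x y z w"
    if V4: "x \<in> V" "y \<in> V" "z \<in> V" "w \<in> V" for x y z w
  proof -
    have Alin: "linear_on V (\<lambda>v. A v x y z)" "linear_on V (\<lambda>v. A x v y z)"
      "linear_on V (\<lambda>v. A x y v z)" "linear_on V (\<lambda>v. A x y z v)"
      if "x \<in> V" "y \<in> V" "z \<in> V" for x y z
      using A that unfolding algebraic_curvature_tensor_def by blast+
    have ex: "f v = (\<Sum>i<n. ?c v i * f (e i))" if "linear_on V f" "v \<in> V" for f :: "'v \<Rightarrow> real" and v
    proof -
      have "f v = f (\<Sum>i<n. ?c v i *\<^sub>R e i)" using expand[OF that(2)] by simp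
      also have "\<dots> = (\<Sum>i<n. ?c v i * f (e i))"
        using linear_on_sum[OF that(1) V, of "{..<n}" e "?c v"] eV by simp
      finally show ?thesis .
    qed
    have "curvature_tensor n {ch} metric (\<lambda>_. 0) (\<phi> x) (\<phi> y) (\<phi> z) (\<phi> w) =
        (\<Sum>i<n. \<Sum>j<n. \<Sum>k<n. \<Sum>l<n. ?c x i * (?c y j * (?c z k * (?c w l * A (e i) (e j) (e k) (e l)))))"
      unfolding curvature_tensor_cube[OF P]
      using \<mu> by (intro sum.cong refl) (simp add: \<phi>_def R0 power_numeral_reduce)
    \<comment> \<open>The orthonormal expansion is undone one argument at a time, starting with the
      innermost sum.\<close>
    also have "\<dots> = (\<Sum>i<n. \<Sum>j<n. \<Sum>k<n. ?c x i * (?c y j * (?c z k * A (e i) (e j) (e k) w)))"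
      by (simp only: sum_distrib_left[symmetric] ex[OF Alin(4)[OF eV eV eV] V4(4), symmetric])
    also have "\<dots> = (\<Sum>i<n. \<Sum>j<n. ?c x i * (?c y j * A (e i) (e j) z w))"
      by (simp only: sum_distrib_left[symmetric] ex[OF Alin(3)[OF eV eV V4(4)] V4(3), symmetric])
    also have "\<dots> = (\<Sum>i<n. ?c x i * A (e i) y z w)"
      by (simp only: sum_distrib_left[symmetric] ex[OF Alin(2)[OF eV V4(3,4)] V4(2), symmetric])
    also have "\<dots> = A x y z w"
      by (simp only: ex[OF Alin(1)[OF V4(2-4)] V4(1), symmetric])
    finally show ?thesis .
  qed
  ultimately have "model_isomorphic (V, b, A) (tangent_model n {ch} metric (\<lambda>_. 0))"
    unfolding model_isomorphic_def tangent_model_def tangent_space_cube[OF P] by auto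
  moreover have "constant_scalar_curvature (cube_space n) n {ch} metric"
    unfolding constant_scalar_curvature_def
    by (intro exI[of _ scal] ballI) (simp add: scalar_curvature_cube scalar)
  ultimately show ?thesis
    using analytic_pseudo_riemannian_cube P topspace_cube_space by blast
qed

end
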